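(* Let $S$ be a positive affine semigroup with Hilbert basis $\{s_1,\dots,s_n\}$, and let $A$ be a noetherian connected $\mathbb N^r$-graded $\Bbbk$-algebra. The following statements are equivalent. (1) $A$ has a quantum toric degeneration with associated semigroup $S$. (2) For every presentation $(\pi,P)$ of $S$ there exists a semigroup morphism $\phi:S\to\mathbb N$ such that $A$ is of $(S,\phi)$-type with respect to $(\pi,P)$ (with generators $b_1,\dots,b_n$), and for every section $\tau:S\to\mathbb N^n$ of $\pi$ the set $\{\mathbf b^{\tau(s)}\mid s\in S\}$ is linearly independent. (3) There exist a presentation $(\pi,P)$ of $S$, a semigroup morphism $\phi:S\to\mathbb N$ and a section $\tau:S\to\mathbb N^n$ of $\pi$ such that $A$ is of $(S,\phi)$-type with respect to $(\pi,P)$ (with generators $b_1,\dots,b_n$) and the set $\{\mathbf b^{\tau(s)}\mid s\in S\}$ is linearly independent.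
   Context: $\Bbbk$ is a field. A connected $\mathbb N^r$-graded algebra has degree-$0$ component equal to $\Bbbk$. A positive affine semigroup is a monoid isomorphic to a finitely generated submonoid of some $\mathbb N^m$; its Hilbert basis is its (finite, generating) set of irreducible elements $\{s_1,\dots,s_n\}$. Presentation: a pair $(\pi,P)$ where $\pi:\mathbb N^n\to S$ is the morphism $e_i\mapsto s_i$ and $P=\{(p_1,p_1'),\dots,(p_m,p_m')\}$ is a finite set generating the congruence $L(\pi)=\{(p,p')\mid\pi(p)=\pi(p')\}$ on $\mathbb N^n$ (a congruence is an equivalence relation closed under addition). A section of $\pi$ is a function $\tau:S\to\mathbb N^n$ with $\pi\circ\tau=\mathrm{Id}_S$. $(S,\phi)$-type: let $\phi:S\to\mathbb N$ be a semigroup morphism with $\phi^{-1}(0)=\{0\}$ and $\tilde\phi=\phi\circ\pi$. $A$ is of $(S,\phi)$-type with respect to $(\pi,P)$ if: (i) $A$ is generated as an algebra by homogeneous elements $b_1,\dots,b_n$; write $\mathbf b^\xi=b_1^{\xi_1}\cdots b_n^{\xi_n}$ for $\xi\in\mathbb N^n$; (ii) for all $1\le i<j\le n$ there are $c_{i,j}\in\Bbbk^\times$, $c^{i,j}_\xi\in\Bbbk$ with $b_jb_i=c_{i,j}b_ib_j+\sum_{\tilde\phi(\xi)<\phi(s_i+s_j)}c^{i,j}_\xi\mathbf b^\xi$; (iii) for all $1\le i\le m$ there are $d_i\in\Bbbk^\times$, $d^i_\xi\in\Bbbk$ with $\mathbf b^{p_i'}=d_i\mathbf b^{p_i}+\sum_{\tilde\phi(\xi)<\tilde\phi(p_i)}d^i_\xi\mathbf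 b^\xi$. (The sums are finite.) Linear independence of $\{\mathbf b^{\tau(s)}\mid s\in S\}$ is as a family indexed by $S$. Quantum toric degeneration: a 2-cocycle on $S$ is $\alpha:S\times S\to\Bbbk^\times$ with $\alpha(s,s')\alpha(s+s',s'')=\alpha(s,s'+s'')\alpha(s',s'')$; $\Bbbk^\alpha[S]$ has basis $\{X^s\}_{s\in S}$ and product $X^sX^t=\alpha(s,t)X^{s+t}$. A connected $\mathbb N^t$-graded algebra is a quantum positive affine toric variety with underlying semigroup $S$ if it is isomorphic to some $\Bbbk^\alpha[S]$ with $X^s$ homogeneous of nonzero degree for all $s\ne0$ in the induced grading. A connected filtration on $A$ is a filtration $\Bbbk=F_0A\subset F_1A\subset\cdots$ with $\bigcup_nF_nA=A$, $F_nA\cdot F_mA\subset F_{n+m}A$, each $F_nA$ a finite-dimensional graded subspace. $A$ has a quantum toric degeneration with associated semigroup $S$ if it has a connected filtration whose associated graded ring (an $\mathbb N^{r+1}$-graded algebra) is a quantum positive affine toric variety with underlying semigroup $S$. *)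

theory Defs
  imports
    "HOL-Library.Function_Algebras"
    "HOL-Library.Poly_Mapping"
    "HOL-Algebra.QuotRing"
    "HOL-Algebra.Algebraic_Closure_Type"
begin

text \<open>
  The field is a type \<open>'k :: field\<close>, the semigroup \<open>S\<close> is a type \<open>'s :: comm_monoid_add\<close>, and
  the algebra \<open>A\<close> is a type \<open>'a :: ring_1\<close> with a scalar multiplication
  \<open>scale :: 'k \<Rightarrow> 'a \<Rightarrow> 'a\<close>. The algebras constructed from these (associated graded algebras,
  twisted semigroup algebras) depend on data inside the statement, so they are HOL-Algebra records.
\<close>

section \<open>Positive affine semigroups and their presentations\<close>

text \<open>\<open>\<nat>\<^sup>m\<close> is realised inside \<open>nat \<Rightarrow> nat\<close>; coordinates are numbered from \<open>0\<close>.\<close>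

definition Npow :: "nat \<Rightarrow> (nat \<Rightarrow> nat) set" where
  "Npow m = {v. \<forall>i\<ge>m. v i = 0}"

inductive_set submonoid_generated :: "'m::comm_monoid_add set \<Rightarrow> 'm set" for B where
  zero: "0 \<in> submonoid_generated B"
| add: "b \<in> B \<Longrightarrow> x \<in> submonoid_generated B \<Longrightarrow> b + x \<in> submonoid_generated B"

definition additive_morphism :: "('m::comm_monoid_add \<Rightarrow> 'l::comm_monoid_add) \<Rightarrow> bool" where
  "additive_morphism f \<longleftrightarrow> f 0 = 0 \<and> (\<forall>x y. f (x + y) = f x + f y)"

definition positive_affine_semigroup :: "'s::comm_monoid_add itself \<Rightarrow> bool" where
  "positive_affine_semigroup _ \<longleftrightarrow>
     (\<exists>m B. \<exists>f :: 's \<Rightarrow> nat \<Rightarrow> nat. finite B \<and> B \<subseteq> Npow m \<and>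
        additive_morphism f \<and> bij_betw f UNIV (submonoid_generated B))"

definition hilbert_basis :: "'s::comm_monoid_add set" where
  "hilbert_basis = {s. s \<noteq> 0 \<and> (\<forall>x y. s = x + y \<longrightarrow> x = 0 \<or> y = 0)}"

text \<open>The morphism \<open>\<pi>\<close> from \<open>\<nat>\<^sup>n\<close> to \<open>S\<close> with \<open>e\<^sub>i \<mapsto> s\<^sub>i\<close>; the inner sum is the multiple
  \<open>\<xi>\<^sub>i s\<^sub>i\<close>.\<close>

definition pres_map :: "nat \<Rightarrow> (nat \<Rightarrow> 's::comm_monoid_add) \<Rightarrow> (nat \<Rightarrow> nat) \<Rightarrow> 's" where
  "pres_map n s \<xi> = (\<Sum>i<n. \<Sum>_<\<xi> i. s i)"

definition monoid_congruence :: "nat \<Rightarrow> ((nat \<Rightarrow> nat) \<times> (nat \<Rightarrow> nat)) set \<Rightarrow> bool" where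
  "monoid_congruence n R \<longleftrightarrow> equiv (Npow n) R \<and>
     (\<forall>p p' q q'. (p, p') \<in> R \<longrightarrow> (q, q') \<in> R \<longrightarrow> (p + q, p' + q') \<in> R)"

definition congruence_generated ::
  "nat \<Rightarrow> ((nat \<Rightarrow> nat) \<times> (nat \<Rightarrow> nat)) set \<Rightarrow> ((nat \<Rightarrow> nat) \<times> (nat \<Rightarrow> nat)) set" where
  "congruence_generated n P = \<Inter>{R. monoid_congruence n R \<and> P \<subseteq> R}"

text \<open>Since \<open>\<pi>\<close> is determined by \<open>s\<close>, a presentation is given by \<open>P\<close> alone.\<close>

definition presentation ::
  "nat \<Rightarrow> (nat \<Rightarrow> 's::comm_monoid_add) \<Rightarrow> ((nat \<Rightarrow> nat) \<times> (nat \<Rightarrow> nat)) set \<Rightarrow> bool" where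
  "presentation n s P \<longleftrightarrow> finite P \<and> P \<subseteq> Npow n \<times> Npow n \<and>
     congruence_generated n P =
       {(p, p'). p \<in> Npow n \<and> p' \<in> Npow n \<and> pres_map n s p = pres_map n s p'}"

definition pres_section ::
  "nat \<Rightarrow> (nat \<Rightarrow> 's::comm_monoid_add) \<Rightarrow> ('s \<Rightarrow> nat \<Rightarrow> nat) \<Rightarrow> bool" where
  "pres_section n s \<tau> \<longleftrightarrow> (\<forall>x. \<tau> x \<in> Npow n \<and> pres_map n s (\<tau> x) = x)"

section \<open>Connected graded algebras\<close>

definition k_algebra :: "('k::field, 'b, 'm) module_scheme \<Rightarrow> bool" where
  "k_algebra M \<longleftrightarrow> ring M \<and> Module.module (ring_of_type_algebra :: 'k ring) M \<and>
     (\<forall>c. \<forall>x\<in>carrier M. \<forall>y\<in>carrier M.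
        (c \<odot>\<^bsub>M\<^esub> x) \<otimes>\<^bsub>M\<^esub> y = c \<odot>\<^bsub>M\<^esub> (x \<otimes>\<^bsub>M\<^esub> y) \<and>
        x \<otimes>\<^bsub>M\<^esub> (c \<odot>\<^bsub>M\<^esub> y) = c \<odot>\<^bsub>M\<^esub> (x \<otimes>\<^bsub>M\<^esub> y))"

text \<open>Only the values \<open>G v\<close> with \<open>v \<in> Npow t\<close> matter. The last clause says that the algebra is
  the internal direct sum of these components.\<close>

definition graded_algebra ::
  "nat \<Rightarrow> ('k::field, 'b, 'm) module_scheme \<Rightarrow> ((nat \<Rightarrow> nat) \<Rightarrow> 'b set) \<Rightarrow> bool" where
  "graded_algebra t M G \<longleftrightarrow> k_algebra M \<and>
     (\<forall>v\<in>Npow t. additive_subgroup (G v) M \<and> (\<forall>c. \<forall>x\<in>G v. c \<odot>\<^bsub>M\<^esub> x \<in> G v)) \<and>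
     (\<forall>v\<in>Npow t. \<forall>w\<in>Npow t. \<forall>x\<in>G v. \<forall>y\<in>G w. x \<otimes>\<^bsub>M\<^esub> y \<in> G (v + w)) \<and>
     (\<forall>x\<in>carrier M. \<exists>!f. (\<forall>v\<in>Npow t. f v \<in> G v) \<and> (\<forall>v. v \<notin> Npow t \<longrightarrow> f v = \<zero>\<^bsub>M\<^esub>) \<and>
        finite {v. f v \<noteq> \<zero>\<^bsub>M\<^esub>} \<and> x = finsum M f {v. f v \<noteq> \<zero>\<^bsub>M\<^esub>})"

definition connected_graded_algebra ::
  "nat \<Rightarrow> ('k::field, 'b, 'm) module_scheme \<Rightarrow> ((nat \<Rightarrow> nat) \<Rightarrow> 'b set) \<Rightarrow> bool" where
  "connected_graded_algebra t M G \<longleftrightarrow> graded_algebra t M G \<and>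
     \<one>\<^bsub>M\<^esub> \<noteq> \<zero>\<^bsub>M\<^esub> \<and> G 0 = range (\<lambda>c. c \<odot>\<^bsub>M\<^esub> \<one>\<^bsub>M\<^esub>)"

definition algebra_of_type :: "('k \<Rightarrow> 'a::ring_1 \<Rightarrow> 'a) \<Rightarrow> ('k, 'a) module" where
  "algebra_of_type scale =
     \<lparr>carrier = UNIV, monoid.mult = (*), one = 1, zero = 0, add = (+), module.smult = scale\<rparr>"

text \<open>Noetherian means left and right noetherian, as usual for noncommutative rings.\<close>

definition left_ideal :: "'a::ring_1 set \<Rightarrow> bool" where
  "left_ideal I \<longleftrightarrow> 0 \<in> I \<and> (\<forall>x\<in>I. \<forall>y\<in>I. x + y \<in> I) \<and> (\<forall>a. \<forall>x\<in>I. a * x \<in> I)"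

definition right_ideal :: "'a::ring_1 set \<Rightarrow> bool" where
  "right_ideal I \<longleftrightarrow> 0 \<in> I \<and> (\<forall>x\<in>I. \<forall>y\<in>I. x + y \<in> I) \<and> (\<forall>a. \<forall>x\<in>I. x * a \<in> I)"

definition noetherian_type :: "'a::ring_1 itself \<Rightarrow> bool" where
  "noetherian_type _ \<longleftrightarrow>
     (\<forall>J :: nat \<Rightarrow> 'a set. (\<forall>n. left_ideal (J n)) \<and> mono J \<longrightarrow> (\<exists>N. \<forall>n\<ge>N. J n = J N)) \<and>
     (\<forall>J :: nat \<Rightarrow> 'a set. (\<forall>n. right_ideal (J n)) \<and> mono J \<longrightarrow> (\<exists>N. \<forall>n\<ge>N. J n = J N))"

section \<open>Algebras of \<open>(S,\<phi>)\<close>-type\<close>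

inductive_set subalgebra_generated ::
  "('k \<Rightarrow> 'a::ring_1 \<Rightarrow> 'a) \<Rightarrow> 'a set \<Rightarrow> 'a set" for scale B where
  base: "x \<in> B \<Longrightarrow> x \<in> subalgebra_generated scale B"
| one: "1 \<in> subalgebra_generated scale B"
| add: "x \<in> subalgebra_generated scale B \<Longrightarrow> y \<in> subalgebra_generated scale B \<Longrightarrow>
    x + y \<in> subalgebra_generated scale B"
| scale: "x \<in> subalgebra_generated scale B \<Longrightarrow> scale c x \<in> subalgebra_generated scale B"
| mult: "x \<in> subalgebra_generated scale B \<Longrightarrow> y \<in> subalgebra_generated scale B \<Longrightarrow>
    x * y \<in> subalgebra_generated scale B"

definition monomial_at :: "nat \<Rightarrow> (nat \<Rightarrow> 'a::ring_1) \<Rightarrow> (nat \<Rightarrow> nat) \<Rightarrow> 'a" where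
  "monomial_at n b \<xi> = prod_list (map (\<lambda>i. b i ^ \<xi> i) [0..<n])"

text \<open>The (finite) sums of terms \<open>c\<^sub>\<xi> b\<^sup>\<xi>\<close> over exponents \<open>\<xi>\<close> with \<open>\<phi> (\<pi> \<xi>) < N\<close>.\<close>

definition lower_terms ::
  "('k::field \<Rightarrow> 'a::ring_1 \<Rightarrow> 'a) \<Rightarrow> nat \<Rightarrow> (nat \<Rightarrow> 's::comm_monoid_add) \<Rightarrow> ('s \<Rightarrow> nat) \<Rightarrow>
    (nat \<Rightarrow> 'a) \<Rightarrow> nat \<Rightarrow> 'a set" where
  "lower_terms scale n s \<phi> b N =
     {(\<Sum>\<xi> | c \<xi> \<noteq> 0. scale (c \<xi>) (monomial_at n b \<xi>)) | c.
        finite {\<xi>. c \<xi> \<noteq> 0} \<and> (\<forall>\<xi>. c \<xi> \<noteq> 0 \<longrightarrow> \<xi> \<in> Npow n \<and> \<phi> (pres_map n s \<xi>) < N)}"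

definition S_phi_type ::
  "('k::field \<Rightarrow> 'a::ring_1 \<Rightarrow> 'a) \<Rightarrow> nat \<Rightarrow> ((nat \<Rightarrow> nat) \<Rightarrow> 'a set) \<Rightarrow>
    nat \<Rightarrow> (nat \<Rightarrow> 's::comm_monoid_add) \<Rightarrow> ((nat \<Rightarrow> nat) \<times> (nat \<Rightarrow> nat)) set \<Rightarrow>
    ('s \<Rightarrow> nat) \<Rightarrow> (nat \<Rightarrow> 'a) \<Rightarrow> bool" where
  "S_phi_type scale r \<A> n s P \<phi> b \<longleftrightarrow>
     additive_morphism \<phi> \<and> \<phi> -` {0} = {0} \<and>
     (\<forall>i<n. \<exists>v\<in>Npow r. b i \<in> \<A> v) \<and>
     subalgebra_generated scale (b ` {..<n}) = UNIV \<and>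
     (\<forall>i j. i < j \<and> j < n \<longrightarrow>
        (\<exists>c. c \<noteq> 0 \<and> (\<exists>l \<in> lower_terms scale n s \<phi> b (\<phi> (s i + s j)).
           b j * b i = scale c (b i * b j) + l))) \<and>
     (\<forall>(p, p')\<in>P.
        (\<exists>d. d \<noteq> 0 \<and> (\<exists>l \<in> lower_terms scale n s \<phi> b (\<phi> (pres_map n s p)).
           monomial_at n b p' = scale d (monomial_at n b p) + l)))"

text \<open>Linear independence of the family \<open>f\<close>, indexed by the whole type \<open>'s\<close>.\<close>

definition independent_family :: "('k::field \<Rightarrow> 'a::ring_1 \<Rightarrow> 'a) \<Rightarrow> ('s \<Rightarrow> 'a) \<Rightarrow> bool" where
  "independent_family scale f \<longleftrightarrow> inj f \<and> \<not> Modules.module.dependent scale (range f)"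

section \<open>Twisted semigroup algebras\<close>

definition two_cocycle :: "('s::comm_monoid_add \<Rightarrow> 's \<Rightarrow> 'k::field) \<Rightarrow> bool" where
  "two_cocycle \<alpha> \<longleftrightarrow> (\<forall>x y. \<alpha> x y \<noteq> 0) \<and>
     (\<forall>x y z. \<alpha> x y * \<alpha> (x + y) z = \<alpha> x (y + z) * \<alpha> y z)"

text \<open>\<open>X\<^sup>s\<close> is \<open>Poly_Mapping.single s 1\<close>. Cocycles are not normalised, so the unit is
  \<open>\<alpha>(0,0)\<^sup>-\<^sup>1 X\<^sup>0\<close>.\<close>

definition twisted_algebra ::
  "('s::comm_monoid_add \<Rightarrow> 's \<Rightarrow> 'k::field) \<Rightarrow> ('k, 's \<Rightarrow>\<^sub>0 'k) module" where
  "twisted_algebra \<alpha> =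
     \<lparr>carrier = UNIV,
      monoid.mult = (\<lambda>f g. \<Sum>x\<in>Poly_Mapping.keys f. \<Sum>y\<in>Poly_Mapping.keys g.
                Poly_Mapping.single (x + y)
                  (Poly_Mapping.lookup f x * Poly_Mapping.lookup g y * \<alpha> x y)),
      one = Poly_Mapping.single 0 (inverse (\<alpha> 0 0)),
      zero = 0,
      add = (+),
      module.smult = (\<lambda>c. Poly_Mapping.map ((*) c))\<rparr>"

definition quantum_positive_affine_toric ::
  "nat \<Rightarrow> ('k::field, 'b, 'm) module_scheme \<Rightarrow> ((nat \<Rightarrow> nat) \<Rightarrow> 'b set) \<Rightarrow>
    's::comm_monoid_add itself \<Rightarrow> bool" where
  "quantum_positive_affine_toric t M G _ \<longleftrightarrow> connected_graded_algebra t M G \<and>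
     (\<exists>(\<alpha> :: 's \<Rightarrow> 's \<Rightarrow> 'k) h. two_cocycle \<alpha> \<and> h \<in> ring_iso (twisted_algebra \<alpha>) M \<and>
        (\<forall>c f. h (c \<odot>\<^bsub>twisted_algebra \<alpha>\<^esub> f) = c \<odot>\<^bsub>M\<^esub> h f) \<and>
        (\<forall>x. x \<noteq> 0 \<longrightarrow> (\<exists>v\<in>Npow t. v \<noteq> 0 \<and> h (Poly_Mapping.single x 1) \<in> G v)))"

section \<open>Filtrations and quantum toric degenerations\<close>

definition graded_subspace ::
  "('k::field \<Rightarrow> 'a::ring_1 \<Rightarrow> 'a) \<Rightarrow> nat \<Rightarrow> ((nat \<Rightarrow> nat) \<Rightarrow> 'a set) \<Rightarrow> 'a set \<Rightarrow> bool" where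
  "graded_subspace scale r \<A> W \<longleftrightarrow> Modules.module.subspace scale W \<and>
     W = Modules.module.span scale (\<Union>v\<in>Npow r. W \<inter> \<A> v)"

definition connected_filtration ::
  "('k::field \<Rightarrow> 'a::ring_1 \<Rightarrow> 'a) \<Rightarrow> nat \<Rightarrow> ((nat \<Rightarrow> nat) \<Rightarrow> 'a set) \<Rightarrow> (nat \<Rightarrow> 'a set) \<Rightarrow> bool"
  where
  "connected_filtration scale r \<A> F \<longleftrightarrow>
     F 0 = range (\<lambda>c. scale c 1) \<and> mono F \<and> (\<Union>d. F d) = UNIV \<and>
     (\<forall>d e. \<forall>x\<in>F d. \<forall>y\<in>F e. x * y \<in> F (d + e)) \<and>
     (\<forall>d. graded_subspace scale r \<A> (F d) \<and>
        (\<exists>B. finite B \<and> F d = Modules.module.span scale B))"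

text \<open>\<open>F\<^sub>d\<^sub>-\<^sub>1\<close>, with the convention \<open>F\<^sub>-\<^sub>1 = 0\<close>.\<close>

definition filt_prev :: "(nat \<Rightarrow> 'a::ring_1 set) \<Rightarrow> nat \<Rightarrow> 'a set" where
  "filt_prev F d = (case d of 0 \<Rightarrow> {0} | Suc e \<Rightarrow> F e)"

definition filt_class :: "(nat \<Rightarrow> 'a::ring_1 set) \<Rightarrow> nat \<Rightarrow> 'a \<Rightarrow> 'a set" where
  "filt_class F d a = (\<lambda>w. a + w) ` filt_prev F d"

text \<open>An element of the direct sum of the quotients \<open>F\<^sub>d / F\<^sub>d\<^sub>-\<^sub>1\<close> is the finitely supported family
  of its components, each component being a coset of \<open>F\<^sub>d\<^sub>-\<^sub>1\<close> in \<open>F\<^sub>d\<close>. The operations are those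
  induced by arbitrary representatives.\<close>

definition assoc_graded ::
  "('k::field \<Rightarrow> 'a::ring_1 \<Rightarrow> 'a) \<Rightarrow> (nat \<Rightarrow> 'a set) \<Rightarrow> ('k, nat \<Rightarrow> 'a set) module" where
  "assoc_graded scale F =
     \<lparr>carrier = {x. (\<forall>d. x d \<in> filt_class F d ` F d) \<and> finite {d. x d \<noteq> filt_prev F d}},
      monoid.mult = (\<lambda>x y d. \<Union>{filt_class F d (\<Sum>i\<le>d. u i * v (d - i)) | u v.
                (\<forall>i. u i \<in> x i) \<and> (\<forall>i. v i \<in> y i)}),
      one = (\<lambda>d. filt_class F d (if d = 0 then 1 else 0)),
      zero = (\<lambda>d. filt_prev F d),
      add = (\<lambda>x y d. \<Union>{filt_class F d (u + v) | u v. u \<in> x d \<and> v \<in> y d}),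
      module.smult = (\<lambda>c x d. \<Union>{filt_class F d (scale c u) | u. u \<in> x d})\<rparr>"

text \<open>The \<open>\<nat>\<^sup>r\<^sup>+\<^sup>1\<close>-grading of the associated graded algebra: the first \<open>r\<close> coordinates are the
  degree inherited from \<open>A\<close>, the last one is the filtration degree.\<close>

definition assoc_graded_component ::
  "('k::field \<Rightarrow> 'a::ring_1 \<Rightarrow> 'a) \<Rightarrow> nat \<Rightarrow> ((nat \<Rightarrow> nat) \<Rightarrow> 'a set) \<Rightarrow> (nat \<Rightarrow> 'a set) \<Rightarrow>
    (nat \<Rightarrow> nat) \<Rightarrow> (nat \<Rightarrow> 'a set) set" where
  "assoc_graded_component scale r \<A> F v =
     {x \<in> carrier (assoc_graded scale F).
        x (v r) \<in> filt_class F (v r) ` (F (v r) \<inter> \<A> (v(r := 0))) \<and>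
        (\<forall>d. d \<noteq> v r \<longrightarrow> x d = filt_prev F d)}"

definition quantum_toric_degeneration ::
  "('k::field \<Rightarrow> 'a::ring_1 \<Rightarrow> 'a) \<Rightarrow> nat \<Rightarrow> ((nat \<Rightarrow> nat) \<Rightarrow> 'a set) \<Rightarrow>
    's::comm_monoid_add itself \<Rightarrow> bool" where
  "quantum_toric_degeneration scale r \<A> S \<longleftrightarrow>
     (\<exists>F. connected_filtration scale r \<A> F \<and>
        quantum_positive_affine_toric (Suc r) (assoc_graded scale F)
          (assoc_graded_component scale r \<A> F) S)"

end

theory Submission
  imports Defs "HOL-Computational_Algebra.Formal_Power_Series"
begin

text \<open>
  All three statements are equivalent to the existence of an adapted basis: a homogeneous basis
  \<open>e\<^sub>x\<close> of \<open>A\<close> indexed by \<open>x \<in> S\<close> and a weight \<open>\<phi>\<close> such that \<open>e\<^sub>x e\<^sub>y\<close> is a nonzero multiple of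
  \<open>e\<^sub>x\<^sub>+\<^sub>y\<close> up to basis elements of weight below \<open>\<phi>(x + y)\<close>.  Given a degeneration, \<open>e\<^sub>x\<close> is a
  homogeneous lift of \<open>X\<^sup>x\<close>, and \<open>\<phi>\<close> is the filtration degree.  Given an adapted basis, the spans of
  the \<open>e\<^sub>x\<close> of weight at most \<open>d\<close> form the filtration, and \<open>b\<^sub>i = e\<^sub>x\<close> for \<open>x = s\<^sub>i\<close> are generators whose
  monomials have leading terms proportional to basis elements.  Conversely, in an algebra of
  \<open>(S,\<phi>)\<close>-type, modulo words of lower weight, words can be permuted by (ii); the pairs of
  exponents with proportional monomials then form a congruence, which contains the kernel of \<open>\<pi>\<close>
  by (iii).  Hence \<open>e\<^sub>x = b\<^sup>\<tau>\<^sup>(\<^sup>x\<^sup>)\<close> is an adapted basis as soon as it is independent.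
\<close>

section \<open>Linear combinations and independent families\<close>

text \<open>Adapted bases mediate because they absorb two mismatches between the statements. A
  degeneration yields a basis known only through its symbols, while (2) and (3) speak of monomials
  in \<open>n\<close> elements; and (2) asks for independence for every section, while (3) provides
  it for one. Both gaps are closed by triangularity: elements with the same leading index agree up
  to a nonzero scalar and lower terms, so a family with one leading element for each index is again
  a basis. These inductions run on the weight, a natural number, and so error terms must have
  strictly smaller weight.

  That \<phi> vanishes only at 0 has two sides. From a degeneration it follows by playing the two
  gradings against each other: filtration degree 0 means being a scalar, hence having degree 0 in
  \<nat>^r as well. Conversely, it makes the set of elements of bounded weight finite and the bottom
  step of the filtration one-dimensional.

  The cocycle identity of the structure constants is forced by associativity of the algebra. The
  passage from (2) to (3) requires a finite presentation to exist; this is Dickson's lemma.\<close>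

definition lincomb :: "('k::field \<Rightarrow> 'a::ring_1 \<Rightarrow> 'a) \<Rightarrow> ('s \<Rightarrow> 'a) \<Rightarrow> ('s \<Rightarrow>\<^sub>0 'k) \<Rightarrow> 'a" where
  "lincomb scale e f = (\<Sum>x\<in>Poly_Mapping.keys f. scale (Poly_Mapping.lookup f x) (e x))"

lemma lookup_map_mult [simp]:
  "Poly_Mapping.lookup (Poly_Mapping.map ((*) c) f) x = c * Poly_Mapping.lookup f x"
  for c :: "'k::field"
  by (simp add: Poly_Mapping.map.rep_eq when_def)

lemma poly_mapping_sum_singles:
  "f = (\<Sum>x\<in>Poly_Mapping.keys f. Poly_Mapping.single x (Poly_Mapping.lookup f x))"
proof (rule poly_mapping_eqI)
  fix y
  show "Poly_Mapping.lookup f y =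
    Poly_Mapping.lookup (\<Sum>x\<in>Poly_Mapping.keys f. Poly_Mapping.single x (Poly_Mapping.lookup f x)) y"
    by (auto simp: lookup_sum lookup_single when_def sum.delta in_keys_iff)
qed

locale unital_algebra = vector_space scale
  for scale :: "'k::field \<Rightarrow> 'a::ring_1 \<Rightarrow> 'a" +
  assumes scale_mult_left: "scale c x * y = scale c (x * y)"
    and scale_mult_right: "x * scale c y = scale c (x * y)"
begin

lemma lincomb_eq_sum:
  assumes "finite T" "Poly_Mapping.keys f \<subseteq> T"
  shows "lincomb scale e f = (\<Sum>x\<in>T. scale (Poly_Mapping.lookup f x) (e x))"
  unfolding lincomb_def
  by (rule sum.mono_neutral_left) (use assms in \<open>auto simp: in_keys_iff\<close>)

lemma lincomb_zero [simp]: "lincomb scale e 0 = 0"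
  by (simp add: lincomb_def)

lemma lincomb_single [simp]: "lincomb scale e (Poly_Mapping.single x c) = scale c (e x)"
  by (cases "c = 0") (simp_all add: lincomb_def)

lemma lincomb_add: "lincomb scale e (f + g) = lincomb scale e f + lincomb scale e g"
proof -
  let ?T = "Poly_Mapping.keys f \<union> Poly_Mapping.keys g"
  have "Poly_Mapping.keys (f + g) \<subseteq> ?T"
    by (rule Poly_Mapping.keys_add)
  then show ?thesis
    by (simp add: lincomb_eq_sum[of ?T] lookup_add scale_left_distrib sum.distrib)
qed

lemma lincomb_smult:
  "lincomb scale e (Poly_Mapping.map ((*) c) f) = scale c (lincomb scale e f)"
proof -
  have "Poly_Mapping.keys (Poly_Mapping.map ((*) c) f) \<subseteq> Poly_Mapping.keys f"
    by (auto simp: in_keys_iff)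
  then show ?thesis
    by (simp add: lincomb_eq_sum[of "Poly_Mapping.keys f"] scale_sum_right)
qed

lemma lincomb_minus: "lincomb scale e (- f) = - lincomb scale e f"
  using lincomb_add[of e f "- f"] by (simp add: minus_unique)

lemma lincomb_diff: "lincomb scale e (f - g) = lincomb scale e f - lincomb scale e g"
  using lincomb_add[of e f "- g"] by (simp add: lincomb_minus)

lemma lincomb_sum: "lincomb scale e (\<Sum>i\<in>I. f i) = (\<Sum>i\<in>I. lincomb scale e (f i))"
  by (induction I rule: infinite_finite_induct) (auto simp: lincomb_add)

lemma lincomb_in_span: "Poly_Mapping.keys f \<subseteq> U \<Longrightarrow> lincomb scale e f \<in> span (e ` U)"
  unfolding lincomb_def by (intro span_sum span_scale span_base) auto

text \<open>Besides the span it records the support of the coefficients: with \<open>U\<close> the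
  indices of small weight, membership in a span becomes a condition on
  \<open>Poly_Mapping.keys\<close>.\<close>

lemma span_image_eq_lincomb:
  "span (e ` U) = {lincomb scale e f | f. Poly_Mapping.keys f \<subseteq> U}" (is "_ = ?R")
proof
  show "span (e ` U) \<subseteq> ?R"
  proof (rule span_minimal)
    show "e ` U \<subseteq> ?R"
    proof
      fix y assume "y \<in> e ` U"
      then obtain x where "x \<in> U" "y = lincomb scale e (Poly_Mapping.single x 1)"
        by auto
      then show "y \<in> ?R" by fastforce
    qed
    show "subspace ?R"
    proof (rule subspaceI)
      show "0 \<in> ?R" by (auto intro!: exI[of _ 0])
    next
      fix x y assume "x \<in> ?R" "y \<in> ?R"
      then obtain f g where *: "x = lincomb scale e f" "y = lincomb scale e g"
        and "Poly_Mapping.keys f \<subseteq> U" "Poly_Mapping.keys g \<subseteq> U"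
        by blast
      then have "Poly_Mapping.keys (f + g) \<subseteq> U"
        using Poly_Mapping.keys_add[of f g] by blast
      with * show "x + y \<in> ?R" by (force simp: lincomb_add)
    next
      fix x c assume "x \<in> ?R"
      then obtain f where *: "x = lincomb scale e f" "Poly_Mapping.keys f \<subseteq> U"
        by blast
      then have "Poly_Mapping.keys (Poly_Mapping.map ((*) c) f) \<subseteq> U"
        by (auto simp: in_keys_iff)
      with * show "scale c x \<in> ?R"
        by (force simp: lincomb_smult)
    qed
  qed
  show "?R \<subseteq> span (e ` U)" by (auto intro: lincomb_in_span)
qed

text \<open>The right-hand side is injectivity of the linear map \<open>lincomb scale e\<close>. It
  covers injectivity of \<open>e\<close> too, since a coincidence \<open>e x = e y\<close> is a
  relation with two terms.\<close>

lemma independent_family_iff: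
  "independent_family scale e \<longleftrightarrow> (\<forall>f. lincomb scale e f = 0 \<longrightarrow> f = 0)"
proof
  assume ind: "independent_family scale e"
  then have inj: "inj e" and nd: "independent (range e)"
    by (auto simp: independent_family_def)
  show "\<forall>f. lincomb scale e f = 0 \<longrightarrow> f = 0"
  proof (intro allI impI)
    fix f assume f: "lincomb scale e f = 0"
    \<comment> \<open>Injectivity of \<open>e\<close> lets coefficients indexed by \<open>x\<close>
      be read as a function of the vectors \<open>e x\<close>, which is the form in which
      \<open>independent\<close> takes them.\<close>
    let ?u = "\<lambda>v. Poly_Mapping.lookup f (inv_into UNIV e v)"
    have "(\<Sum>v\<in>e ` Poly_Mapping.keys f. scale (?u v) v) = (\<Sum>x\<in>Poly_Mapping.keys f. scale (?u (e x)) (e x))"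
      using inj by (simp add: sum.reindex inj_on_subset)
    also have "\<dots> = 0"
      using f inj by (simp add: lincomb_def)
    finally have sum: "(\<Sum>v\<in>e ` Poly_Mapping.keys f. scale (?u v) v) = 0" .
    have u0: "?u v = 0" if "v \<in> e ` Poly_Mapping.keys f" for v
      by (rule nd[unfolded independent_explicit_finite_subsets, rule_format, OF _ _ sum that]) (simp_all add: image_mono)
    have "Poly_Mapping.lookup f x = 0" for x
    proof (cases "x \<in> Poly_Mapping.keys f")
      case True
      then show ?thesis using u0[of "e x"] inj by simp
    qed (simp add: in_keys_iff)
    then show "f = 0" by (intro poly_mapping_eqI) simp
  qed
next
  assume H: "\<forall>f. lincomb scale e f = 0 \<longrightarrow> f = 0"
  have inj: "inj e"
  proof (rule injI, rule ccontr)
    fix x y assume "e x = e y" "x \<noteq> y"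
    then have "lincomb scale e (Poly_Mapping.single x 1 - Poly_Mapping.single y 1) = 0"
      by (simp add: lincomb_diff)
    then have "Poly_Mapping.single x (1::'k) - Poly_Mapping.single y 1 = 0" using H by blast
    then have "Poly_Mapping.lookup (Poly_Mapping.single x (1::'k)) x =
        Poly_Mapping.lookup (Poly_Mapping.single y 1) x"
      by (metis eq_iff_diff_eq_0)
    with \<open>x \<noteq> y\<close> show False by (simp add: lookup_single when_def)
  qed
  have "\<forall>v\<in>S. u v = 0" if S: "S \<subseteq> range e" "finite S" "(\<Sum>v\<in>S. scale (u v) v) = 0" for S u
  proof -
    define T where "T = e -` S"
    have T: "S = e ` T" "finite T"
      using S inj by (auto simp: T_def finite_vimageI)
    define f where "f = (\<Sum>x\<in>T. Poly_Mapping.single x (u (e x)))"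
    have "(\<Sum>x\<in>T. scale (u (e x)) (e x)) = 0"
      using S(3) inj by (simp add: T(1) sum.reindex inj_on_subset)
    then have "lincomb scale e f = 0"
      by (simp add: f_def lincomb_sum)
    then have f0: "f = 0" using H by blast
    have "u (e x) = 0" if "x \<in> T" for x
    proof -
      have "Poly_Mapping.lookup f x = u (e x)"
        using T that by (simp add: f_def lookup_sum lookup_single when_def)
      with f0 show ?thesis by simp
    qed
    with T show ?thesis by auto
  qed
  then have "independent (range e)"
    unfolding independent_explicit_finite_subsets by blast
  with inj show "independent_family scale e" by (simp add: independent_family_def)
qed

lemma mult_mem_of_spans:
  assumes V: "subspace V" and BC: "\<And>x y. x \<in> B \<Longrightarrow> y \<in> C \<Longrightarrow> x * y \<in> V"
    and a: "a \<in> span B" and b: "b \<in> span C"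
  shows "a * b \<in> V"
proof -
  have 1: "x * b \<in> V" if x: "x \<in> B" for x
    using b
  proof (induction rule: span_induct_alt)
    case base
    then show ?case using V by (simp add: subspace_0)
  next
    case (step c y z)
    then show ?case
      using V BC x by (simp add: distrib_left scale_mult_right subspace_add subspace_scale)
  qed
  show ?thesis
    using a
  proof (induction rule: span_induct_alt)
    case base
    then show ?case using V by (simp add: subspace_0)
  next
    case (step c y z)
    then show ?case
      using V 1 by (simp add: distrib_right scale_mult_left subspace_add subspace_scale)
  qed
qed

text \<open>Induction on the weight: \<open>g i\<close> splits into \<open>y\<close> and a rest
  spanned by members of smaller weight. As \<open>N\<close> is a strict bound, weight
  \<open>w i\<close> belongs to \<open>V (Suc (w i))\<close>. It serves to rewrite one basis in
  terms of another and to rewrite words in terms of basis elements.\<close>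

lemma span_subset_of_reduction:
  fixes w :: "'i \<Rightarrow> nat"
  assumes V: "\<And>N. subspace (V N)" "mono V"
    and red: "\<And>i. i \<in> I \<Longrightarrow> \<exists>y\<in>V (Suc (w i)). g i - y \<in> span (g ` {j\<in>I. w j < w i})"
  shows "span (g ` {j\<in>I. w j < N}) \<subseteq> V N"
proof (induction N rule: less_induct)
  case (less N)
  show ?case
  proof (rule span_minimal)
    show "subspace (V N)" by (rule V)
    show "g ` {j\<in>I. w j < N} \<subseteq> V N"
    proof clarify
      fix i assume i: "i \<in> I" "w i < N"
      obtain y where y: "y \<in> V (Suc (w i))" "g i - y \<in> span (g ` {j\<in>I. w j < w i})"
        using red[OF i(1)] by blast
      have "y \<in> V N" using y(1) V(2) i(2) by (meson Suc_leI monoD subsetD)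
      moreover have "g i - y \<in> V N"
        using y(2) less[OF i(2)] V(2) i(2) by (meson less_imp_le monoD subsetD)
      ultimately show "g i \<in> V N"
        using subspace_add[OF V(1), of y N "g i - y"] by simp
    qed
  qed
qed

text \<open>A matrix that is triangular for the weight with nonzero diagonal has trivial kernel.
  Off-diagonal entries have strictly smaller weight, so distinct indices of equal weight do not
  interfere.\<close>

lemma independent_family_triangular:
  fixes \<phi> :: "'s \<Rightarrow> nat"
  assumes e: "independent_family scale e"
    and tri: "\<And>x. \<exists>c. c \<noteq> 0 \<and> f x - scale c (e x) \<in> span (e ` {u. \<phi> u < \<phi> x})"
  shows "independent_family scale f"
proof -
  have "\<exists>t. f x = lincomb scale e t \<and> Poly_Mapping.lookup t x \<noteq> 0 \<and>
      (\<forall>u. u \<noteq> x \<and> Poly_Mapping.lookup t u \<noteq> 0 \<longrightarrow> \<phi> u < \<phi> x)" for x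
  proof -
    obtain c where c: "c \<noteq> 0" "f x - scale c (e x) \<in> span (e ` {u. \<phi> u < \<phi> x})"
      using tri by blast
    then obtain q where q: "f x - scale c (e x) = lincomb scale e q"
      "Poly_Mapping.keys q \<subseteq> {u. \<phi> u < \<phi> x}"
      by (auto simp: span_image_eq_lincomb)
    have "f x = lincomb scale e (q + Poly_Mapping.single x c)"
      using q(1) by (simp add: lincomb_add algebra_simps)
    moreover have "Poly_Mapping.lookup q x = 0"
      using q(2) by (auto simp: in_keys_iff)
    ultimately show ?thesis
      using c(1) q(2)
      by (intro exI[of _ "q + Poly_Mapping.single x c"])
        (auto simp: lookup_add lookup_single when_def in_keys_iff)
  qed
  then obtain t where t: "\<And>x. f x = lincomb scale e (t x)"
    "\<And>x. Poly_Mapping.lookup (t x) x \<noteq> 0"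
    "\<And>x u. u \<noteq> x \<Longrightarrow> Poly_Mapping.lookup (t x) u \<noteq> 0 \<Longrightarrow> \<phi> u < \<phi> x"
    by metis
  show ?thesis
    unfolding independent_family_iff
  proof (intro allI impI, rule ccontr)
    fix p assume p: "lincomb scale f p = 0" "p \<noteq> 0"
    let ?q = "\<Sum>x\<in>Poly_Mapping.keys p. Poly_Mapping.map ((*) (Poly_Mapping.lookup p x)) (t x)"
    have "lincomb scale e ?q = lincomb scale f p"
      by (simp add: lincomb_sum lincomb_smult lincomb_def[of _ f] t(1)[symmetric])
    then have q0: "?q = 0" using p e by (simp add: independent_family_iff)
    \<comment> \<open>In a relation, take an index \<open>x0\<close> of largest weight. Another
      \<open>t x\<close> involves \<open>x0\<close> only if \<open>\<phi> x0 < \<phi> x\<close>, so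
      the coefficient at \<open>x0\<close> comes from \<open>t x0\<close> alone.\<close>
    have "Max (\<phi> ` Poly_Mapping.keys p) \<in> \<phi> ` Poly_Mapping.keys p"
      using p by (intro Max_in) auto
    then obtain x0 where x0: "x0 \<in> Poly_Mapping.keys p" "\<phi> x0 = Max (\<phi> ` Poly_Mapping.keys p)"
      by auto
    then have max: "\<phi> x \<le> \<phi> x0" if "x \<in> Poly_Mapping.keys p" for x
      using that by simp
    have zero: "Poly_Mapping.lookup (t x) x0 = 0" if "x \<in> Poly_Mapping.keys p" "x \<noteq> x0" for x
      using that max[of x] t(3)[of x0 x] by force
    have "Poly_Mapping.lookup ?q x0 =
        (\<Sum>x\<in>Poly_Mapping.keys p. Poly_Mapping.lookup p x * Poly_Mapping.lookup (t x) x0)"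
      by (simp add: lookup_sum)
    also have "\<dots> = (\<Sum>x\<in>{x0}. Poly_Mapping.lookup p x * Poly_Mapping.lookup (t x) x0)"
      by (rule sum.mono_neutral_right) (use x0 zero in auto)
    finally show False using q0 t(2) x0(1) by (simp add: in_keys_iff)
  qed
qed

end

section \<open>Positive affine semigroups\<close>

lemma Npow_zero [simp]: "0 \<in> Npow n"
  by (simp add: Npow_def)

lemma Npow_add [intro]: "p \<in> Npow n \<Longrightarrow> q \<in> Npow n \<Longrightarrow> p + q \<in> Npow n"
  by (simp add: Npow_def)

lemma additive_morphism_sum:
  "additive_morphism f \<Longrightarrow> f (\<Sum>i\<in>I. g i) = (\<Sum>i\<in>I. f (g i))"
  by (induction I rule: infinite_finite_induct) (auto simp: additive_morphism_def)

lemma sum_const_add: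
  "(\<Sum>_<k + l. x) = (\<Sum>_<k. x) + (\<Sum>_<l. x :: 's::comm_monoid_add)" for k l :: nat
  by (induction l) (auto simp: ac_simps)

lemma pres_map_zero [simp]: "pres_map n s 0 = 0"
  by (simp add: pres_map_def)

lemma pres_map_add: "pres_map n s (p + q) = pres_map n s p + pres_map n s q"
  unfolding pres_map_def plus_fun_apply sum_const_add sum.distrib ..

lemma pres_map_unit:
  assumes "i < n"
  shows "pres_map n s (\<lambda>j. if j = i then 1 else 0) = s i"
proof -
  have "pres_map n s (\<lambda>j. if j = i then 1 else 0) = (\<Sum>j<n. if j = i then s i else 0)"
    unfolding pres_map_def by (intro sum.cong) auto
  with assms show ?thesis by simp
qed

lemma submonoid_generated_subset_Npow:
  assumes "B \<subseteq> Npow m" "x \<in> submonoid_generated B"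
  shows "x \<in> Npow m"
  using assms(2)
proof induction
  case zero
  show ?case by (rule Npow_zero)
next
  case (add b x)
  have "b \<in> Npow m" using assms(1) add(1) by (rule subsetD)
  then show ?case using add(3) by (rule Npow_add)
qed

lemma positive_affine_semigroup_embedding:
  assumes "positive_affine_semigroup TYPE('s::comm_monoid_add)"
  shows "\<exists>m. \<exists>f :: 's \<Rightarrow> nat \<Rightarrow> nat. additive_morphism f \<and> inj f \<and> (\<forall>x. f x \<in> Npow m)"
proof -
  have "\<exists>m B. \<exists>f :: 's \<Rightarrow> nat \<Rightarrow> nat. B \<subseteq> Npow m \<and> additive_morphism f \<and>
      bij_betw f UNIV (submonoid_generated B)"
    using assms unfolding positive_affine_semigroup_def by metis
  then obtain m B and f :: "'s \<Rightarrow> nat \<Rightarrow> nat" where *: "B \<subseteq> Npow m" "additive_morphism f"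
    "bij_betw f UNIV (submonoid_generated B)"
    by (elim exE conjE)
  have "f x \<in> Npow m" for x
    using bij_betwE[OF *(3)] by (intro submonoid_generated_subset_Npow[OF *(1)]) simp
  then show ?thesis
    using *(2) bij_betw_imp_inj_on[OF *(3)] by (intro exI conjI allI)
qed

lemma positive_affine_semigroup_cancel:
  assumes "positive_affine_semigroup TYPE('s::comm_monoid_add)"
    and "x + z = y + (z :: 's)"
  shows "x = y"
proof -
  obtain m and f :: "'s \<Rightarrow> nat \<Rightarrow> nat" where f: "additive_morphism f" "inj f"
    using positive_affine_semigroup_embedding[OF assms(1)] by (elim exE conjE)
  have f_add: "f (u + v) = f u + f v" for u v
    using f(1) by (simp only: additive_morphism_def)
  have "f x + f z = f y + f z"
    unfolding f_add[symmetric] assms(2) ..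
  then have "f x = f y" by (rule add_right_imp_eq)
  with f(2) show ?thesis by (rule injD)
qed

text \<open>Induction on the coordinate sum under an embedding into \<nat>^m. The sum is positive on
  nonzero elements, so a reducible element splits into two parts of strictly smaller sum, and the
  irreducible ones are the \<open>s i\<close>.\<close>

lemma pres_map_surj:
  fixes s :: "nat \<Rightarrow> 's::comm_monoid_add"
  assumes S: "positive_affine_semigroup TYPE('s)" and s: "bij_betw s {..<n} hilbert_basis"
  shows "\<exists>\<xi>\<in>Npow n. pres_map n s \<xi> = x"
proof -
  obtain m and f :: "'s \<Rightarrow> nat \<Rightarrow> nat" where f: "additive_morphism f" "inj f" "\<forall>x. f x \<in> Npow m"
    using positive_affine_semigroup_embedding[OF S] by (elim exE conjE)
  have f_add: "f (y + z) = f y + f z" for y z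
    using f(1) by (simp add: additive_morphism_def)
  have pos: "(\<Sum>i<m. f y i) > 0" if "y \<noteq> 0" for y
  proof (rule ccontr)
    assume "\<not> ?thesis"
    then have "f y i = 0" for i
      using f(3)[rule_format, of y] by (cases "i < m") (auto simp: Npow_def)
    then have "f y = f 0" using f(1) by (auto simp: additive_morphism_def fun_eq_iff)
    with f(2) that show False by (simp add: inj_eq)
  qed
  show ?thesis
  proof (induction "\<Sum>i<m. f x i" arbitrary: x rule: less_induct)
    case less
    consider "x = 0" | "x \<in> hilbert_basis" | y z where "x = y + z" "y \<noteq> 0" "z \<noteq> 0"
      by (auto simp: hilbert_basis_def)
    then show ?case
    proof cases
      case 1
      then show ?thesis by (intro bexI[of _ 0]) auto
    next
      case 2
      then have "x \<in> s ` {..<n}" using bij_betw_imp_surj_on[OF s] by simp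
      then obtain i where i: "i < n" "s i = x" by auto
      then show ?thesis
        by (intro bexI[of _ "\<lambda>j. if j = i then 1 else 0"]) (auto simp: pres_map_unit Npow_def)
    next
      case 3
      have "(\<Sum>i<m. f x i) = (\<Sum>i<m. f y i) + (\<Sum>i<m. f z i)"
        by (simp add: 3 f_add sum.distrib)
      then obtain p q where "p \<in> Npow n" "q \<in> Npow n" "pres_map n s p = y" "pres_map n s q = z"
        using less[of y] less[of z] pos[of y] pos[of z] 3 by auto
      then show ?thesis
        by (intro bexI[of _ "p + q"]) (auto simp: pres_map_add 3)
    qed
  qed
qed

lemma pres_section_exists:
  fixes s :: "nat \<Rightarrow> 's::comm_monoid_add"
  assumes "positive_affine_semigroup TYPE('s)" "bij_betw s {..<n} hilbert_basis"
  shows "\<exists>\<tau>. pres_section n s \<tau>"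
  using pres_map_surj[OF assms] unfolding pres_section_def by metis

lemma weight_pres_map:
  assumes "additive_morphism \<phi>"
  shows "\<phi> (pres_map n s \<xi>) = (\<Sum>i<n. \<xi> i * \<phi> (s i))"
  using assms by (simp add: pres_map_def additive_morphism_sum)

text \<open>Each \<open>s i\<close> has positive weight, so the exponents of a representative of
  \<open>u\<close> are bounded by the weight of \<open>u\<close>, and a finite box of exponents
  suffices. This makes the steps of the weight filtration finite-dimensional.\<close>

lemma finite_weight_le:
  fixes \<phi> :: "'s::comm_monoid_add \<Rightarrow> nat" and s :: "nat \<Rightarrow> 's" and n :: nat
  assumes S: "positive_affine_semigroup TYPE('s)" and s: "bij_betw s {..<n} hilbert_basis"
    and \<phi>: "additive_morphism \<phi>" "\<phi> -` {0} = {0}"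
  shows "finite {u. \<phi> u \<le> d}"
proof (rule finite_subset)
  let ?N = "{\<xi>. \<forall>i. (i \<in> {..<n} \<longrightarrow> \<xi> i \<in> {..d}) \<and> (i \<notin> {..<n} \<longrightarrow> \<xi> i = 0)}"
  show "finite (pres_map n s ` ?N)"
    by (intro finite_imageI finite_set_of_finite_funs) auto
  show "{u. \<phi> u \<le> d} \<subseteq> pres_map n s ` ?N"
  proof clarify
    fix u assume u: "\<phi> u \<le> d"
    obtain \<xi> where \<xi>: "\<xi> \<in> Npow n" "pres_map n s \<xi> = u" using pres_map_surj[OF S s] by blast
    have "\<xi> i \<le> d" if i: "i < n" for i
    proof -
      have "s i \<in> hilbert_basis" using bij_betwE[OF s] i by simp
      then have "s i \<noteq> 0" by (simp add: hilbert_basis_def)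
      then have "\<phi> (s i) \<noteq> 0" using \<phi>(2) by auto
      then have "\<xi> i \<le> \<xi> i * \<phi> (s i)" by simp
      also have "\<dots> \<le> (\<Sum>i<n. \<xi> i * \<phi> (s i))"
        using i by (intro member_le_sum) auto
      also have "\<dots> \<le> d"
        using u \<xi>(2) weight_pres_map[OF \<phi>(1), of n s \<xi>] by simp
      finally show ?thesis .
    qed
    with \<xi> show "u \<in> pres_map n s ` ?N" by (auto simp: Npow_def)
  qed
qed

section \<open>Dickson's lemma and finite presentations\<close>

lemma dickson_subsequence:
  fixes v :: "nat \<Rightarrow> 'i \<Rightarrow> nat"
  assumes "finite K"
  shows "\<exists>g :: nat \<Rightarrow> nat. strict_mono g \<and> (\<forall>k\<in>K. mono (\<lambda>i. v (g i) k))"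
  using assms
proof (induction K)
  case empty
  show ?case by (intro exI[of _ id]) (simp add: strict_mono_def)
next
  case (insert k K)
  then obtain g :: "nat \<Rightarrow> nat" where g: "strict_mono g" "\<forall>k\<in>K. mono (\<lambda>i. v (g i) k)" by blast
  obtain g' :: "nat \<Rightarrow> nat" where g': "strict_mono g'" "monoseq (\<lambda>i. v (g (g' i)) k)"
    using seq_monosub[of "\<lambda>i. v (g i) k"] by blast
  have "\<exists>g'' :: nat \<Rightarrow> nat. strict_mono g'' \<and> mono (\<lambda>i. v (g (g' (g'' i))) k)"
  proof (cases "incseq (\<lambda>i. v (g (g' i)) k)")
    case True
    then show ?thesis by (intro exI[of _ id]) (auto simp: strict_mono_def)
  next
    case False
    \<comment> \<open>A nonincreasing sequence of naturals is constant from the index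
      \<open>N\<close> of its least value on, so its tail is also nondecreasing.\<close>
    then have dec: "decseq (\<lambda>i. v (g (g' i)) k)"
      using g'(2) by (simp add: monoseq_iff)
    define a where "a = (\<lambda>i. v (g (g' i)) k)"
    have "\<exists>N. \<forall>i. a N \<le> a i"
      using ex_has_least_nat[of "\<lambda>_. True" 0 a] by auto
    then obtain N where N: "\<And>i. a N \<le> a i" by blast
    have "a (N + i) = a N" for i
      using N[of "N + i"] dec by (metis a_def antisym decseqD le_add1)
    then show ?thesis
      by (intro exI[of _ "\<lambda>i. N + i"]) (auto simp: a_def strict_mono_def)
  qed
  then obtain g'' :: "nat \<Rightarrow> nat" where g'': "strict_mono g''" "mono (\<lambda>i. v (g (g' (g'' i))) k)" by blast
  have sm: "strict_mono (\<lambda>i. g' (g'' i))"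
    using g'(1) g''(1) by (simp add: strict_mono_def)
  have "mono (\<lambda>i. v (g (g' (g'' i))) l)" if "l \<in> K" for l
  proof (rule monoI)
    fix i j :: nat assume "i \<le> j"
    then have "g' (g'' i) \<le> g' (g'' j)" using strict_mono_leD[OF sm] by simp
    then show "v (g (g' (g'' i))) l \<le> v (g (g' (g'' j))) l"
      using g(2) that by (simp add: mono_def)
  qed
  moreover have "strict_mono (\<lambda>i. g (g' (g'' i)))"
    using g(1) sm by (simp add: strict_mono_def)
  ultimately show ?case
    using g''(2) by (intro exI[of _ "\<lambda>i. g (g' (g'' i))"]) auto
qed

lemma finite_antichain_Npow:
  assumes M: "M \<subseteq> Npow n \<times> Npow n"
    and anti: "\<And>x y. x \<in> M \<Longrightarrow> y \<in> M \<Longrightarrow> fst x \<le> fst y \<Longrightarrow> snd x \<le> snd y \<Longrightarrow> x = y"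
  shows "finite M"
proof (rule ccontr)
  assume "infinite M"
  then obtain q :: "nat \<Rightarrow> _" where q: "inj q" "range q \<subseteq> M"
    using infinite_countable_subset by blast
  \<comment> \<open>A pair of exponents is treated as one vector, indexed by a coordinate and a flag
    selecting the component, so that Dickson's lemma applies to pairs.\<close>
  define v where "v i k = (if snd k then fst (q i) (fst k) else snd (q i) (fst k))" for i k
  obtain g :: "nat \<Rightarrow> nat" where g: "strict_mono g" "\<forall>k\<in>{..<n} \<times> UNIV. mono (\<lambda>i. v (g i) k)"
    using dickson_subsequence[of "{..<n} \<times> (UNIV :: bool set)" v] by auto
  have qM: "q i \<in> M" for i using q by auto
  have le: "v (g 0) (k, c) \<le> v (g 1) (k, c)" if "k < n" for k c
    using g(2) that by (auto simp: mono_def)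
  have "fst (q (g 0)) k \<le> fst (q (g 1)) k \<and> snd (q (g 0)) k \<le> snd (q (g 1)) k" for k
  proof (cases "k < n")
    case True
    then show ?thesis using le[of k True] le[of k False] by (auto simp: v_def)
  next
    case False
    have "fst (q (g 0)) \<in> Npow n" "snd (q (g 0)) \<in> Npow n"
      using subsetD[OF M qM[of "g 0"]] by (simp_all add: mem_Times_iff)
    with False show ?thesis by (simp add: Npow_def)
  qed
  then have "q (g 0) = q (g 1)" using qM by (intro anti) (auto simp: le_fun_def)
  then have "g 0 = g 1" using q(1) by (simp add: inj_eq)
  with g(1) show False by (metis strict_mono_eq zero_neq_one)
qed

text \<open>Since \<open>S\<close> is cancellative, the kernel congruence is closed under differences of comparable
  pairs, so its minimal nonzero pairs already generate it additively.\<close>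

lemma presentation_exists:
  fixes s :: "nat \<Rightarrow> 's::comm_monoid_add"
  assumes S: "positive_affine_semigroup TYPE('s)"
  shows "\<exists>P. presentation n s P"
proof -
  define L where "L = {(p, p'). p \<in> Npow n \<and> p' \<in> Npow n \<and> pres_map n s p = pres_map n s p'}"
  define le where "le x y \<longleftrightarrow> fst x \<le> fst y \<and> snd x \<le> snd y"
    for x y :: "(nat \<Rightarrow> nat) \<times> (nat \<Rightarrow> nat)"
  define M where "M = {x \<in> L - {(0, 0)}. \<forall>y\<in>L - {(0, 0)}. le y x \<longrightarrow> y = x}"
  define size where "size x = (\<Sum>i<n. fst x i + snd x i)" for x :: "(nat \<Rightarrow> nat) \<times> (nat \<Rightarrow> nat)"
  have "finite M"
    by (rule finite_antichain_Npow[of _ n]) (auto simp: M_def L_def le_def)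
  have Lcong: "monoid_congruence n L"
    unfolding monoid_congruence_def
  proof (intro conjI equivI)
    show "refl_on (Npow n) L" "sym L" "trans L"
      by (auto simp: refl_on_def sym_def trans_def L_def)
  qed (auto simp: L_def pres_map_add)
  have diff_le: "y = x + (y - x)" if "x \<le> y" for x y :: "nat \<Rightarrow> nat"
    using that by (auto simp: fun_eq_iff le_fun_def)
  have in_R: "x \<in> R" if R: "monoid_congruence n R" "M \<subseteq> R" and x: "x \<in> L" for R x
    using x
  proof (induction "size x" arbitrary: x rule: less_induct)
    case less
    obtain p p' where x: "x = (p, p')" by (cases x)
    have pp: "p \<in> Npow n" "p' \<in> Npow n" "pres_map n s p = pres_map n s p'"
      using less(2) by (auto simp: x L_def)
    show ?case
    proof (cases "x = (0, 0)")
      case True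
      then show ?thesis
        using R(1) by (auto simp: monoid_congruence_def equiv_def refl_on_def)
    next
      case False
      \<comment> \<open>Minimality in the product order is obtained from minimality of
        \<open>size\<close>: the difference of two comparable pairs is again in \<open>L\<close>,
        and its size is positive unless it is zero.\<close>
      let ?Q = "\<lambda>y. y \<in> L - {(0, 0)} \<and> le y x"
      have "?Q x" using False less(2) by (auto simp: le_def)
      then obtain y where y: "?Q y" and ymin: "\<And>z. ?Q z \<Longrightarrow> size y \<le> size z"
        using ex_has_least_nat[of ?Q x size] by blast
      obtain q q' where yq: "y = (q, q')" by (cases y)
      have qq: "q \<in> Npow n" "q' \<in> Npow n" "pres_map n s q = pres_map n s q'" "q \<le> p" "q' \<le> p'"
        using y by (auto simp: yq x L_def le_def)
      have size_diff: "size z = size y + size (fst z - fst y, snd z - snd y)" if "le y z" for y z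
      proof -
        have "fst z i = fst y i + (fst z i - fst y i)" "snd z i = snd y i + (snd z i - snd y i)" for i
          using that by (auto simp: le_def le_fun_def)
        then show ?thesis
          unfolding size_def sum.distrib[symmetric] by (intro sum.cong) (auto simp: algebra_simps)
      qed
      have size_pos: "size z > 0" if "z \<in> L" "z \<noteq> (0, 0)" for z
      proof (rule ccontr)
        assume "\<not> ?thesis"
        then have "fst z i = 0 \<and> snd z i = 0" for i
          using that by (cases "i < n") (auto simp: size_def L_def Npow_def)
        then have "z = (0, 0)" by (auto simp: prod_eq_iff fun_eq_iff)
        with that show False by simp
      qed
      have diff_L: "(b - a, b' - a') \<in> L" if "(a, a') \<in> L" "(b, b') \<in> L" "a \<le> b" "a' \<le> b'"
        for a a' b b'
      proof -
        have "pres_map n s (b - a) + pres_map n s a = pres_map n s (b' - a') + pres_map n s a"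
          using that pres_map_add[of n s a "b - a"] pres_map_add[of n s a' "b' - a'"]
          by (auto simp: L_def diff_le[symmetric] add.commute)
        then have "pres_map n s (b - a) = pres_map n s (b' - a')"
          by (rule positive_affine_semigroup_cancel[OF S])
        with that show ?thesis by (auto simp: L_def Npow_def)
      qed
      have "y \<in> M"
      proof -
        have "z = y" if z: "z \<in> L - {(0, 0)}" "le z y" for z
        proof (rule ccontr)
          assume "z \<noteq> y"
          have "?Q z" using z y by (auto simp: le_def)
          then have "size y \<le> size z" by (rule ymin)
          then have "size (fst y - fst z, snd y - snd z) = 0" using size_diff[OF z(2)] by simp
          moreover have "(fst y - fst z, snd y - snd z) \<in> L"
            using z y by (intro diff_L) (auto simp: le_def)
          ultimately have "fst y - fst z = 0" "snd y - snd z = 0"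
            using size_pos by fastforce+
          then have "y = z"
            using z(2) diff_le[of "fst z" "fst y"] diff_le[of "snd z" "snd y"]
            by (auto simp: le_def prod_eq_iff)
          with \<open>z \<noteq> y\<close> show False by simp
        qed
        with y show ?thesis by (auto simp: M_def)
      qed
      \<comment> \<open>Subtracting the minimal pair leaves a smaller pair of the kernel, to which
        the induction hypothesis applies; closure of \<open>R\<close> under sums then returns
        \<open>x\<close>.\<close>
      have dL: "(p - q, p' - q') \<in> L"
        using y less(2) by (intro diff_L) (auto simp: x yq le_def)
      have "size (p - q, p' - q') < size x"
        using size_diff[of y x] size_pos[of y] y by (auto simp: x yq)
      then have "(p - q, p' - q') \<in> R" using less(1) dL by blast
      moreover have "(q, q') \<in> R" using \<open>y \<in> M\<close> R(2) yq by auto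
      ultimately have "(q + (p - q), q' + (p' - q')) \<in> R"
        using R(1) by (auto simp: monoid_congruence_def)
      then show ?thesis
        using diff_le[OF qq(4)] diff_le[OF qq(5)] by (simp add: x)
    qed
  qed
  have "congruence_generated n M = L"
    unfolding congruence_generated_def
  proof
    have "M \<subseteq> L" by (simp add: M_def Collect_mono_iff subset_iff)
    with Lcong show "\<Inter> {R. monoid_congruence n R \<and> M \<subseteq> R} \<subseteq> L" by blast
    show "L \<subseteq> \<Inter> {R. monoid_congruence n R \<and> M \<subseteq> R}"
      using in_R by blast
  qed
  then have "presentation n s M"
    using \<open>finite M\<close> unfolding presentation_def L_def[symmetric]
    by (simp add: M_def L_def subset_iff)
  then show ?thesis by blast
qed

section \<open>Homogeneous bases that multiply like the semigroup up to lower terms\<close>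

text \<open>Directness of the grading is kept as \<open>component_of_sum\<close>, with ordinary sums
  in the type \<open>'a\<close>, which leaves the record operations behind. For
  \<open>T = {0}\<close> it says that a scalar lying in a component of nonzero degree
  vanishes.\<close>

locale graded_unital_algebra = unital_algebra scale
  for scale :: "'k::field \<Rightarrow> 'a::ring_1 \<Rightarrow> 'a" +
  fixes r :: nat and \<A> :: "(nat \<Rightarrow> nat) \<Rightarrow> 'a set"
  assumes subspace_component: "v \<in> Npow r \<Longrightarrow> subspace (\<A> v)"
    and component_mult:
      "v \<in> Npow r \<Longrightarrow> w \<in> Npow r \<Longrightarrow> x \<in> \<A> v \<Longrightarrow> y \<in> \<A> w \<Longrightarrow> x * y \<in> \<A> (v + w)"
    and component_zero: "\<A> 0 = range (\<lambda>c. scale c 1)"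
    and component_of_sum:
      "finite T \<Longrightarrow> T \<subseteq> Npow r \<Longrightarrow> (\<And>v. v \<in> T \<Longrightarrow> g v \<in> \<A> v) \<Longrightarrow> w \<in> Npow r \<Longrightarrow>
        (\<Sum>v\<in>T. g v) \<in> \<A> w \<Longrightarrow> (\<Sum>v\<in>T. g v) = (if w \<in> T then g w else 0)"
begin

abbreviation homogeneous :: "'a \<Rightarrow> bool" where
  "homogeneous x \<equiv> \<exists>v\<in>Npow r. x \<in> \<A> v"

lemma one_in_component_zero: "1 \<in> \<A> 0"
  unfolding component_zero using scale_one by (metis rangeI)

lemma homogeneous_mult: "homogeneous x \<Longrightarrow> homogeneous y \<Longrightarrow> homogeneous (x * y)"
  using component_mult by (blast intro: Npow_add)

lemma homogeneous_power: "homogeneous x \<Longrightarrow> homogeneous (x ^ k)"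
proof (induction k)
  case 0
  show ?case using one_in_component_zero by (auto intro!: bexI[of _ 0])
next
  case (Suc k)
  then show ?case unfolding power_Suc by (intro homogeneous_mult)
qed

lemma homogeneous_monomial:
  "(\<And>i. i < n \<Longrightarrow> homogeneous (b i)) \<Longrightarrow> homogeneous (monomial_at n b \<xi>)"
proof (induction n)
  case 0
  show ?case using one_in_component_zero by (auto simp: monomial_at_def intro!: bexI[of _ 0])
next
  case (Suc n)
  have eq: "monomial_at (Suc n) b \<xi> = monomial_at n b \<xi> * b n ^ \<xi> n"
    by (simp add: monomial_at_def)
  have "homogeneous (monomial_at n b \<xi>)" using Suc by simp
  moreover have "homogeneous (b n ^ \<xi> n)" by (rule homogeneous_power) (simp add: Suc.prems)
  ultimately show ?case unfolding eq by (rule homogeneous_mult)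
qed

end

lemma connected_graded_algebra_imp_graded_unital_algebra:
  fixes scale :: "'k::field \<Rightarrow> 'a::ring_1 \<Rightarrow> 'a"
  assumes "connected_graded_algebra r (algebra_of_type scale) \<A>"
  shows "graded_unital_algebra scale r \<A>"
proof -
  let ?M = "algebra_of_type scale"
  have gr: "graded_algebra r ?M \<A>" and z: "\<A> 0 = range (\<lambda>c. scale c 1)"
    using assms by (auto simp: connected_graded_algebra_def algebra_of_type_def)
  have k: "k_algebra ?M"
    and sub: "\<And>v. v \<in> Npow r \<Longrightarrow> additive_subgroup (\<A> v) ?M"
      "\<And>v c x. v \<in> Npow r \<Longrightarrow> x \<in> \<A> v \<Longrightarrow> scale c x \<in> \<A> v"
    and mul: "\<And>v w x y. v \<in> Npow r \<Longrightarrow> w \<in> Npow r \<Longrightarrow> x \<in> \<A> v \<Longrightarrow> y \<in> \<A> w \<Longrightarrow> x * y \<in> \<A> (v + w)"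
    and dec: "\<And>x. \<exists>!f. (\<forall>v\<in>Npow r. f v \<in> \<A> v) \<and> (\<forall>v. v \<notin> Npow r \<longrightarrow> f v = 0) \<and>
        finite {v. f v \<noteq> 0} \<and> x = finsum ?M f {v. f v \<noteq> 0}"
    using gr unfolding graded_algebra_def by (simp_all add: algebra_of_type_def)
  have ring: "ring ?M" and md: "Module.module (ring_of_type_algebra :: 'k ring) ?M"
    and sc: "\<And>c x y. scale c x * y = scale c (x * y)" "\<And>c x y. x * scale c y = scale c (x * y)"
    using k unfolding k_algebra_def by (simp_all add: algebra_of_type_def)
  have vs: "vector_space scale"
  proof
    fix a b x y
    show "scale a (x + y) = scale a x + scale a y"
      using Module.module.smult_r_distr[OF md, of a x y]
      by (simp add: algebra_of_type_def ring_of_type_algebra_def)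
    show "scale (a + b) x = scale a x + scale b x"
      using Module.module.smult_l_distr[OF md, of a b x]
      by (simp add: algebra_of_type_def ring_of_type_algebra_def)
    show "scale a (scale b x) = scale (a * b) x"
      using Module.module.smult_assoc1[OF md, of a b x]
      by (simp add: algebra_of_type_def ring_of_type_algebra_def)
    show "scale 1 x = x"
      using Module.module.smult_one[OF md, of x]
      by (simp add: algebra_of_type_def ring_of_type_algebra_def)
  qed
  interpret unital_algebra scale
    using vs sc by (simp add: unital_algebra_def unital_algebra_axioms_def)
  interpret M: ring ?M by (rule ring)
  have fs: "finsum ?M f T = sum f T" if "finite T" for f and T :: "(nat \<Rightarrow> nat) set"
    using that
  proof induction
    case empty
    have "finsum ?M f {} = \<zero>\<^bsub>?M\<^esub>" by (rule M.finsum_empty)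
    then show ?case by (simp add: algebra_of_type_def)
  next
    case (insert x F)
    have "finsum ?M f (insert x F) = f x \<oplus>\<^bsub>?M\<^esub> finsum ?M f F"
      using insert by (intro M.finsum_insert) (auto simp: algebra_of_type_def)
    with insert show ?case by (simp add: algebra_of_type_def)
  qed
  have sp: "subspace (\<A> v)" if v: "v \<in> Npow r" for v
  proof (rule subspaceI)
    note sg = sub(1)[OF v, unfolded additive_subgroup_def]
    show "0 \<in> \<A> v" using subgroup.one_closed[OF sg] by (simp add: algebra_of_type_def)
    show "x + y \<in> \<A> v" if "x \<in> \<A> v" "y \<in> \<A> v" for x y
      using subgroup.m_closed[OF sg that] by (simp add: algebra_of_type_def)
  qed (rule sub(2)[OF v])
  show ?thesis
  proof (unfold_locales)
    fix T g w
    assume T: "finite T" "T \<subseteq> Npow r" "\<And>v. v \<in> T \<Longrightarrow> g v \<in> \<A> v" and w: "w \<in> Npow r"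
      and sum: "(\<Sum>v\<in>T. g v) \<in> \<A> w"
    let ?x = "\<Sum>v\<in>T. g v"
    \<comment> \<open>Two decompositions of the same element: \<open>f1\<close> uses the given
      summands, \<open>f2\<close> places everything in degree \<open>w\<close>. Uniqueness
      identifies them.\<close>
    define f1 where "f1 v = (if v \<in> T then g v else 0)" for v
    define f2 where "f2 v = (if v = w then ?x else 0)" for v
    have A0: "0 \<in> \<A> v" if "v \<in> Npow r" for v using sp[OF that] by (rule subspace_0)
    have fin: "finite {v. f1 v \<noteq> 0}" "finite {v. f2 v \<noteq> 0}"
      using T(1) by (auto simp: f1_def f2_def intro: finite_subset[of _ T] finite_subset[of _ "{w}"])
    have "?x = sum f1 {v. f1 v \<noteq> 0}"
      by (rule sum.mono_neutral_cong_right) (use T in \<open>auto simp: f1_def\<close>)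
    then have 1: "(\<forall>v\<in>Npow r. f1 v \<in> \<A> v) \<and> (\<forall>v. v \<notin> Npow r \<longrightarrow> f1 v = 0) \<and>
        finite {v. f1 v \<noteq> 0} \<and> ?x = finsum ?M f1 {v. f1 v \<noteq> 0}"
      using T A0 fin by (auto simp: f1_def fs)
    have "?x = sum f2 {w}" by (simp add: f2_def)
    also have "\<dots> = sum f2 {v. f2 v \<noteq> 0}"
      by (rule sum.mono_neutral_right) (auto simp: f2_def)
    finally have 2: "(\<forall>v\<in>Npow r. f2 v \<in> \<A> v) \<and> (\<forall>v. v \<notin> Npow r \<longrightarrow> f2 v = 0) \<and>
        finite {v. f2 v \<noteq> 0} \<and> ?x = finsum ?M f2 {v. f2 v \<noteq> 0}"
      using w sum A0 fin by (auto simp: f2_def fs)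
    have "f1 = f2" using dec[of ?x] 1 2 by blast
    then have "f2 w = f1 w" by simp
    then show "?x = (if w \<in> T then g w else 0)" by (simp add: f1_def f2_def)
  qed (use sp mul z in auto)
qed

text \<open>Of \<alpha> only nonvanishing is assumed; \<open>two_cocycle_structure\<close> derives
  the cocycle identity. The unit is merely a multiple of \<open>e 0\<close>, in accordance with
  cocycles that are not normalised.\<close>

locale adapted_basis = graded_unital_algebra scale r \<A>
  for scale :: "'k::field \<Rightarrow> 'a::ring_1 \<Rightarrow> 'a" and r :: nat and \<A> :: "(nat \<Rightarrow> nat) \<Rightarrow> 'a set" +
  fixes \<phi> :: "'s::comm_monoid_add \<Rightarrow> nat" and e :: "'s \<Rightarrow> 'a" and \<alpha> :: "'s \<Rightarrow> 's \<Rightarrow> 'k"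
  assumes weight_additive: "additive_morphism \<phi>" and weight_zero: "\<phi> -` {0} = {0}"
    and basis_independent: "independent_family scale e"
    and basis_spans: "span (range e) = UNIV"
    and basis_homogeneous: "\<And>x. homogeneous (e x)"
    and one_eq_basis_zero: "\<exists>c. 1 = scale c (e 0)"
    and structure_nonzero: "\<alpha> x y \<noteq> 0"
    and basis_mult: "e x * e y - scale (\<alpha> x y) (e (x + y)) \<in> span (e ` {u. \<phi> u < \<phi> (x + y)})"

text \<open>Turns the error terms of (ii) and (iii) into a subspace. Finiteness of the support of
  \<open>c\<close> is what allows it to become an \<open>Abs_poly_mapping\<close>.\<close>

lemma (in unital_algebra) lower_terms_eq_span:
  "lower_terms scale n s \<phi> b N =
    span (monomial_at n b ` {\<xi> \<in> Npow n. \<phi> (pres_map n s \<xi>) < N})"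
proof -
  have "lower_terms scale n s \<phi> b N = {lincomb scale (monomial_at n b) f | f.
      Poly_Mapping.keys f \<subseteq> {\<xi> \<in> Npow n. \<phi> (pres_map n s \<xi>) < N}}" (is "?L = ?R")
  proof
    show "?L \<subseteq> ?R"
    proof
      fix y assume "y \<in> ?L"
      then obtain c where c: "y = (\<Sum>\<xi> | c \<xi> \<noteq> 0. scale (c \<xi>) (monomial_at n b \<xi>))"
        "finite {\<xi>. c \<xi> \<noteq> 0}" "\<forall>\<xi>. c \<xi> \<noteq> 0 \<longrightarrow> \<xi> \<in> Npow n \<and> \<phi> (pres_map n s \<xi>) < N"
        by (auto simp: lower_terms_def)
      have "Poly_Mapping.keys (Abs_poly_mapping c) = {\<xi>. c \<xi> \<noteq> 0}"
        using c(2) by (auto simp: in_keys_iff)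
      with c show "y \<in> ?R"
        by (intro CollectI exI[of _ "Abs_poly_mapping c"]) (auto simp: lincomb_def)
    qed
    show "?R \<subseteq> ?L"
    proof
      fix y assume "y \<in> ?R"
      then obtain f where f: "y = lincomb scale (monomial_at n b) f"
        "Poly_Mapping.keys f \<subseteq> {\<xi> \<in> Npow n. \<phi> (pres_map n s \<xi>) < N}" by blast
      have keys: "{\<xi>. Poly_Mapping.lookup f \<xi> \<noteq> 0} = Poly_Mapping.keys f"
        by (auto simp: in_keys_iff)
      show "y \<in> ?L"
        unfolding lower_terms_def
        by (intro CollectI exI[of _ "Poly_Mapping.lookup f"])
          (use f keys in \<open>auto simp: lincomb_def in_keys_iff\<close>)
    qed
  qed
  then show ?thesis by (simp add: span_image_eq_lincomb)
qed

section \<open>Calculus of leading terms for an adapted basis\<close>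

context adapted_basis
begin

lemma weight_add: "\<phi> (x + y) = \<phi> x + \<phi> y"
  using weight_additive by (simp add: additive_morphism_def)

lemma weight_zero_iff: "\<phi> x = 0 \<longleftrightarrow> x = 0"
  using weight_zero by auto

text \<open>The bound is strict so that \<open>below 0\<close> is the zero space and
  \<open>below d\<close> can stand for the filtration step preceding degree \<open>d\<close>; the
  step of degree \<open>d\<close> itself is \<open>below (Suc d)\<close>.\<close>

definition below :: "nat \<Rightarrow> 'a set" where
  "below N = span (e ` {u. \<phi> u < N})"

lemma subspace_below [simp]: "subspace (below N)"
  by (simp add: below_def)

lemma below_mono: "N \<le> M \<Longrightarrow> below N \<subseteq> below M"
  unfolding below_def by (rule span_mono) auto

lemma basis_in_below: "\<phi> x < N \<Longrightarrow> e x \<in> below N"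
  by (auto simp: below_def intro: span_base)

lemma basis_mult_below: "e x * e y - scale (\<alpha> x y) (e (x + y)) \<in> below (\<phi> x + \<phi> y)"
  using basis_mult[of x y] by (simp add: below_def weight_add)

lemma basis_mult_below_Suc: "e x * e y \<in> below (Suc (\<phi> x + \<phi> y))"
proof -
  have "scale (\<alpha> x y) (e (x + y)) \<in> below (Suc (\<phi> x + \<phi> y))"
    by (intro subspace_scale basis_in_below) (simp_all add: weight_add)
  moreover have "e x * e y - scale (\<alpha> x y) (e (x + y)) \<in> below (Suc (\<phi> x + \<phi> y))"
    using basis_mult_below below_mono[of "\<phi> x + \<phi> y" "Suc (\<phi> x + \<phi> y)"] by auto
  ultimately have "(e x * e y - scale (\<alpha> x y) (e (x + y))) + scale (\<alpha> x y) (e (x + y))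
      \<in> below (Suc (\<phi> x + \<phi> y))"
    by (intro subspace_add) auto
  then show ?thesis by simp
qed

text \<open>Strict bounds gain one: \<open>\<phi> u < N\<close> and \<open>\<phi> v < M\<close> give
  \<open>Suc (\<phi> u + \<phi> v) < N + M\<close>, whence the slack \<open>Suc K\<close>. Thus one
  factor may carry its full leading term without spoiling the bound, provided the other factor is
  lower.\<close>

lemma below_mult:
  assumes "a \<in> below N" "b \<in> below M" and K: "N + M \<le> Suc K"
  shows "a * b \<in> below K"
  using subspace_below _ assms(1,2)[unfolded below_def]
proof (rule mult_mem_of_spans)
  fix x y assume "x \<in> e ` {u. \<phi> u < N}" "y \<in> e ` {u. \<phi> u < M}"
  then obtain u v where "x = e u" "y = e v" "\<phi> u < N" "\<phi> v < M" by auto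
  then show "x * y \<in> below K"
    using basis_mult_below_Suc[of u v] below_mono[of "Suc (\<phi> u + \<phi> v)" K] K by auto
qed

text \<open>The coefficient is existentially quantified because only its nonvanishing matters;
  products and powers then need no bookkeeping of scalars.\<close>

definition leading :: "'a \<Rightarrow> 's \<Rightarrow> bool" where
  "leading a x \<longleftrightarrow> (\<exists>c. c \<noteq> 0 \<and> a - scale c (e x) \<in> below (\<phi> x))"

lemma leading_basis: "leading (e x) x"
  unfolding leading_def by (intro exI[of _ 1]) (simp add: subspace_0)

lemma leading_one: "leading 1 0"
proof -
  obtain c where c: "1 = scale c (e 0)" using one_eq_basis_zero by blast
  then have "c \<noteq> 0" by auto
  with c show ?thesis
    unfolding leading_def by (intro exI[of _ c]) (simp add: subspace_0)
qed

lemma leading_mult: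
  assumes "leading a x" "leading b y"
  shows "leading (a * b) (x + y)"
proof -
  obtain c d where c: "c \<noteq> 0" "a - scale c (e x) \<in> below (\<phi> x)"
    and d: "d \<noteq> 0" "b - scale d (e y) \<in> below (\<phi> y)"
    using assms by (auto simp: leading_def)
  define l m where "l = a - scale c (e x)" and "m = b - scale d (e y)"
  have a: "a = scale c (e x) + l" and b: "b = scale d (e y) + m"
    by (simp_all add: l_def m_def)
  have l: "l \<in> below (\<phi> x)" and m: "m \<in> below (\<phi> y)" using c d by (simp_all add: l_def m_def)
  have 1: "scale (c * d) (e x * e y - scale (\<alpha> x y) (e (x + y))) \<in> below (\<phi> x + \<phi> y)"
    by (intro subspace_scale basis_mult_below) simp
  have 2: "scale c (e x) * m \<in> below (\<phi> x + \<phi> y)"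
    by (rule below_mult[of _ "Suc (\<phi> x)" _ "\<phi> y"])
      (use m in \<open>auto intro!: subspace_scale basis_in_below\<close>)
  have 3: "l * b \<in> below (\<phi> x + \<phi> y)"
  proof (rule below_mult[of _ "\<phi> x" _ "Suc (\<phi> y)"])
    have "m \<in> below (Suc (\<phi> y))" using m below_mono[of "\<phi> y" "Suc (\<phi> y)"] by auto
    then show "b \<in> below (Suc (\<phi> y))"
      unfolding b by (auto intro!: subspace_add subspace_scale basis_in_below)
  qed (use l in auto)
  \<comment> \<open>The error has three sources: the product of the two basis elements, the lower
    part of \<open>b\<close>, and the lower part of \<open>a\<close>.\<close>
  have "a * b - scale (c * d * \<alpha> x y) (e (x + y)) =
      scale (c * d) (e x * e y - scale (\<alpha> x y) (e (x + y))) + scale c (e x) * m + l * b"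
    unfolding a
    by (simp add: b distrib_left distrib_right scale_mult_left scale_mult_right
        scale_right_diff_distrib scale_right_distrib mult.commute)
  also have "\<dots> \<in> below (\<phi> (x + y))"
    using 1 2 3 by (simp add: weight_add subspace_add)
  finally show ?thesis
    unfolding leading_def using c(1) d(1) structure_nonzero
    by (intro exI[of _ "c * d * \<alpha> x y"]) simp
qed

lemma leading_power: "leading a x \<Longrightarrow> leading (a ^ k) (\<Sum>_<k. x)"
  by (induction k) (auto simp: leading_one power_Suc2 simp del: power_Suc intro: leading_mult)

lemma leading_monomial: "leading (monomial_at n (\<lambda>i. e (s i)) \<xi>) (pres_map n s \<xi>)"
proof (induction n)
  case 0
  show ?case by (simp add: monomial_at_def pres_map_def leading_one)
next
  case (Suc n)
  have "leading (monomial_at n (\<lambda>i. e (s i)) \<xi> * e (s n) ^ \<xi> n)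
      (pres_map n s \<xi> + (\<Sum>_<\<xi> n. s n))"
    by (intro leading_mult leading_power leading_basis Suc)
  then show ?case by (simp add: monomial_at_def pres_map_def)
qed

lemma leading_imp_below: "leading a x \<Longrightarrow> \<phi> x < N \<Longrightarrow> a \<in> below N"
proof -
  assume "leading a x" and N: "\<phi> x < N"
  then obtain c where c: "a - scale c (e x) \<in> below (\<phi> x)" by (auto simp: leading_def)
  have "scale c (e x) + (a - scale c (e x)) \<in> below N"
    using c below_mono[of "\<phi> x" N] N
    by (intro subspace_add subspace_scale basis_in_below) auto
  then show ?thesis by simp
qed

text \<open>Both elements are proportional to \<open>e x\<close> modulo lower terms, so the quotient
  of their leading coefficients relates them. This is the common shape of the relations (ii) and
  (iii).\<close>

lemma leading_compare:
  assumes "leading a x" "leading b x"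
  shows "\<exists>c. c \<noteq> 0 \<and> a - scale c b \<in> below (\<phi> x)"
proof -
  obtain c d where c: "c \<noteq> 0" "a - scale c (e x) \<in> below (\<phi> x)"
    and d: "d \<noteq> 0" "b - scale d (e x) \<in> below (\<phi> x)"
    using assms by (auto simp: leading_def)
  have "(a - scale c (e x)) - scale (c / d) (b - scale d (e x)) \<in> below (\<phi> x)"
    by (rule subspace_diff[OF subspace_below c(2) subspace_scale[OF subspace_below d(2)]])
  also have "(a - scale c (e x)) - scale (c / d) (b - scale d (e x)) = a - scale (c / d) b"
    using d(1) by (simp add: scale_right_diff_distrib)
  finally show ?thesis using c d by (intro exI[of _ "c / d"]) simp
qed

text \<open>A triangular change of basis preserves every step of the weight filtration, not just the
  whole space. Applied to a section, it presents \<open>below N\<close> as a span of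
  monomials.\<close>

lemma span_leading:
  assumes "\<And>x. leading (f x) x"
  shows "span (f ` {u. \<phi> u < N}) = below N"
proof
  show "span (f ` {u. \<phi> u < N}) \<subseteq> below N"
    by (rule span_minimal) (use assms in \<open>auto intro: leading_imp_below\<close>)
  have "\<exists>y\<in>span (f ` {u. \<phi> u < Suc (\<phi> x)}). e x - y \<in> span (e ` {j \<in> UNIV. \<phi> j < \<phi> x})" for x
  proof -
    obtain c where "e x - scale c (f x) \<in> below (\<phi> x)"
      using leading_compare[OF leading_basis assms] by blast
    then show ?thesis
      by (intro bexI[of _ "scale c (f x)"])
        (simp_all add: below_def span_scale[OF span_base[OF imageI]])
  qed
  then have "span (e ` {j \<in> UNIV. \<phi> j < N}) \<subseteq> span (f ` {u. \<phi> u < N})"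
    by (intro span_subset_of_reduction[where V = "\<lambda>N. span (f ` {u. \<phi> u < N})"])
      (auto simp: mono_def intro!: span_mono)
  then show "below N \<subseteq> span (f ` {u. \<phi> u < N})" by (simp add: below_def)
qed

lemma union_below: "(\<Union>N. below N) = UNIV"
proof -
  have "a \<in> (\<Union>N. below N)" for a
  proof -
    have "a \<in> span (e ` UNIV)" using basis_spans by simp
    then obtain f where f: "a = lincomb scale e f" by (auto simp: span_image_eq_lincomb)
    have "a \<in> below (Suc (Max (\<phi> ` Poly_Mapping.keys f)))"
      unfolding f below_def by (rule lincomb_in_span) (auto simp: less_Suc_eq_le)
    then show ?thesis by blast
  qed
  then show ?thesis by blast
qed

lemma independent_family_leading:
  assumes "\<And>x. leading (f x) x"
  shows "independent_family scale f"
  by (rule independent_family_triangular[OF basis_independent, of _ \<phi>])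
    (use assms in \<open>simp add: leading_def below_def\<close>)

text \<open>In (ii) and (iii) the two monomials have the same image in \<open>S\<close>, by
  commutativity and because \<open>P\<close> lies in the kernel, so \<open>leading_compare\<close>
  applies to both. Neither \<phi> nor the generators depend on \<open>P\<close> or on a section, so
  one choice serves all of (2).\<close>

theorem imp_S_phi_type:
  assumes S: "positive_affine_semigroup TYPE('s)" and s: "bij_betw s {..<n} hilbert_basis"
    and P: "presentation n s P"
  shows "\<exists>b. S_phi_type scale r \<A> n s P \<phi> b \<and>
    (\<forall>\<tau>. pres_section n s \<tau> \<longrightarrow> independent_family scale (\<lambda>x. monomial_at n b (\<tau> x)))"
proof -
  define b where "b = (\<lambda>i. e (s i))"
  have lead: "leading (monomial_at n b \<xi>) (pres_map n s \<xi>)" for \<xi>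
    using leading_monomial[of n s \<xi>] by (simp add: b_def)
  have sec: "leading (monomial_at n b (\<tau> x)) x" if "pres_section n s \<tau>" for \<tau> x
    using lead[of "\<tau> x"] that by (simp add: pres_section_def)
  \<comment> \<open>Any section will do here: it selects monomials forming a triangular basis, so
    that monomials span each \<open>below N\<close>.\<close>
  obtain \<tau> where \<tau>: "pres_section n s \<tau>" using pres_section_exists[OF S s] by blast
  have span_sec: "span ((\<lambda>x. monomial_at n b (\<tau> x)) ` {u. \<phi> u < N}) = below N" for N
    by (rule span_leading) (rule sec[OF \<tau>])
  have lower: "lower_terms scale n s \<phi> b N = below N" for N
    unfolding lower_terms_eq_span
  proof
    show "span (monomial_at n b ` {\<xi> \<in> Npow n. \<phi> (pres_map n s \<xi>) < N}) \<subseteq> below N"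
      by (rule span_minimal) (auto intro!: leading_imp_below[OF lead])
    show "below N \<subseteq> span (monomial_at n b ` {\<xi> \<in> Npow n. \<phi> (pres_map n s \<xi>) < N})"
      unfolding span_sec[symmetric] by (rule span_mono) (use \<tau> in \<open>auto simp: pres_section_def\<close>)
  qed
  have diff_iff: "(\<exists>c. c \<noteq> 0 \<and> (\<exists>l \<in> below N. x = scale c y + l)) \<longleftrightarrow>
      (\<exists>c. c \<noteq> 0 \<and> x - scale c y \<in> below N)" for x y N
    by (intro ex_cong1 conj_cong refl) (auto intro!: bexI[of _ "x - scale _ y"])
  have gen: "subalgebra_generated scale (b ` {..<n}) = UNIV"
  proof -
    let ?G = "subalgebra_generated scale (b ` {..<n})"
    have pow: "b i ^ k \<in> ?G" if "i < n" for i k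
    proof (induction k)
      case (Suc k)
      have "b i \<in> ?G" using that by (intro subalgebra_generated.base) simp
      then show ?case unfolding power_Suc using Suc by (rule subalgebra_generated.mult)
    qed (simp add: subalgebra_generated.one)
    have "monomial_at m b \<xi> \<in> ?G" if "m \<le> n" for m \<xi>
      using that
    proof (induction m)
      case (Suc m)
      then have "monomial_at m b \<xi> * b m ^ \<xi> m \<in> ?G"
        by (intro subalgebra_generated.mult pow) simp_all
      then show ?case by (simp add: monomial_at_def)
    qed (simp add: monomial_at_def subalgebra_generated.one)
    then have mon: "monomial_at n b \<xi> \<in> ?G" for \<xi> by simp
    have zero: "0 \<in> ?G"
      using subalgebra_generated.scale[OF subalgebra_generated.one, of scale 0 "b ` {..<n}"] by simp
    have "subspace ?G"
      by (rule subspaceI)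
        (simp_all add: zero subalgebra_generated.add subalgebra_generated.scale)
    then have "below N \<subseteq> ?G" for N
      unfolding span_sec[symmetric] by (rule span_minimal[rotated]) (use mon in auto)
    then show ?thesis using union_below by blast
  qed
  have "S_phi_type scale r \<A> n s P \<phi> b"
    unfolding S_phi_type_def lower diff_iff
  proof (intro conjI)
    show "\<forall>i j. i < j \<and> j < n \<longrightarrow>
        (\<exists>c. c \<noteq> 0 \<and> b j * b i - scale c (b i * b j) \<in> below (\<phi> (s i + s j)))"
    proof (intro allI impI)
      fix i j
      have "leading (b j * b i) (s j + s i)" "leading (b i * b j) (s i + s j)"
        unfolding b_def by (intro leading_mult leading_basis)+
      then show "\<exists>c. c \<noteq> 0 \<and> b j * b i - scale c (b i * b j) \<in> below (\<phi> (s i + s j))"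
        by (intro leading_compare) (simp_all add: add.commute)
    qed
    show "\<forall>(p, p')\<in>P. \<exists>d. d \<noteq> 0 \<and>
        monomial_at n b p' - scale d (monomial_at n b p) \<in> below (\<phi> (pres_map n s p))"
    proof clarify
      fix p p' assume "(p, p') \<in> P"
      then have "(p, p') \<in> congruence_generated n P" by (auto simp: congruence_generated_def)
      then have "pres_map n s p = pres_map n s p'" using P by (simp add: presentation_def)
      then show "\<exists>d. d \<noteq> 0 \<and>
          monomial_at n b p' - scale d (monomial_at n b p) \<in> below (\<phi> (pres_map n s p))"
        using lead[of p] lead[of p'] by (intro leading_compare) simp_all
    qed
  qed (use weight_additive weight_zero gen basis_homogeneous in \<open>auto simp: b_def\<close>)
  moreover have "independent_family scale (\<lambda>x. monomial_at n b (\<tau> x))" if "pres_section n s \<tau>" for \<tau>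
    using sec[OF that] by (rule independent_family_leading)
  ultimately show ?thesis by blast
qed

end

section \<open>Straightening words in algebras of \<open>(S,\<phi>)\<close>-type\<close>

lemma prod_list_block_word:
  "prod_list (map b (concat (map (\<lambda>i. replicate (\<xi> i) i) [0..<m]))) = monomial_at m b \<xi>"
  by (induction m) (auto simp: monomial_at_def)

lemma sum_list_replicate_eq_sum: "sum_list (replicate k x) = (\<Sum>_<k. x)"
  by (induction k) (auto simp: add.commute)

lemma sum_list_block_word:
  "sum_list (map s (concat (map (\<lambda>i. replicate (\<xi> i) i) [0..<m]))) = pres_map m s \<xi>"
proof (induction m)
  case (Suc m)
  then show ?case
    by (simp add: pres_map_def sum_list_replicate_eq_sum)
qed (simp add: pres_map_def)

lemma count_block_word:
  "count (mset (concat (map (\<lambda>i. replicate (\<xi> i) i) [0..<m]))) j = (if j < m then \<xi> j else 0)"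
  by (induction m) (auto simp: less_Suc_eq)

locale S_phi_algebra = graded_unital_algebra scale r \<A>
  for scale :: "'k::field \<Rightarrow> 'a::ring_1 \<Rightarrow> 'a" and r :: nat and \<A> :: "(nat \<Rightarrow> nat) \<Rightarrow> 'a set" +
  fixes n :: nat and s :: "nat \<Rightarrow> 's::comm_monoid_add" and P and \<phi> :: "'s \<Rightarrow> nat" and b :: "nat \<Rightarrow> 'a"
  assumes type: "S_phi_type scale r \<A> n s P \<phi> b" and pres: "presentation n s P"
begin

definition word_val :: "nat list \<Rightarrow> 'a" where "word_val w = prod_list (map b w)"

definition word_deg :: "nat list \<Rightarrow> 's" where "word_deg w = sum_list (map s w)"

abbreviation words :: "nat list set" where "words \<equiv> lists {..<n}"

abbreviation block_word :: "(nat \<Rightarrow> nat) \<Rightarrow> nat list" where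
  "block_word \<xi> \<equiv> concat (map (\<lambda>i. replicate (\<xi> i) i) [0..<n])"

text \<open>Unlike the span of ordered monomials, the span of all words is visibly multiplicative;
  that the two agree is the point of the straightening.\<close>

definition word_below :: "nat \<Rightarrow> 'a set" where
  "word_below N = span (word_val ` {w \<in> words. \<phi> (word_deg w) < N})"

lemma weight_add: "\<phi> (x + y) = \<phi> x + \<phi> y"
  using type by (simp add: S_phi_type_def additive_morphism_def)

lemma word_append [simp]:
  "word_val (u @ v) = word_val u * word_val v" "word_deg (u @ v) = word_deg u + word_deg v"
  by (simp_all add: word_val_def word_deg_def)

lemma block_word_val [simp]: "word_val (block_word \<xi>) = monomial_at n b \<xi>"
  unfolding word_val_def by (rule prod_list_block_word)

lemma block_word_deg [simp]: "word_deg (block_word \<xi>) = pres_map n s \<xi>"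
  unfolding word_deg_def by (rule sum_list_block_word)

lemma block_word_in_words [simp]: "block_word \<xi> \<in> words"
  by auto

lemma subspace_word_below [simp]: "subspace (word_below N)"
  by (simp add: word_below_def)

lemma lower_terms_subset_word_below: "lower_terms scale n s \<phi> b N \<subseteq> word_below N"
  unfolding lower_terms_eq_span word_below_def
proof (rule span_mono, rule image_subsetI)
  fix \<xi> assume "\<xi> \<in> {\<xi> \<in> Npow n. \<phi> (pres_map n s \<xi>) < N}"
  then show "monomial_at n b \<xi> \<in> word_val ` {w \<in> words. \<phi> (word_deg w) < N}"
    by (intro image_eqI[of _ _ "block_word \<xi>"]) (simp_all del: in_lists_conv_set)
qed

text \<open>Multiplying by words on either side shifts the bound by exactly their weights. Hence a
  relation between short words may be applied inside a longer one.\<close>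

lemma word_below_context:
  assumes "p \<in> words" "q \<in> words" "l \<in> word_below N"
  shows "word_val p * l * word_val q \<in> word_below (\<phi> (word_deg p) + N + \<phi> (word_deg q))"
proof -
  let ?V = "word_below (\<phi> (word_deg p) + N + \<phi> (word_deg q))"
  have 1: "word_val p * word_val u * word_val q \<in> ?V" if "u \<in> words" "\<phi> (word_deg u) < N" for u
    unfolding word_below_def word_append(1)[symmetric]
    by (intro span_base imageI) (use that assms in \<open>simp add: weight_add\<close>)
  show ?thesis
    using assms(3) unfolding word_below_def[of N]
  proof (induction rule: span_induct_alt)
    case base
    show ?case by (simp add: subspace_0)
  next
    case (step c y z)
    then obtain u where "y = word_val u" "u \<in> words" "\<phi> (word_deg u) < N" by auto
    then have "word_val p * y * word_val q \<in> ?V" using 1 by simp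
    with step(2) show ?case
      by (simp add: distrib_left distrib_right scale_mult_left scale_mult_right
          subspace_add subspace_scale)
  qed
qed

text \<open>Proportionality of symbols, before any associated graded algebra is available. Requiring
  equal degrees in \<open>S\<close> gives both words the same weight bound, which makes the relation
  symmetric and transitive.\<close>

definition word_equiv :: "nat list \<Rightarrow> nat list \<Rightarrow> bool" where
  "word_equiv u v \<longleftrightarrow> u \<in> words \<and> v \<in> words \<and> word_deg u = word_deg v \<and>
    (\<exists>c. c \<noteq> 0 \<and> word_val u - scale c (word_val v) \<in> word_below (\<phi> (word_deg u)))"

lemma word_equiv_refl: "u \<in> words \<Longrightarrow> word_equiv u u"
  unfolding word_equiv_def by (simp add: exI[of _ 1] subspace_0)

lemma word_equiv_sym:
  assumes "word_equiv u v"
  shows "word_equiv v u"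
proof -
  obtain c where c: "c \<noteq> 0" "word_val u - scale c (word_val v) \<in> word_below (\<phi> (word_deg u))"
    using assms by (auto simp: word_equiv_def)
  have "scale (- inverse c) (word_val u - scale c (word_val v)) \<in> word_below (\<phi> (word_deg u))"
    by (intro subspace_scale c(2)) simp
  also have "scale (- inverse c) (word_val u - scale c (word_val v)) =
      word_val v - scale (inverse c) (word_val u)"
    using c(1) by (simp add: scale_right_diff_distrib)
  finally show ?thesis
    using assms c(1) unfolding word_equiv_def by (intro conjI exI[of _ "inverse c"]) auto
qed

lemma word_equiv_trans:
  assumes "word_equiv u v" "word_equiv v w"
  shows "word_equiv u w"
proof -
  obtain c d where c: "c \<noteq> 0" "word_val u - scale c (word_val v) \<in> word_below (\<phi> (word_deg u))"
    and d: "d \<noteq> 0" "word_val v - scale d (word_val w) \<in> word_below (\<phi> (word_deg u))"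
    using assms by (auto simp: word_equiv_def)
  have "(word_val u - scale c (word_val v)) + scale c (word_val v - scale d (word_val w))
      \<in> word_below (\<phi> (word_deg u))"
    by (rule subspace_add[OF subspace_word_below c(2) subspace_scale[OF subspace_word_below d(2)]])
  then have "word_val u - scale (c * d) (word_val w) \<in> word_below (\<phi> (word_deg u))"
    by (simp add: scale_right_diff_distrib)
  then show ?thesis
    using assms c(1) d(1) unfolding word_equiv_def by (intro conjI exI[of _ "c * d"]) auto
qed

lemma word_equiv_context:
  assumes "word_equiv u v" "p \<in> words" "q \<in> words"
  shows "word_equiv (p @ u @ q) (p @ v @ q)"
proof -
  obtain c where c: "c \<noteq> 0" "word_val u - scale c (word_val v) \<in> word_below (\<phi> (word_deg u))"
    using assms by (auto simp: word_equiv_def)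
  have "word_val p * (word_val u - scale c (word_val v)) * word_val q \<in>
      word_below (\<phi> (word_deg p) + \<phi> (word_deg u) + \<phi> (word_deg q))"
    by (rule word_below_context[OF assms(2,3) c(2)])
  also have "word_val p * (word_val u - scale c (word_val v)) * word_val q =
      word_val (p @ u @ q) - scale c (word_val (p @ v @ q))"
    by (simp add: algebra_simps scale_mult_left scale_mult_right)
  finally show ?thesis
    using assms c(1) unfolding word_equiv_def
    by (intro conjI exI[of _ c]) (auto simp: weight_add add.assoc)
qed

lemma word_equiv_append:
  assumes "word_equiv u u'" "word_equiv v v'"
  shows "word_equiv (u @ v) (u' @ v')"
proof -
  have W: "u' \<in> words" "v \<in> words" using assms by (simp_all add: word_equiv_def)
  have "word_equiv (u @ v) (u' @ v)"
    using word_equiv_context[OF assms(1), of "[]" v] W by simp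
  moreover have "word_equiv (u' @ v) (u' @ v')"
    using word_equiv_context[OF assms(2), of u' "[]"] W by simp
  ultimately show ?thesis by (rule word_equiv_trans)
qed

section \<open>Permuting letters modulo words of lower weight\<close>

lemma word_equiv_swap:
  assumes "i < n" "j < n"
  shows "word_equiv [i, j] [j, i]"
proof -
  have less: "word_equiv [j, i] [i, j]" if ij: "i < j" "j < n" for i j
  proof -
    obtain c l where "c \<noteq> 0" "l \<in> lower_terms scale n s \<phi> b (\<phi> (s i + s j))"
      "b j * b i = scale c (b i * b j) + l"
      using type ij unfolding S_phi_type_def by blast
    moreover from this have "l \<in> word_below (\<phi> (s i + s j))"
      using lower_terms_subset_word_below by blast
    ultimately show ?thesis
      using ij unfolding word_equiv_def
      by (auto simp: word_val_def word_deg_def add.commute intro!: exI[of _ c])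
  qed
  consider "i < j" | "j < i" | "i = j" by linarith
  then show ?thesis
    using less assms word_equiv_sym word_equiv_refl by cases auto
qed

lemma word_equiv_rotate1:
  assumes "x < n" "ys \<in> words"
  shows "word_equiv (x # ys) (ys @ [x])"
  using assms(2)
proof (induction ys)
  case Nil
  show ?case using assms(1) by (simp add: word_equiv_refl)
next
  case (Cons y ys)
  then have y: "y < n" "ys \<in> words" by auto
  have "word_equiv (x # y # ys) (y # x # ys)"
    using word_equiv_append[OF word_equiv_swap[OF assms(1) y(1)] word_equiv_refl[OF y(2)]] by simp
  moreover have "word_equiv (y # x # ys) (y # ys @ [x])"
    using word_equiv_append[of "[y]" "[y]" "x # ys" "ys @ [x]"] Cons y by (simp add: word_equiv_refl)
  ultimately show ?case using word_equiv_trans by simp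
qed

text \<open>Adjacent swaps reach every rearrangement: by induction the tail of \<open>w\<close> is
  rearranged into \<open>w'\<close> with one occurrence of the first letter removed, and
  \<open>word_equiv_rotate1\<close> moves that letter into its place.\<close>

lemma word_equiv_of_mset_eq:
  "w \<in> words \<Longrightarrow> mset w = mset w' \<Longrightarrow> word_equiv w w'"
proof (induction w arbitrary: w')
  case Nil
  then show ?case by (simp add: word_equiv_refl)
next
  case (Cons x xs)
  then have "x \<in> set w'" using mset_eq_setD[OF Cons.prems(2)] by auto
  then obtain ys zs where w': "w' = ys @ x # zs" by (meson split_list)
  have "set w' = set (x # xs)" using mset_eq_setD[OF Cons.prems(2)] by simp
  then have W: "x < n" "xs \<in> words" "ys \<in> words" "zs \<in> words"
    using Cons.prems(1) by (auto simp: w')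
  have "word_equiv xs (ys @ zs)"
    using Cons W w' by auto
  then have "word_equiv ([x] @ xs) ([x] @ (ys @ zs))"
    using W by (intro word_equiv_append word_equiv_refl) auto
  moreover have "word_equiv ((x # ys) @ zs) ((ys @ [x]) @ zs)"
    using W by (intro word_equiv_append word_equiv_refl word_equiv_rotate1) auto
  ultimately show ?case using word_equiv_trans by (simp add: w')
qed

lemma word_equiv_block:
  assumes "w \<in> words"
  shows "\<exists>\<xi>\<in>Npow n. word_equiv w (block_word \<xi>)"
proof
  let ?\<xi> = "\<lambda>i. count (mset w) i"
  have 0: "count (mset w) i = 0" if "\<not> i < n" for i
    using assms that by (auto simp: count_eq_zero_iff)
  then show "?\<xi> \<in> Npow n" by (auto simp: Npow_def)
  have "mset w = mset (block_word ?\<xi>)"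
    by (rule multiset_eqI) (use 0 in \<open>simp add: count_block_word\<close>)
  then show "word_equiv w (block_word ?\<xi>)"
    by (rule word_equiv_of_mset_eq[OF assms])
qed

text \<open>A generated congruence is the least one containing its generators, so it suffices to
  check that \<open>R\<close> is a congruence containing \<open>P\<close>; no chain of elementary
  moves has to be followed.\<close>

lemma word_equiv_block_of_pres_map_eq:
  assumes "p \<in> Npow n" "p' \<in> Npow n" "pres_map n s p = pres_map n s p'"
  shows "word_equiv (block_word p) (block_word p')"
proof -
  define R where "R = {(p, p'). p \<in> Npow n \<and> p' \<in> Npow n \<and> word_equiv (block_word p) (block_word p')}"
  \<comment> \<open>Addition of exponents is concatenation of words only up to a rearrangement, so
    closure of \<open>R\<close> under sums already depends on the commutation relations
    (ii).\<close>
  have add: "word_equiv (block_word (p + q)) (block_word p @ block_word q)" for p q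
    by (rule word_equiv_of_mset_eq)
      (simp, rule multiset_eqI, simp add: count_block_word)
  have "monoid_congruence n R"
    unfolding monoid_congruence_def
  proof (intro conjI equivI)
    show "R \<subseteq> Npow n \<times> Npow n" by (auto simp: R_def)
    show "refl_on (Npow n) R"
      unfolding refl_on_def R_def by (auto intro: word_equiv_refl block_word_in_words)
    show "sym R" by (auto simp: R_def sym_def intro: word_equiv_sym)
    show "trans R" by (auto simp: R_def trans_def intro: word_equiv_trans)
    show "\<forall>p p' q q'. (p, p') \<in> R \<longrightarrow> (q, q') \<in> R \<longrightarrow> (p + q, p' + q') \<in> R"
    proof (intro allI impI)
      fix p p' q q' assume "(p, p') \<in> R" "(q, q') \<in> R"
      then have N: "p \<in> Npow n" "p' \<in> Npow n" "q \<in> Npow n" "q' \<in> Npow n"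
        and w: "word_equiv (block_word p) (block_word p')" "word_equiv (block_word q) (block_word q')"
        by (simp_all add: R_def)
      have "word_equiv (block_word (p + q)) (block_word (p' + q'))"
        using word_equiv_trans[OF add word_equiv_trans[OF word_equiv_append[OF w] word_equiv_sym[OF add]]] .
      then show "(p + q, p' + q') \<in> R"
        using N by (simp add: R_def Npow_add)
    qed
  qed
  moreover have "P \<subseteq> R"
  proof clarify
    fix p p' assume pp: "(p, p') \<in> P"
    then have N: "p \<in> Npow n" "p' \<in> Npow n" using pres by (auto simp: presentation_def)
    from pp have "(p, p') \<in> congruence_generated n P" by (auto simp: congruence_generated_def)
    then have eq: "pres_map n s p = pres_map n s p'" using pres by (simp add: presentation_def)
    obtain d l where d: "d \<noteq> 0" "l \<in> lower_terms scale n s \<phi> b (\<phi> (pres_map n s p))"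
      "monomial_at n b p' = scale d (monomial_at n b p) + l"
      using type pp unfolding S_phi_type_def by blast
    \<comment> \<open>Relation (iii) solves for the monomial of \<open>p'\<close>, hence the
      reversed order here.\<close>
    have "word_equiv (block_word p') (block_word p)"
      unfolding word_equiv_def
      using d lower_terms_subset_word_below eq
      by (intro conjI exI[of _ d]) (auto simp del: in_lists_conv_set)
    with N show "(p, p') \<in> R" by (simp add: R_def word_equiv_sym)
  qed
  ultimately have "congruence_generated n P \<subseteq> R"
    unfolding congruence_generated_def by blast
  moreover have "(p, p') \<in> congruence_generated n P"
    using pres assms by (simp add: presentation_def)
  ultimately show ?thesis by (auto simp: R_def)
qed

text \<open>Straightening makes every word, modulo lower words, a nonzero multiple of the one
  element \<open>e x\<close> of its degree \<open>x\<close>. For concatenated words this yields the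
  structure constants; iterated along the weight it shows that the \<open>e x\<close> span.\<close>

theorem imp_adapted_basis:
  assumes \<tau>: "pres_section n s \<tau>"
    and ind: "independent_family scale (\<lambda>x. monomial_at n b (\<tau> x))"
  shows "\<exists>\<alpha>. adapted_basis scale r \<A> \<phi> (\<lambda>x. monomial_at n b (\<tau> x)) \<alpha>"
proof -
  define e where "e x = monomial_at n b (\<tau> x)" for x
  define E where "E N = span (e ` {u. \<phi> u < N})" for N
  have e_word: "e x = word_val (block_word (\<tau> x))" for x by (simp add: e_def)
  have equiv: "word_equiv w (block_word (\<tau> (word_deg w)))" if w: "w \<in> words" for w
  proof -
    obtain \<xi> where \<xi>: "\<xi> \<in> Npow n" "word_equiv w (block_word \<xi>)" using word_equiv_block[OF w] by blast
    then have "pres_map n s \<xi> = word_deg w" by (simp add: word_equiv_def)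
    then have "word_equiv (block_word \<xi>) (block_word (\<tau> (word_deg w)))"
      using \<xi> \<tau> by (intro word_equiv_block_of_pres_map_eq) (auto simp: pres_section_def)
    with \<xi>(2) show ?thesis by (rule word_equiv_trans)
  qed
  have red: "\<exists>c. c \<noteq> 0 \<and> word_val w - scale c (e (word_deg w)) \<in> word_below (\<phi> (word_deg w))"
    if "w \<in> words" for w
    using equiv[OF that] by (simp add: word_equiv_def e_def)
  \<comment> \<open>The error term of a reduction consists of words of smaller weight, which can be
    reduced again; the weight bound is never exceeded on the way from words to the
    \<open>e x\<close>.\<close>
  have below: "word_below N \<subseteq> E N" for N
    unfolding word_below_def
  proof (rule span_subset_of_reduction)
    show "subspace (E N)" for N by (simp add: E_def)
    show "mono E" 
    proof (rule monoI)
      fix N M :: nat assume "N \<le> M"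
      then show "E N \<subseteq> E M" unfolding E_def by (intro span_mono image_mono) auto
    qed
    fix w assume w: "w \<in> words"
    then obtain c where c: "word_val w - scale c (e (word_deg w)) \<in> word_below (\<phi> (word_deg w))"
      using red by blast
    have "scale c (e (word_deg w)) \<in> E (Suc (\<phi> (word_deg w)))"
      unfolding E_def by (intro span_scale span_base imageI) simp
    with c show "\<exists>y\<in>E (Suc (\<phi> (word_deg w))). word_val w - y \<in>
        span (word_val ` {j \<in> words. \<phi> (word_deg j) < \<phi> (word_deg w)})"
      by (auto simp: word_below_def)
  qed
  have spans: "span (range e) = UNIV"
  proof -
    let ?W = "span (word_val ` words)"
    have "x \<in> ?W" if "x \<in> subalgebra_generated scale (b ` {..<n})" for x
      using that
    proof induction
      case (base x)
      then obtain i where "i < n" "x = word_val [i]" by (auto simp: word_val_def)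
      then show ?case by (auto intro!: span_base imageI)
    next
      case one
      have "1 = word_val []" by (simp add: word_val_def)
      also have "\<dots> \<in> ?W" by (intro span_base imageI) simp
      finally show ?case .
    next
      case (mult x y)
      show ?case
      proof (rule mult_mem_of_spans[OF _ _ mult.IH])
        fix x y assume "x \<in> word_val ` words" "y \<in> word_val ` words"
        then obtain u v where "x = word_val u" "y = word_val v" "u \<in> words" "v \<in> words" by blast
        then have "x * y = word_val (u @ v)" "u @ v \<in> words" by auto
        then show "x * y \<in> ?W" by (simp only: span_base imageI)
      qed simp
    qed (auto intro: span_add span_scale)
    then have "?W = UNIV" using type by (auto simp: S_phi_type_def)
    moreover have "word_val w \<in> span (range e)" if "w \<in> words" for w
    proof -
      have "word_val w \<in> word_below (Suc (\<phi> (word_deg w)))"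
        unfolding word_below_def by (intro span_base imageI) (use that in simp)
      also have "\<dots> \<subseteq> E (Suc (\<phi> (word_deg w)))" by (rule below)
      also have "\<dots> \<subseteq> span (range e)" unfolding E_def by (rule span_mono) auto
      finally show ?thesis .
    qed
    then have "?W \<subseteq> span (range e)" by (intro span_minimal) auto
    ultimately show ?thesis by blast
  qed
  have deg\<tau>: "word_deg (block_word (\<tau> x)) = x" for x
    using \<tau> by (simp add: pres_section_def)
  have "\<exists>c. c \<noteq> 0 \<and> e x * e y - scale c (e (x + y)) \<in> E (\<phi> (x + y))" for x y
  proof -
    have W: "block_word (\<tau> x) @ block_word (\<tau> y) \<in> words"
      unfolding append_in_lists_conv by (rule conjI[OF block_word_in_words block_word_in_words])
    have "\<exists>c. c \<noteq> 0 \<and> e x * e y - scale c (e (x + y)) \<in> word_below (\<phi> (x + y))"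
      using red[OF W] unfolding word_append deg\<tau> e_word[symmetric] .
    then show ?thesis using subsetD[OF below] by (elim exE conjE) (intro exI conjI)
  qed
  then obtain \<alpha> where \<alpha>: "\<And>x y. \<alpha> x y \<noteq> 0" "\<And>x y. e x * e y - scale (\<alpha> x y) (e (x + y)) \<in> E (\<phi> (x + y))"
    by metis
  have "\<exists>c. 1 = scale c (e 0)"
  proof -
    \<comment> \<open>The empty word has weight 0 and no word has smaller weight, so its reduction
      to a multiple of \<open>e 0\<close> is an exact equality.\<close>
    have "\<phi> 0 = 0" using type by (simp add: S_phi_type_def additive_morphism_def)
    then show ?thesis
      using red[of "[]"] by (auto simp: word_val_def word_deg_def word_below_def)
  qed
  moreover have "homogeneous (e x)" for x
    unfolding e_def using type by (intro homogeneous_monomial) (auto simp: S_phi_type_def)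
  moreover have "independent_family scale e" using ind by (simp add: e_def[abs_def])
  ultimately have "adapted_basis scale r \<A> \<phi> e \<alpha>"
    using \<alpha> spans type unfolding E_def S_phi_type_def by unfold_locales auto
  then show ?thesis by (auto simp: e_def[abs_def])
qed

end

section \<open>The associated graded algebra\<close>

text \<open>The operations of \<open>assoc_graded\<close> are unions over all representatives; a
  union collapses to one coset once the result is independent of the choice.\<close>

lemma Union_eq_of_all_eq: "K \<noteq> {} \<Longrightarrow> (\<And>C. C \<in> K \<Longrightarrow> C = D) \<Longrightarrow> \<Union>K = D"
  by auto

text \<open>The series with the single term \<open>a\<close> in degree \<open>d\<close>; its class
  is the symbol of \<open>a\<close> in filtration degree \<open>d\<close>.\<close>

definition mono_fps :: "nat \<Rightarrow> 'a::zero \<Rightarrow> 'a fps" where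
  "mono_fps d a = Abs_fps (\<lambda>k. if k = d then a else 0)"

lemma mono_fps_nth [simp]: "fps_nth (mono_fps d a) k = (if k = d then a else 0)"
  by (simp add: mono_fps_def)

lemma mono_fps_zero [simp]: "mono_fps d 0 = 0"
  by (rule fps_ext) simp

lemma mono_fps_mult: "mono_fps d a * mono_fps e b = mono_fps (d + e) (a * b)"
  for a b :: "'a::ring_1"
proof (rule fps_ext)
  fix k
  have "fps_nth (mono_fps d a * mono_fps e b) k =
      (\<Sum>i=0..k. if i = d then (if k - d = e then a * b else 0) else 0)"
    unfolding fps_mult_nth by (rule sum.cong) auto
  also have "\<dots> = fps_nth (mono_fps (d + e) (a * b)) k"
    by auto
  finally show "fps_nth (mono_fps d a * mono_fps e b) k = fps_nth (mono_fps (d + e) (a * b)) k" .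
qed

locale filtered_algebra = unital_algebra scale
  for scale :: "'k::field \<Rightarrow> 'a::ring_1 \<Rightarrow> 'a" +
  fixes F :: "nat \<Rightarrow> 'a set"
  assumes filt_zero: "F 0 = range (\<lambda>c. scale c 1)"
    and filt_mono: "mono F"
    and subspace_filt: "subspace (F d)"
    and filt_mult: "x \<in> F d \<Longrightarrow> y \<in> F e \<Longrightarrow> x * y \<in> F (d + e)"
begin

lemma one_in_filt_zero: "1 \<in> F 0"
  unfolding filt_zero using scale_one[of 1] by (rule range_eqI[OF sym])

lemma subspace_filt_prev [simp]: "subspace (filt_prev F d)"
  by (cases d) (simp_all add: filt_prev_def subspace_filt subspace_single_0)

lemma filt_prev_subset: "filt_prev F d \<subseteq> F d"
  using filt_mono subspace_0[OF subspace_filt, of 0]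
  by (cases d) (simp_all add: filt_prev_def mono_def)

lemma filt_prev_mult_left: "x \<in> filt_prev F d \<Longrightarrow> y \<in> F e \<Longrightarrow> x * y \<in> filt_prev F (d + e)"
  using filt_mult subspace_0[OF subspace_filt_prev, of e]
  by (cases d) (simp_all add: filt_prev_def)

lemma filt_prev_mult_right: "x \<in> F d \<Longrightarrow> y \<in> filt_prev F e \<Longrightarrow> x * y \<in> filt_prev F (d + e)"
  using filt_mult subspace_0[OF subspace_filt_prev, of d]
  by (cases e) (simp_all add: filt_prev_def)

lemma mem_filt_class_iff: "u \<in> filt_class F d a \<longleftrightarrow> u - a \<in> filt_prev F d"
proof
  assume "u - a \<in> filt_prev F d"
  then have "a + (u - a) \<in> filt_class F d a" unfolding filt_class_def by (rule imageI)
  then show "u \<in> filt_class F d a" by simp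
qed (auto simp: filt_class_def)

lemma filt_class_eq_iff: "filt_class F d a = filt_class F d b \<longleftrightarrow> a - b \<in> filt_prev F d"
proof
  assume eq: "filt_class F d a = filt_class F d b"
  have "a \<in> filt_class F d a" by (simp add: mem_filt_class_iff subspace_0)
  then show "a - b \<in> filt_prev F d" unfolding eq by (simp add: mem_filt_class_iff)
next
  assume ab: "a - b \<in> filt_prev F d"
  have "u - a \<in> filt_prev F d \<longleftrightarrow> u - b \<in> filt_prev F d" for u
    using subspace_add[OF subspace_filt_prev _ ab, of "u - a"]
      subspace_diff[OF subspace_filt_prev _ ab, of "u - b"] by auto
  then show "filt_class F d a = filt_class F d b"
    by (intro Set.set_eqI) (simp add: mem_filt_class_iff)
qed

lemma filt_class_zero [simp]: "filt_class F d 0 = filt_prev F d"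
  by (simp add: filt_class_def)

text \<open>Elements of the associated graded algebra are represented by finitely supported power
  series with \<open>d\<close>-th coefficient in \<open>F\<^sub>d\<close>, so that its ring laws become those of power series.\<close>

definition rees :: "'a fps set" where
  "rees = {u. (\<forall>d. fps_nth u d \<in> F d) \<and> finite {d. fps_nth u d \<noteq> 0}}"

text \<open>The quotient map from the Rees algebra \<open>rees\<close> onto the associated graded
  algebra. Its kernel consists of the series whose \<open>d\<close>-th coefficient lies in the
  preceding step, that is, of the multiples of the series variable.\<close>

definition graded_class :: "'a fps \<Rightarrow> nat \<Rightarrow> 'a set" where
  "graded_class u = (\<lambda>d. filt_class F d (fps_nth u d))"

definition scale_fps :: "'k \<Rightarrow> 'a fps \<Rightarrow> 'a fps" where
  "scale_fps c u = Abs_fps (\<lambda>d. scale c (fps_nth u d))"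

lemma scale_fps_nth [simp]: "fps_nth (scale_fps c u) d = scale c (fps_nth u d)"
  by (simp add: scale_fps_def)

abbreviation gr :: "('k, nat \<Rightarrow> 'a set) module" where
  "gr \<equiv> assoc_graded scale F"

lemma graded_class_eq_iff:
  "graded_class u = graded_class v \<longleftrightarrow> (\<forall>d. fps_nth u d - fps_nth v d \<in> filt_prev F d)"
  by (simp add: graded_class_def fun_eq_iff filt_class_eq_iff)

lemma reesD: "u \<in> rees \<Longrightarrow> fps_nth u d \<in> F d" "u \<in> rees \<Longrightarrow> finite {d. fps_nth u d \<noteq> 0}"
  by (simp_all add: rees_def)

lemma rees_zero: "0 \<in> rees"
  by (simp add: rees_def subspace_0 subspace_filt)

lemma rees_mono: "a \<in> F d \<Longrightarrow> mono_fps d a \<in> rees"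
  by (auto simp: rees_def subspace_0 subspace_filt)

lemma rees_one: "1 \<in> rees"
proof -
  have "1 = mono_fps 0 (1::'a)" by (rule fps_ext) (simp add: fps_one_nth)
  then show ?thesis using rees_mono[OF one_in_filt_zero] by simp
qed

lemma rees_add:
  assumes "u \<in> rees" "v \<in> rees"
  shows "u + v \<in> rees"
proof -
  have "{d. fps_nth (u + v) d \<noteq> 0} \<subseteq> {d. fps_nth u d \<noteq> 0} \<union> {d. fps_nth v d \<noteq> 0}" by auto
  then have "finite {d. fps_nth (u + v) d \<noteq> 0}"
    by (rule finite_subset) (simp add: reesD(2) assms)
  then show ?thesis
    using assms by (simp add: rees_def subspace_add[OF subspace_filt])
qed

lemma rees_uminus: "u \<in> rees \<Longrightarrow> - u \<in> rees"
  unfolding rees_def by (auto simp: subspace_filt intro!: subspace_neg)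

lemma rees_scale:
  assumes "u \<in> rees"
  shows "scale_fps c u \<in> rees"
proof -
  have "{d. scale c (fps_nth u d) \<noteq> 0} \<subseteq> {d. fps_nth u d \<noteq> 0}" by auto
  then show ?thesis
    using assms by (auto simp: rees_def subspace_filt intro!: subspace_scale intro: finite_subset)
qed

lemma rees_mult:
  assumes u: "u \<in> rees" and v: "v \<in> rees"
  shows "u * v \<in> rees"
proof -
  have "fps_nth (u * v) d \<in> F d" for d
    unfolding fps_mult_nth
  proof (rule subspace_sum[OF subspace_filt])
    fix i assume "i \<in> {0..d}"
    then show "fps_nth u i * fps_nth v (d - i) \<in> F d"
      using filt_mult[OF reesD(1)[OF u] reesD(1)[OF v], of i "d - i"] by simp
  qed
  moreover have "finite {d. fps_nth (u * v) d \<noteq> 0}"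
  proof (rule finite_subset)
    let ?S = "{d. fps_nth u d \<noteq> 0} \<times> {d. fps_nth v d \<noteq> 0}"
    show "finite ((\<lambda>(i, j). i + j) ` ?S)"
      using reesD(2)[OF u] reesD(2)[OF v] by blast
    show "{d. fps_nth (u * v) d \<noteq> 0} \<subseteq> (\<lambda>(i, j). i + j) ` ?S"
    proof
      fix d assume "d \<in> {d. fps_nth (u * v) d \<noteq> 0}"
      then have "(\<Sum>i=0..d. fps_nth u i * fps_nth v (d - i)) \<noteq> 0" by (simp add: fps_mult_nth)
      then obtain i where "i \<in> {0..d}" "fps_nth u i * fps_nth v (d - i) \<noteq> 0"
        by (rule sum.not_neutral_contains_not_neutral)
      then have "(i, d - i) \<in> ?S" "d = i + (d - i)" by auto
      then show "d \<in> (\<lambda>(i, j). i + j) ` ?S" by (intro image_eqI[of _ _ "(i, d - i)"]) simp_all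
    qed
  qed
  ultimately show ?thesis by (simp add: rees_def)
qed

lemma carrier_gr: "carrier gr = graded_class ` rees"
proof
  show "graded_class ` rees \<subseteq> carrier gr"
  proof clarify
    fix u assume u: "u \<in> rees"
    have "{d. graded_class u d \<noteq> filt_prev F d} \<subseteq> {d. fps_nth u d \<noteq> 0}"
      by (auto simp: graded_class_def)
    then have "finite {d. graded_class u d \<noteq> filt_prev F d}"
      by (rule finite_subset) (rule reesD(2)[OF u])
    then show "graded_class u \<in> carrier gr"
      using reesD(1)[OF u] by (simp add: assoc_graded_def graded_class_def)
  qed
  show "carrier gr \<subseteq> graded_class ` rees"
  proof
    fix x assume "x \<in> carrier gr"
    then have x: "\<And>d. x d \<in> filt_class F d ` F d" and fin: "finite {d. x d \<noteq> filt_prev F d}"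
      by (simp_all add: assoc_graded_def)
    \<comment> \<open>Wherever the coset is trivial the representative must be 0, since otherwise
      the chosen series could have infinite support.\<close>
    have "\<exists>a. a \<in> F d \<and> x d = filt_class F d a \<and> (x d = filt_prev F d \<longrightarrow> a = 0)" for d
    proof (cases "x d = filt_prev F d")
      case True
      then show ?thesis by (intro exI[of _ 0]) (simp add: subspace_0 subspace_filt)
    next
      case False
      then show ?thesis using x[of d] by blast
    qed
    then obtain a where a: "\<And>d. a d \<in> F d" "\<And>d. x d = filt_class F d (a d)"
      "\<And>d. x d = filt_prev F d \<Longrightarrow> a d = 0"
      by metis
    have "{d. a d \<noteq> 0} \<subseteq> {d. x d \<noteq> filt_prev F d}" using a(3) by blast
    then have "finite {d. a d \<noteq> 0}" using fin by (rule finite_subset)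
    then have "Abs_fps a \<in> rees" using a(1) by (simp add: rees_def)
    moreover have "x = graded_class (Abs_fps a)" using a(2) by (simp add: graded_class_def fun_eq_iff)
    ultimately show "x \<in> graded_class ` rees" by (rule rev_image_eqI)
  qed
qed

lemma gr_zero: "\<zero>\<^bsub>gr\<^esub> = graded_class 0"
  by (simp add: assoc_graded_def graded_class_def)

lemma gr_one: "\<one>\<^bsub>gr\<^esub> = graded_class 1"
  by (simp add: assoc_graded_def graded_class_def fps_one_nth)

lemma gr_add: "graded_class u \<oplus>\<^bsub>gr\<^esub> graded_class v = graded_class (u + v)"
proof
  fix d
  let ?K = "{filt_class F d (a + b) | a b. a \<in> graded_class u d \<and> b \<in> graded_class v d}"
  have "\<Union>?K = filt_class F d (fps_nth (u + v) d)"
  proof (rule Union_eq_of_all_eq)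
    have "fps_nth u d \<in> graded_class u d" "fps_nth v d \<in> graded_class v d"
      by (simp_all add: graded_class_def mem_filt_class_iff subspace_0)
    then show "?K \<noteq> {}" by blast
    fix C assume "C \<in> ?K"
    then obtain a b where C: "C = filt_class F d (a + b)"
      and ab: "a - fps_nth u d \<in> filt_prev F d" "b - fps_nth v d \<in> filt_prev F d"
      by (auto simp: graded_class_def mem_filt_class_iff)
    have "(a - fps_nth u d) + (b - fps_nth v d) \<in> filt_prev F d"
      by (rule subspace_add[OF subspace_filt_prev ab])
    then show "C = filt_class F d (fps_nth (u + v) d)"
      by (simp add: C filt_class_eq_iff algebra_simps)
  qed
  then show "(graded_class u \<oplus>\<^bsub>gr\<^esub> graded_class v) d = graded_class (u + v) d"
    by (simp add: assoc_graded_def graded_class_def)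
qed

lemma gr_smult: "c \<odot>\<^bsub>gr\<^esub> graded_class u = graded_class (scale_fps c u)"
proof
  fix d
  let ?K = "{filt_class F d (scale c a) | a. a \<in> graded_class u d}"
  have "\<Union>?K = filt_class F d (fps_nth (scale_fps c u) d)"
  proof (rule Union_eq_of_all_eq)
    have "fps_nth u d \<in> graded_class u d"
      by (simp add: graded_class_def mem_filt_class_iff subspace_0)
    then show "?K \<noteq> {}" by blast
    fix C assume "C \<in> ?K"
    then obtain a where C: "C = filt_class F d (scale c a)"
      and a: "a - fps_nth u d \<in> filt_prev F d"
      by (auto simp: graded_class_def mem_filt_class_iff)
    have "scale c (a - fps_nth u d) \<in> filt_prev F d"
      by (rule subspace_scale[OF subspace_filt_prev a])
    then show "C = filt_class F d (fps_nth (scale_fps c u) d)"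
      by (simp add: C filt_class_eq_iff scale_right_diff_distrib)
  qed
  then show "(c \<odot>\<^bsub>gr\<^esub> graded_class u) d = graded_class (scale_fps c u) d"
    by (simp add: assoc_graded_def graded_class_def)
qed

lemma gr_mult:
  assumes u: "u \<in> rees" and v: "v \<in> rees"
  shows "graded_class u \<otimes>\<^bsub>gr\<^esub> graded_class v = graded_class (u * v)"
proof
  fix d
  let ?K = "{filt_class F d (\<Sum>i\<le>d. a i * b (d - i)) | a b.
      (\<forall>i. a i \<in> graded_class u i) \<and> (\<forall>i. b i \<in> graded_class v i)}"
  have "\<Union>?K = filt_class F d (fps_nth (u * v) d)"
  proof (rule Union_eq_of_all_eq)
    have "\<forall>i. fps_nth u i \<in> graded_class u i" "\<forall>i. fps_nth v i \<in> graded_class v i"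
      by (simp_all add: graded_class_def mem_filt_class_iff subspace_0)
    then show "?K \<noteq> {}" by blast
    fix C assume "C \<in> ?K"
    then obtain a b where C: "C = filt_class F d (\<Sum>i\<le>d. a i * b (d - i))"
      and a: "\<And>i. a i - fps_nth u i \<in> filt_prev F i" and b: "\<And>i. b i - fps_nth v i \<in> filt_prev F i"
      by (auto simp: graded_class_def mem_filt_class_iff)
    have bF: "b i \<in> F i" for i
      using subspace_add[OF subspace_filt subsetD[OF filt_prev_subset b[of i]] reesD(1)[OF v]] by simp
    \<comment> \<open>The difference of products is split as
      \<open>(a - u) * b + u * (b - v)\<close>: in each summand one factor drops a step while the
      other stays in its own step. For \<open>b\<close> the latter holds because it differs from
      \<open>v\<close> by a lower element.\<close>
    have "a i * b (d - i) - fps_nth u i * fps_nth v (d - i) \<in> filt_prev F d" if "i \<le> d" for i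
    proof -
      have "(a i - fps_nth u i) * b (d - i) \<in> filt_prev F (i + (d - i))"
        by (rule filt_prev_mult_left[OF a bF])
      moreover have "fps_nth u i * (b (d - i) - fps_nth v (d - i)) \<in> filt_prev F (i + (d - i))"
        by (rule filt_prev_mult_right[OF reesD(1)[OF u] b])
      ultimately have "(a i - fps_nth u i) * b (d - i) + fps_nth u i * (b (d - i) - fps_nth v (d - i))
          \<in> filt_prev F (i + (d - i))"
        by (rule subspace_add[OF subspace_filt_prev])
      then show ?thesis using that by (simp add: algebra_simps)
    qed
    then have "(\<Sum>i\<le>d. a i * b (d - i) - fps_nth u i * fps_nth v (d - i)) \<in> filt_prev F d"
      by (intro subspace_sum[OF subspace_filt_prev]) simp
    then show "C = filt_class F d (fps_nth (u * v) d)"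
      by (simp add: C filt_class_eq_iff sum_subtractf fps_mult_nth atLeast0AtMost)
  qed
  then show "(graded_class u \<otimes>\<^bsub>gr\<^esub> graded_class v) d = graded_class (u * v) d"
    by (simp add: assoc_graded_def graded_class_def)
qed

lemma ring_gr: "ring gr"
proof (rule ringI)
  show "abelian_group gr"
  proof (rule abelian_groupI)
    fix x y z assume "x \<in> carrier gr" "y \<in> carrier gr" "z \<in> carrier gr"
    then obtain u v w where *: "x = graded_class u" "y = graded_class v" "z = graded_class w"
      "u \<in> rees" "v \<in> rees" "w \<in> rees" unfolding carrier_gr by blast
    show "x \<oplus>\<^bsub>gr\<^esub> y \<in> carrier gr"
      using * by (simp add: gr_add carrier_gr rees_add)
    show "x \<oplus>\<^bsub>gr\<^esub> y \<oplus>\<^bsub>gr\<^esub> z = x \<oplus>\<^bsub>gr\<^esub> (y \<oplus>\<^bsub>gr\<^esub> z)"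
      using * by (simp add: gr_add add.assoc)
    show "x \<oplus>\<^bsub>gr\<^esub> y = y \<oplus>\<^bsub>gr\<^esub> x"
      using * by (simp add: gr_add add.commute)
  next
    show "\<zero>\<^bsub>gr\<^esub> \<in> carrier gr" by (simp add: gr_zero carrier_gr rees_zero)
  next
    fix x assume "x \<in> carrier gr"
    then obtain u where u: "x = graded_class u" "u \<in> rees" unfolding carrier_gr by blast
    show "\<zero>\<^bsub>gr\<^esub> \<oplus>\<^bsub>gr\<^esub> x = x" using u by (simp add: gr_zero gr_add)
    show "\<exists>y\<in>carrier gr. y \<oplus>\<^bsub>gr\<^esub> x = \<zero>\<^bsub>gr\<^esub>"
      by (rule bexI[of _ "graded_class (- u)"])
        (use u in \<open>simp_all add: gr_zero gr_add carrier_gr rees_uminus\<close>)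
  qed
  show "Group.monoid gr"
  proof (rule monoidI)
    fix x y z assume "x \<in> carrier gr" "y \<in> carrier gr" "z \<in> carrier gr"
    then obtain u v w where *: "x = graded_class u" "y = graded_class v" "z = graded_class w"
      "u \<in> rees" "v \<in> rees" "w \<in> rees" unfolding carrier_gr by blast
    show "x \<otimes>\<^bsub>gr\<^esub> y \<in> carrier gr"
      using * by (simp add: gr_mult carrier_gr rees_mult)
    show "x \<otimes>\<^bsub>gr\<^esub> y \<otimes>\<^bsub>gr\<^esub> z = x \<otimes>\<^bsub>gr\<^esub> (y \<otimes>\<^bsub>gr\<^esub> z)"
      using * by (simp add: gr_mult rees_mult mult.assoc)
  next
    show "\<one>\<^bsub>gr\<^esub> \<in> carrier gr" by (simp add: gr_one carrier_gr rees_one)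
  next
    fix x assume "x \<in> carrier gr"
    then obtain u where u: "x = graded_class u" "u \<in> rees" unfolding carrier_gr by blast
    show "\<one>\<^bsub>gr\<^esub> \<otimes>\<^bsub>gr\<^esub> x = x" "x \<otimes>\<^bsub>gr\<^esub> \<one>\<^bsub>gr\<^esub> = x"
      using u by (simp_all add: gr_one gr_mult rees_one)
  qed
  fix x y z assume "x \<in> carrier gr" "y \<in> carrier gr" "z \<in> carrier gr"
  then obtain u v w where *: "x = graded_class u" "y = graded_class v" "z = graded_class w"
    "u \<in> rees" "v \<in> rees" "w \<in> rees" unfolding carrier_gr by blast
  show "(x \<oplus>\<^bsub>gr\<^esub> y) \<otimes>\<^bsub>gr\<^esub> z = x \<otimes>\<^bsub>gr\<^esub> z \<oplus>\<^bsub>gr\<^esub> y \<otimes>\<^bsub>gr\<^esub> z"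
    using * by (simp add: gr_mult gr_add rees_add distrib_right)
  show "z \<otimes>\<^bsub>gr\<^esub> (x \<oplus>\<^bsub>gr\<^esub> y) = z \<otimes>\<^bsub>gr\<^esub> x \<oplus>\<^bsub>gr\<^esub> z \<otimes>\<^bsub>gr\<^esub> y"
    using * by (simp add: gr_mult gr_add rees_add distrib_left)
qed

lemma k_algebra_gr: "k_algebra gr"
  unfolding k_algebra_def
proof (intro conjI)
  interpret gr: ring gr by (rule ring_gr)
  show "ring gr" by (rule ring_gr)
  show "Module.module (ring_of_type_algebra :: 'k ring) gr"
  proof (rule Module.moduleI)
    show "cring (ring_of_type_algebra :: 'k ring)" by (rule cring_from_type_algebra)
    show "abelian_group gr" by (rule gr.is_abelian_group)
    fix a b :: 'k and x y assume "x \<in> carrier gr" "y \<in> carrier gr"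
    then obtain u v where *: "x = graded_class u" "y = graded_class v" "u \<in> rees" "v \<in> rees"
      unfolding carrier_gr by blast
    show "a \<odot>\<^bsub>gr\<^esub> x \<in> carrier gr"
      using * by (simp add: gr_smult carrier_gr rees_scale)
    have "scale_fps (a + b) u = scale_fps a u + scale_fps b u"
      by (rule fps_ext) (simp add: scale_left_distrib)
    then show "(a \<oplus>\<^bsub>ring_of_type_algebra\<^esub> b) \<odot>\<^bsub>gr\<^esub> x = a \<odot>\<^bsub>gr\<^esub> x \<oplus>\<^bsub>gr\<^esub> b \<odot>\<^bsub>gr\<^esub> x"
      using * by (simp add: gr_smult gr_add ring_of_type_algebra_def)
    have "scale_fps a (u + v) = scale_fps a u + scale_fps a v"
      by (rule fps_ext) (simp add: scale_right_distrib)
    then show "a \<odot>\<^bsub>gr\<^esub> (x \<oplus>\<^bsub>gr\<^esub> y) = a \<odot>\<^bsub>gr\<^esub> x \<oplus>\<^bsub>gr\<^esub> a \<odot>\<^bsub>gr\<^esub> y"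
      using * by (simp add: gr_smult gr_add)
    have "scale_fps (a * b) u = scale_fps a (scale_fps b u)"
      by (rule fps_ext) simp
    then show "(a \<otimes>\<^bsub>ring_of_type_algebra\<^esub> b) \<odot>\<^bsub>gr\<^esub> x = a \<odot>\<^bsub>gr\<^esub> (b \<odot>\<^bsub>gr\<^esub> x)"
      using * by (simp add: gr_smult ring_of_type_algebra_def)
    have "scale_fps 1 u = u"
      by (rule fps_ext) simp
    then show "\<one>\<^bsub>ring_of_type_algebra\<^esub> \<odot>\<^bsub>gr\<^esub> x = x"
      using * by (simp add: gr_smult ring_of_type_algebra_def)
  qed
  show "\<forall>c. \<forall>x\<in>carrier gr. \<forall>y\<in>carrier gr.
      (c \<odot>\<^bsub>gr\<^esub> x) \<otimes>\<^bsub>gr\<^esub> y = c \<odot>\<^bsub>gr\<^esub> (x \<otimes>\<^bsub>gr\<^esub> y) \<and>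
      x \<otimes>\<^bsub>gr\<^esub> (c \<odot>\<^bsub>gr\<^esub> y) = c \<odot>\<^bsub>gr\<^esub> (x \<otimes>\<^bsub>gr\<^esub> y)"
  proof (intro allI ballI)
    fix c x y assume "x \<in> carrier gr" "y \<in> carrier gr"
    then obtain u v where *: "x = graded_class u" "y = graded_class v" "u \<in> rees" "v \<in> rees"
      unfolding carrier_gr by blast
    have "scale_fps c u * v = scale_fps c (u * v)" "u * scale_fps c v = scale_fps c (u * v)"
      by (rule fps_ext,
          simp add: fps_mult_nth scale_mult_left scale_mult_right scale_sum_right)+
    then show "(c \<odot>\<^bsub>gr\<^esub> x) \<otimes>\<^bsub>gr\<^esub> y = c \<odot>\<^bsub>gr\<^esub> (x \<otimes>\<^bsub>gr\<^esub> y) \<and>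
        x \<otimes>\<^bsub>gr\<^esub> (c \<odot>\<^bsub>gr\<^esub> y) = c \<odot>\<^bsub>gr\<^esub> (x \<otimes>\<^bsub>gr\<^esub> y)"
      using * by (simp add: gr_smult gr_mult rees_scale)
  qed
qed

lemma mem_assoc_graded_component_iff:
  "x \<in> assoc_graded_component scale r \<A> F v \<longleftrightarrow>
    (\<exists>a \<in> F (v r) \<inter> \<A> (v(r := 0)). x = graded_class (mono_fps (v r) a))"
proof
  assume "x \<in> assoc_graded_component scale r \<A> F v"
  then obtain a where a: "a \<in> F (v r) \<inter> \<A> (v(r := 0))" "x (v r) = filt_class F (v r) a"
    and "\<And>d. d \<noteq> v r \<Longrightarrow> x d = filt_prev F d"
    unfolding assoc_graded_component_def by blast
  then have "x = graded_class (mono_fps (v r) a)"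
    by (auto simp: graded_class_def fun_eq_iff)
  with a(1) show "\<exists>a \<in> F (v r) \<inter> \<A> (v(r := 0)). x = graded_class (mono_fps (v r) a)" by blast
next
  assume "\<exists>a \<in> F (v r) \<inter> \<A> (v(r := 0)). x = graded_class (mono_fps (v r) a)"
  then obtain a where a: "a \<in> F (v r) \<inter> \<A> (v(r := 0))" "x = graded_class (mono_fps (v r) a)" by blast
  then have "x \<in> carrier gr" by (simp add: carrier_gr rees_mono)
  with a show "x \<in> assoc_graded_component scale r \<A> F v"
    by (simp add: assoc_graded_component_def graded_class_def)
qed

end

section \<open>From a degeneration to an adapted basis\<close>

text \<open>Cutting along the fibres of the weight or of the degree extracts the homogeneous parts
  of a coefficient function.\<close>

definition poly_part :: "('s \<Rightarrow>\<^sub>0 'k::field) \<Rightarrow> 's set \<Rightarrow> ('s \<Rightarrow>\<^sub>0 'k)" where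
  "poly_part f Q = (\<Sum>x\<in>Poly_Mapping.keys f \<inter> Q. Poly_Mapping.single x (Poly_Mapping.lookup f x))"

lemma lookup_poly_part:
  "Poly_Mapping.lookup (poly_part f Q) x = (if x \<in> Q then Poly_Mapping.lookup f x else 0)"
  by (auto simp: poly_part_def lookup_sum lookup_single when_def sum.delta in_keys_iff)

lemma keys_poly_part: "Poly_Mapping.keys (poly_part f Q) = Poly_Mapping.keys f \<inter> Q"
  by (auto simp: in_keys_iff lookup_poly_part split: if_splits)

lemma sum_poly_part_fibres:
  assumes "finite T" "g ` Poly_Mapping.keys f \<subseteq> T"
  shows "(\<Sum>t\<in>T. poly_part f (g -` {t})) = f"
proof (rule poly_mapping_eqI)
  fix x
  have "Poly_Mapping.lookup (\<Sum>t\<in>T. poly_part f (g -` {t})) x =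
      (\<Sum>t\<in>T. if t = g x then Poly_Mapping.lookup f x else 0)"
    unfolding lookup_sum by (rule sum.cong) (auto simp: lookup_poly_part)
  also have "\<dots> = Poly_Mapping.lookup f x"
  proof (cases "x \<in> Poly_Mapping.keys f")
    case True
    then have "g x \<in> T" using assms(2) by auto
    with assms(1) show ?thesis by simp
  next
    case False
    then show ?thesis by (intro trans[OF sum.neutral]) (simp_all add: in_keys_iff)
  qed
  finally show "Poly_Mapping.lookup (\<Sum>t\<in>T. poly_part f (g -` {t})) x = Poly_Mapping.lookup f x" .
qed

lemma twisted_algebra_mult_single:
  "Poly_Mapping.single x a \<otimes>\<^bsub>twisted_algebra \<alpha>\<^esub> Poly_Mapping.single y b =
    Poly_Mapping.single (x + y) (a * b * \<alpha> x y)"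
  by (simp add: twisted_algebra_def)

context unital_algebra
begin

lemma lincomb_poly_part:
  "lincomb scale e (poly_part f Q) = lincomb scale (\<lambda>x. if x \<in> Q then e x else 0) f"
proof -
  have "lincomb scale e (poly_part f Q) =
      (\<Sum>x\<in>Poly_Mapping.keys f. scale (Poly_Mapping.lookup (poly_part f Q) x) (e x))"
    by (rule lincomb_eq_sum) (auto simp: keys_poly_part)
  also have "\<dots> = lincomb scale (\<lambda>x. if x \<in> Q then e x else 0) f"
    unfolding lincomb_def by (rule sum.cong) (auto simp: lookup_poly_part)
  finally show ?thesis .
qed

text \<open>Sorts a combination of basis elements by weight into a series. Its class is the image of
  \<open>f\<close> under the map from the twisted semigroup algebra that sends \<open>X^x\<close> to
  the symbol of \<open>e x\<close>; both directions of the equivalence use this formula.\<close>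

definition weight_series :: "('s \<Rightarrow> nat) \<Rightarrow> ('s \<Rightarrow> 'a) \<Rightarrow> ('s \<Rightarrow>\<^sub>0 'k) \<Rightarrow> 'a fps" where
  "weight_series \<phi> e f = Abs_fps (\<lambda>d. lincomb scale e (poly_part f (\<phi> -` {d})))"

text \<open>Moving the restriction from the coefficients to the family makes the expression visibly
  linear in \<open>f\<close>.\<close>

lemma weight_series_nth:
  "fps_nth (weight_series \<phi> e f) d = lincomb scale (\<lambda>x. if x \<in> \<phi> -` {d} then e x else 0) f"
  by (simp add: weight_series_def lincomb_poly_part)

lemma weight_series_add: "weight_series \<phi> e (f + g) = weight_series \<phi> e f + weight_series \<phi> e g"
  by (rule fps_ext) (simp add: weight_series_nth lincomb_add)

lemma weight_series_zero [simp]: "weight_series \<phi> e 0 = 0"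
  by (rule fps_ext) (simp add: weight_series_nth)

lemma weight_series_single:
  "weight_series \<phi> e (Poly_Mapping.single x c) = mono_fps (\<phi> x) (scale c (e x))"
  by (rule fps_ext) (simp add: weight_series_nth)

end

context filtered_algebra
begin

lemma weight_series_in_rees:
  assumes "\<And>x. e x \<in> F (\<phi> x)"
  shows "weight_series \<phi> e f \<in> rees"
proof -
  have "lincomb scale (\<lambda>x. if x \<in> \<phi> -` {d} then e x else 0) f \<in> F d" for d
    unfolding lincomb_def
    by (intro subspace_sum[OF subspace_filt] subspace_scale[OF subspace_filt])
      (use assms in \<open>auto simp: subspace_0 subspace_filt\<close>)
  moreover have "finite {d. lincomb scale (\<lambda>x. if x \<in> \<phi> -` {d} then e x else 0) f \<noteq> 0}"
  proof (rule finite_subset)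
    show "{d. lincomb scale (\<lambda>x. if x \<in> \<phi> -` {d} then e x else 0) f \<noteq> 0} \<subseteq> \<phi> ` Poly_Mapping.keys f"
    proof clarify
      fix d assume ne: "lincomb scale (\<lambda>x. if x \<in> \<phi> -` {d} then e x else 0) f \<noteq> 0"
      show "d \<in> \<phi> ` Poly_Mapping.keys f"
      proof (rule ccontr)
        assume "d \<notin> \<phi> ` Poly_Mapping.keys f"
        then have "lincomb scale (\<lambda>x. if x \<in> \<phi> -` {d} then e x else 0) f = 0"
          unfolding lincomb_def by (intro sum.neutral) auto
        with ne show False by simp
      qed
    qed
  qed simp
  ultimately show ?thesis by (simp add: rees_def weight_series_nth)
qed

end

lemma (in graded_unital_algebra) connected_filtration_imp_filtered_algebra:
  assumes "connected_filtration scale r \<A> F"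
  shows "filtered_algebra scale F"
  by unfold_locales
    (use assms in \<open>auto simp: connected_filtration_def graded_subspace_def\<close>)

theorem (in graded_unital_algebra) quantum_toric_degeneration_imp_adapted_basis:
  assumes "quantum_toric_degeneration scale r \<A> TYPE('s::comm_monoid_add)"
  shows "\<exists>(\<phi> :: 's \<Rightarrow> nat) e \<alpha>. adapted_basis scale r \<A> \<phi> e \<alpha>"
proof -
  obtain F where filt: "connected_filtration scale r \<A> F"
    and toric: "quantum_positive_affine_toric (Suc r) (assoc_graded scale F)
      (assoc_graded_component scale r \<A> F) TYPE('s)"
    using assms unfolding quantum_toric_degeneration_def by (elim exE conjE)
  interpret filtered_algebra scale F
    by (rule connected_filtration_imp_filtered_algebra[OF filt])
  let ?G = "assoc_graded_component scale r \<A> F"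
  obtain \<alpha> :: "'s \<Rightarrow> 's \<Rightarrow> 'k" and h where cocycle: "two_cocycle \<alpha>"
    and iso: "h \<in> ring_iso (twisted_algebra \<alpha>) gr"
    and h_smult: "\<And>c f. h (c \<odot>\<^bsub>twisted_algebra \<alpha>\<^esub> f) = c \<odot>\<^bsub>gr\<^esub> h f"
    and h_deg: "\<And>x. x \<noteq> 0 \<Longrightarrow> \<exists>v\<in>Npow (Suc r). v \<noteq> 0 \<and> h (Poly_Mapping.single x 1) \<in> ?G v"
    using toric unfolding quantum_positive_affine_toric_def by blast
  have conn: "?G 0 = range (\<lambda>c. c \<odot>\<^bsub>gr\<^esub> \<one>\<^bsub>gr\<^esub>)"
    using toric unfolding quantum_positive_affine_toric_def connected_graded_algebra_def by (elim conjE)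
  have \<alpha>: "\<alpha> x y \<noteq> 0" for x y using cocycle unfolding two_cocycle_def by (elim conjE allE)
  have tw: "carrier (twisted_algebra \<alpha>) = UNIV"
    "\<one>\<^bsub>twisted_algebra \<alpha>\<^esub> = Poly_Mapping.single 0 (inverse (\<alpha> 0 0))"
    "\<And>f g. f \<oplus>\<^bsub>twisted_algebra \<alpha>\<^esub> g = f + g"
    "\<And>c f. c \<odot>\<^bsub>twisted_algebra \<alpha>\<^esub> f = Poly_Mapping.map ((*) c) f"
    by (simp_all add: twisted_algebra_def)
  have hom: "h \<in> ring_hom (twisted_algebra \<alpha>) gr" and bij: "bij_betw h UNIV (carrier gr)"
    using iso unfolding ring_iso_def tw(1) by simp_all
  have h_add: "h (f + g) = h f \<oplus>\<^bsub>gr\<^esub> h g" for f g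
    using ring_hom_add[OF hom, of f g] by (simp add: tw)
  have h_mult: "h (f \<otimes>\<^bsub>twisted_algebra \<alpha>\<^esub> g) = h f \<otimes>\<^bsub>gr\<^esub> h g" for f g
    using ring_hom_mult[OF hom, of f g] by (simp add: tw)
  have h_single: "h (Poly_Mapping.single x c) = c \<odot>\<^bsub>gr\<^esub> h (Poly_Mapping.single x 1)" for x c
    using h_smult[of c "Poly_Mapping.single x 1"] by (simp add: tw)
  \<comment> \<open>The assumption on degrees concerns \<open>x\<close> different from 0. For
    \<open>x = 0\<close>, the unit is \<open>inverse (\<alpha> 0 0)\<close> times
    \<open>X^0\<close>, so connectedness puts \<open>X^0\<close> into degree 0.\<close>
  have "\<exists>v\<in>Npow (Suc r). (x = 0 \<longleftrightarrow> v = 0) \<and> h (Poly_Mapping.single x 1) \<in> ?G v" for x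
  proof (cases "x = 0")
    case True
    have "h (Poly_Mapping.single 0 1) = h (\<alpha> 0 0 \<odot>\<^bsub>twisted_algebra \<alpha>\<^esub> \<one>\<^bsub>twisted_algebra \<alpha>\<^esub>)"
      using \<alpha>[of 0 0] by (simp add: tw)
    also have "\<dots> = \<alpha> 0 0 \<odot>\<^bsub>gr\<^esub> \<one>\<^bsub>gr\<^esub>"
      unfolding h_smult using ring_hom_one[OF hom] by simp
    finally have "h (Poly_Mapping.single 0 1) \<in> ?G 0" unfolding conn by (rule range_eqI)
    with True show ?thesis by (intro bexI[of _ 0]) simp_all
  next
    case False
    then show ?thesis using h_deg[of x] by blast
  qed
  then obtain v where v: "\<And>x. v x \<in> Npow (Suc r)" "\<And>x. x = 0 \<longleftrightarrow> v x = 0"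
    "\<And>x. h (Poly_Mapping.single x 1) \<in> ?G (v x)"
    by metis
  \<comment> \<open>The last coordinate of the degree of \<open>X^x\<close> is the filtration degree
    and becomes the weight; the remaining ones are the degree of the lift in \<nat>^r.\<close>
  define \<phi> where "\<phi> x = v x r" for x
  define w where "w x = (v x)(r := 0)" for x
  have w: "w x \<in> Npow r" for x
    unfolding Npow_def
  proof (intro CollectI allI impI)
    fix i assume "r \<le> i"
    then show "w x i = 0"
      using v(1)[of x] by (cases "i = r") (simp_all add: Npow_def w_def)
  qed
  have "\<exists>a. a \<in> F (\<phi> x) \<and> a \<in> \<A> (w x) \<and> h (Poly_Mapping.single x 1) = graded_class (mono_fps (\<phi> x) a)" for x
    using v(3)[of x] unfolding mem_assoc_graded_component_iff \<phi>_def w_def by blast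
  then obtain e where e: "\<And>x. e x \<in> F (\<phi> x)" "\<And>x. e x \<in> \<A> (w x)"
    "\<And>x. h (Poly_Mapping.single x 1) = graded_class (mono_fps (\<phi> x) (e x))"
    by metis
  have scale_mono: "scale_fps c (mono_fps d a) = mono_fps d (scale c a)" for c d a
    by (rule fps_ext) simp
  have h_single': "h (Poly_Mapping.single x c) = graded_class (mono_fps (\<phi> x) (scale c (e x)))" for x c
    unfolding h_single[of x c] e(3) gr_smult scale_mono ..
  have h_zero: "h 0 = graded_class 0"
    using h_single'[of 0 0] by simp
  have h_series: "h f = graded_class (weight_series \<phi> e f)" for f
  proof -
    have "h (\<Sum>x\<in>T. Poly_Mapping.single x (c x)) =
        graded_class (weight_series \<phi> e (\<Sum>x\<in>T. Poly_Mapping.single x (c x)))" if "finite T" for T c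
      using that
      by (induction T)
        (simp_all add: h_zero h_add h_single' gr_add weight_series_add weight_series_single)
    from this[of "Poly_Mapping.keys f" "Poly_Mapping.lookup f"] show ?thesis
      by (simp add: poly_mapping_sum_singles[symmetric])
  qed
  have h_eq_zero: "f = 0" if "\<And>d. fps_nth (weight_series \<phi> e f) d \<in> filt_prev F d" for f
  proof -
    have "h f = h 0" unfolding h_series using that by (simp add: graded_class_eq_iff)
    then show ?thesis using bij_betw_imp_inj_on[OF bij] by (simp add: inj_eq)
  qed
  \<comment> \<open>The symbol of \<open>e x\<close> in degree \<open>\<phi> x\<close> is the image
    of \<open>X^x\<close> under the injective \<open>h\<close>, so it cannot vanish.\<close>
  have e_notin: "e x \<notin> filt_prev F (\<phi> x)" for x
  proof
    assume "e x \<in> filt_prev F (\<phi> x)"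
    then have "Poly_Mapping.single x (1::'k) = 0"
      by (intro h_eq_zero) (simp add: weight_series_single subspace_0)
    then have "Poly_Mapping.lookup (Poly_Mapping.single x (1::'k)) x = 0" by simp
    then show False by simp
  qed
  have prod: "\<phi> (x + y) = \<phi> x + \<phi> y \<and>
      e x * e y - scale (\<alpha> x y) (e (x + y)) \<in> filt_prev F (\<phi> (x + y))" for x y
  proof -
    have "h (Poly_Mapping.single (x + y) (\<alpha> x y)) =
        h (Poly_Mapping.single x 1 \<otimes>\<^bsub>twisted_algebra \<alpha>\<^esub> Poly_Mapping.single y 1)"
      by (simp add: twisted_algebra_mult_single)
    also have "\<dots> = graded_class (mono_fps (\<phi> x + \<phi> y) (e x * e y))"
      by (simp add: h_mult e(3) gr_mult rees_mono e(1) mono_fps_mult)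
    finally have eq: "graded_class (mono_fps (\<phi> x + \<phi> y) (e x * e y)) =
        graded_class (mono_fps (\<phi> (x + y)) (scale (\<alpha> x y) (e (x + y))))"
      by (simp add: h_single')
    have *: "fps_nth (mono_fps (\<phi> x + \<phi> y) (e x * e y)) d -
        fps_nth (mono_fps (\<phi> (x + y)) (scale (\<alpha> x y) (e (x + y)))) d \<in> filt_prev F d" for d
      using eq unfolding graded_class_eq_iff by (rule spec)
    \<comment> \<open>The class of the product sits in degree \<open>\<phi> x + \<phi> y\<close>,
      and it equals a nonzero multiple of the symbol of \<open>e (x + y)\<close>. If the degrees
      differed, that symbol would be zero.\<close>
    have "\<phi> (x + y) = \<phi> x + \<phi> y"
    proof (rule ccontr)
      assume "\<phi> (x + y) \<noteq> \<phi> x + \<phi> y"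
      then have "- scale (\<alpha> x y) (e (x + y)) \<in> filt_prev F (\<phi> (x + y))"
        using *[of "\<phi> (x + y)"] by simp
      then have "scale (- inverse (\<alpha> x y)) (- scale (\<alpha> x y) (e (x + y))) \<in> filt_prev F (\<phi> (x + y))"
        by (rule subspace_scale[OF subspace_filt_prev])
      then show False using e_notin[of "x + y"] \<alpha>[of x y] by simp
    qed
    with *[of "\<phi> (x + y)"] show ?thesis by simp
  qed
  have \<phi>0: "\<phi> x = 0 \<longleftrightarrow> x = 0" for x
  proof
    assume "x = 0"
    then show "\<phi> x = 0" using v(2)[of x] by (simp add: \<phi>_def)
  next
    assume \<phi>x: "\<phi> x = 0"
    show "x = 0"
    proof (rule ccontr)
      assume "x \<noteq> 0"
      then have "v x \<noteq> 0" using v(2)[of x] by simp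
      moreover have "w x = v x" using \<phi>x by (simp add: w_def \<phi>_def fun_eq_iff)
      ultimately have w0: "w x \<noteq> 0" by simp
      \<comment> \<open>Filtration degree 0 makes \<open>e x\<close> a scalar, hence of degree 0;
        but the degree \<open>w x\<close> is nonzero, because the total degree is nonzero and its
        last coordinate vanishes. Directness then forces \<open>e x = 0\<close>.\<close>
      have "e x \<in> \<A> 0" using e(1)[of x] unfolding \<phi>x filt_zero component_zero .
      then have "e x = 0"
        using component_of_sum[of "{0}" "\<lambda>_. e x" "w x"] w0 by (simp add: w e(2))
      then show False using e_notin[of x] by (simp add: subspace_0)
    qed
  qed
  define E where "E d = span (e ` {u. \<phi> u < d})" for d
  \<comment> \<open>By surjectivity of \<open>h\<close>, the symbol of \<open>a\<close> in degree
    \<open>d\<close> is that of a combination of elements \<open>e x\<close> of weight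
    \<open>d\<close>. Subtracting it drops \<open>a\<close> into the preceding step, where induction
    applies.\<close>
  have E_prev: "filt_prev F d \<subseteq> E d" for d
  proof (induction d)
    case 0
    show ?case by (simp add: filt_prev_def E_def)
  next
    case (Suc d)
    show ?case
    proof
      fix a assume "a \<in> filt_prev F (Suc d)"
      then have a: "a \<in> F d" by (simp add: filt_prev_def)
      then have "graded_class (mono_fps d a) \<in> carrier gr" by (simp add: carrier_gr rees_mono)
      then have "graded_class (mono_fps d a) \<in> range h" using bij_betw_imp_surj_on[OF bij] by simp
      then obtain f where "graded_class (mono_fps d a) = graded_class (weight_series \<phi> e f)"
        unfolding h_series by blast
      then have "fps_nth (mono_fps d a) d - fps_nth (weight_series \<phi> e f) d \<in> filt_prev F d"
        unfolding graded_class_eq_iff by (rule spec)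
      then have "a - lincomb scale e (poly_part f (\<phi> -` {d})) \<in> E d"
        using Suc by (auto simp: weight_series_def)
      also have "E d \<subseteq> E (Suc d)" unfolding E_def by (intro span_mono image_mono) auto
      finally have 1: "a - lincomb scale e (poly_part f (\<phi> -` {d})) \<in> E (Suc d)" .
      have 2: "lincomb scale e (poly_part f (\<phi> -` {d})) \<in> E (Suc d)"
        unfolding E_def by (rule lincomb_in_span) (auto simp: keys_poly_part)
      show "a \<in> E (Suc d)"
        using span_add[OF 1[unfolded E_def] 2[unfolded E_def]] by (simp add: E_def)
    qed
  qed
  have E_sub: "E d \<subseteq> filt_prev F d" for d
    unfolding E_def
  proof (rule span_minimal[OF _ subspace_filt_prev], rule image_subsetI)
    fix x assume "x \<in> {u. \<phi> u < d}"
    then obtain d' where d': "d = Suc d'" "\<phi> x \<le> d'" by (cases d) auto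
    then have "F (\<phi> x) \<subseteq> filt_prev F d" using filt_mono by (simp add: filt_prev_def mono_def)
    then show "e x \<in> filt_prev F d" using e(1) by (rule subsetD)
  qed
  have "independent_family scale e"
    unfolding independent_family_iff
  proof (intro allI impI, rule ccontr)
    fix f assume f: "lincomb scale e f = 0" "f \<noteq> 0"
    define D where "D = Max (\<phi> ` Poly_Mapping.keys f)"
    have "D \<in> \<phi> ` Poly_Mapping.keys f"
      unfolding D_def using f(2) by (intro Max_in) auto
    then obtain x0 where x0: "x0 \<in> Poly_Mapping.keys f" "\<phi> x0 = D" by auto
    have D: "\<phi> x \<le> D" if "x \<in> Poly_Mapping.keys f" for x
      unfolding D_def using that by simp
    \<comment> \<open>The part of top weight in a relation equals minus the rest, which lies in the
      preceding step. Its symbol is therefore zero, and injectivity of \<open>h\<close> removes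
      it.\<close>
    define g where "g = poly_part f (\<phi> -` {D})"
    have fg: "Poly_Mapping.keys (f - g) \<subseteq> {u. \<phi> u < D}"
    proof
      fix x assume "x \<in> Poly_Mapping.keys (f - g)"
      then have "x \<in> Poly_Mapping.keys f" "\<phi> x \<noteq> D"
        by (auto simp: in_keys_iff lookup_minus g_def lookup_poly_part split: if_splits)
      then show "x \<in> {u. \<phi> u < D}" using D[of x] by simp
    qed
    have "lincomb scale e g = - lincomb scale e (f - g)" using f(1) by (simp add: lincomb_diff)
    also have "\<dots> \<in> filt_prev F D"
      by (rule subspace_neg[OF subspace_filt_prev subsetD[OF E_sub]])
        (use lincomb_in_span[OF fg] in \<open>simp add: E_def\<close>)
    finally have gD: "lincomb scale e g \<in> filt_prev F D" .
    have "g = 0"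
    proof (rule h_eq_zero)
      fix d
      show "fps_nth (weight_series \<phi> e g) d \<in> filt_prev F d"
      proof (cases "d = D")
        case True
        have "poly_part g (\<phi> -` {D}) = g"
          by (rule poly_mapping_eqI) (simp add: g_def lookup_poly_part)
        then show ?thesis using True gD by (simp add: weight_series_def)
      next
        case False
        then have "poly_part g (\<phi> -` {d}) = 0"
          by (intro poly_mapping_eqI) (simp add: g_def lookup_poly_part)
        then show ?thesis by (simp add: weight_series_def subspace_0)
      qed
    qed
    then have "Poly_Mapping.lookup g x0 = 0" by simp
    then show False using x0 by (simp add: g_def lookup_poly_part in_keys_iff)
  qed
  moreover have "span (range e) = UNIV"
  proof -
    have "a \<in> span (range e)" for a
    proof -
      have "(\<Union>d. F d) = UNIV" using filt unfolding connected_filtration_def by (elim conjE)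
      then obtain d where "a \<in> F d" by blast
      then have "a \<in> E (Suc d)" using E_prev[of "Suc d"] by (auto simp: filt_prev_def)
      also have "E (Suc d) \<subseteq> span (range e)" unfolding E_def by (intro span_mono image_mono) auto
      finally show ?thesis .
    qed
    then show ?thesis by blast
  qed
  moreover have "\<exists>c. 1 = scale c (e 0)"
  proof -
    \<comment> \<open>Only 0 has weight 0, so the bottom step is contained in the line through
      \<open>e 0\<close>; it contains the unit.\<close>
    have "{u. \<phi> u < Suc 0} = {0}" using \<phi>0 by auto
    then have "E (Suc 0) = range (\<lambda>c. scale c (e 0))" by (simp add: E_def span_singleton)
    moreover have "1 \<in> E (Suc 0)"
      using one_in_filt_zero E_prev[of "Suc 0"] by (auto simp: filt_prev_def)
    ultimately show ?thesis by blast
  qed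
  moreover have "additive_morphism \<phi>"
    using prod \<phi>0 by (simp add: additive_morphism_def)
  moreover have "\<phi> -` {0} = {0}" using \<phi>0 by auto
  moreover have "homogeneous (e x)" for x using w e(2) by blast
  moreover have "e x * e y - scale (\<alpha> x y) (e (x + y)) \<in> span (e ` {u. \<phi> u < \<phi> (x + y)})" for x y
    using prod[of x y] E_prev unfolding E_def by blast
  ultimately have "adapted_basis scale r \<A> \<phi> e \<alpha>"
    using \<alpha> by unfold_locales
  then show ?thesis by blast
qed

section \<open>From an adapted basis to a degeneration\<close>

context adapted_basis
begin

definition filt :: "nat \<Rightarrow> 'a set" where
  "filt d = below (Suc d)"

lemma filt_prev_eq_below: "filt_prev filt d = below d"
  by (cases d) (simp_all add: filt_prev_def filt_def below_def)

lemma lincomb_inject: "lincomb scale e f = lincomb scale e g \<Longrightarrow> f = g"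
  using basis_independent[unfolded independent_family_iff, rule_format, of "f - g"]
  by (simp add: lincomb_diff)

text \<open>Independence makes coefficients unique, so membership in \<open>below\<close> can be
  read off the support. Injectivity and surjectivity of \<open>iso_gr\<close> both come down to
  this.\<close>

lemma lincomb_below_iff: "lincomb scale e f \<in> below N \<longleftrightarrow> Poly_Mapping.keys f \<subseteq> {u. \<phi> u < N}"
proof
  assume "lincomb scale e f \<in> below N"
  then obtain g where "lincomb scale e f = lincomb scale e g" "Poly_Mapping.keys g \<subseteq> {u. \<phi> u < N}"
    unfolding below_def span_image_eq_lincomb by blast
  then show "Poly_Mapping.keys f \<subseteq> {u. \<phi> u < N}" using lincomb_inject[of f g] by simp
qed (simp add: below_def lincomb_in_span)

lemma scale_basis_below: "scale c (e x) \<in> below (\<phi> x) \<Longrightarrow> c = 0"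
  using lincomb_below_iff[of "Poly_Mapping.single x c" "\<phi> x"]
  by (cases "c = 0") simp_all

lemma filt_zero_eq: "filt 0 = range (\<lambda>c. scale c 1)"
proof -
  obtain c where c: "1 = scale c (e 0)" using one_eq_basis_zero by blast
  then have c0: "c \<noteq> 0" by auto
  have "{u. \<phi> u < Suc 0} = {0}" using weight_zero_iff by auto
  then have eq: "filt 0 = range (\<lambda>c. scale c (e 0))"
    by (simp add: filt_def below_def span_singleton)
  have "scale k (e 0) = scale (k / c) 1" for k using c0 by (simp add: c)
  moreover have "scale k 1 = scale (k * c) (e 0)" for k by (simp add: c)
  ultimately show ?thesis unfolding eq by (metis (mono_tags, lifting) image_cong subset_antisym image_subsetI rangeI)
qed

lemma filtered_algebra_filt: "filtered_algebra scale filt"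
proof
  show "filt 0 = range (\<lambda>c. scale c 1)" by (rule filt_zero_eq)
  show "mono filt" by (rule monoI) (simp add: filt_def below_mono)
  show "subspace (filt d)" for d by (simp add: filt_def)
  show "x * y \<in> filt (d + d')" if "x \<in> filt d" "y \<in> filt d'" for x y d d'
    using that unfolding filt_def by (rule below_mult) simp
qed

end

sublocale adapted_basis \<subseteq> gr_filt: filtered_algebra scale "adapted_basis.filt scale \<phi> e"
  by (rule filtered_algebra_filt)

context adapted_basis
begin

abbreviation "gr \<equiv> gr_filt.gr"

text \<open>Homogeneity of the basis makes each step a graded subspace, and \<open>fin\<close> makes
  it finite-dimensional.\<close>

lemma connected_filtration_filt:
  assumes fin: "\<And>d. finite {u. \<phi> u \<le> d}"
  shows "connected_filtration scale r \<A> filt"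
  unfolding connected_filtration_def
proof (intro conjI allI ballI)
  show "filt 0 = range (\<lambda>c. scale c 1)" by (rule filt_zero_eq)
  show "mono filt" by (rule gr_filt.filt_mono)
  have "a \<in> (\<Union>d. filt d)" for a
  proof -
    obtain N where "a \<in> below N" using union_below by blast
    then have "a \<in> filt N" using below_mono[of N "Suc N"] by (auto simp: filt_def)
    then show ?thesis by blast
  qed
  then show "(\<Union>d. filt d) = UNIV" by blast
  show "x * y \<in> filt (d + d')" if "x \<in> filt d" "y \<in> filt d'" for x y d d'
    using that by (rule gr_filt.filt_mult)
  fix d
  show "graded_subspace scale r \<A> (filt d)"
    unfolding graded_subspace_def
  proof
    show sub: "subspace (filt d)" by (rule gr_filt.subspace_filt)
    show "filt d = span (\<Union>v\<in>Npow r. filt d \<inter> \<A> v)"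
    proof
      have "e u \<in> (\<Union>v\<in>Npow r. filt d \<inter> \<A> v)" if "\<phi> u < Suc d" for u
        using basis_homogeneous[of u] basis_in_below[OF that] unfolding filt_def by blast
      then show "filt d \<subseteq> span (\<Union>v\<in>Npow r. filt d \<inter> \<A> v)"
        unfolding filt_def[of d] below_def[of "Suc d"] by (intro span_mono image_subsetI) (simp add: filt_def below_def)
      show "span (\<Union>v\<in>Npow r. filt d \<inter> \<A> v) \<subseteq> filt d"
        by (rule span_minimal[OF _ sub]) blast
    qed
  qed
  show "\<exists>B. finite B \<and> filt d = span B"
    using fin[of d] by (intro exI[of _ "e ` {u. \<phi> u \<le> d}"]) (simp add: filt_def below_def less_Suc_eq_le)
qed

text \<open>The product \<open>e x * e y * e z\<close> is expanded with either bracketing; comparing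
  the coefficients of \<open>e (x + y + z)\<close> modulo lower terms gives the identity.\<close>

lemma two_cocycle_structure: "two_cocycle \<alpha>"
  unfolding two_cocycle_def
proof (intro conjI allI)
  show "\<alpha> x y \<noteq> 0" for x y by (rule structure_nonzero)
  fix x y z
  let ?N = "\<phi> (x + y + z)"
  have 1: "e x * e y * e z - scale (\<alpha> x y * \<alpha> (x + y) z) (e (x + y + z)) \<in> below ?N"
  proof -
    have "(e x * e y - scale (\<alpha> x y) (e (x + y))) * e z \<in> below ?N"
      by (rule below_mult[OF basis_mult_below basis_in_below[OF lessI]]) (simp add: weight_add)
    moreover have "scale (\<alpha> x y) (e (x + y) * e z - scale (\<alpha> (x + y) z) (e (x + y + z))) \<in> below ?N"
      using basis_mult_below[of "x + y" z] by (simp add: weight_add subspace_scale)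
    ultimately have "(e x * e y - scale (\<alpha> x y) (e (x + y))) * e z +
        scale (\<alpha> x y) (e (x + y) * e z - scale (\<alpha> (x + y) z) (e (x + y + z))) \<in> below ?N"
      by (rule subspace_add[OF subspace_below])
    then show ?thesis
      by (simp add: left_diff_distrib scale_mult_left scale_right_diff_distrib)
  qed
  have 2: "e x * e y * e z - scale (\<alpha> x (y + z) * \<alpha> y z) (e (x + y + z)) \<in> below ?N"
  proof -
    have "e x * (e y * e z - scale (\<alpha> y z) (e (y + z))) \<in> below ?N"
      by (rule below_mult[OF basis_in_below[OF lessI] basis_mult_below]) (simp add: weight_add)
    moreover have "scale (\<alpha> y z) (e x * e (y + z) - scale (\<alpha> x (y + z)) (e (x + (y + z)))) \<in> below ?N"
      using basis_mult_below[of x "y + z"] by (simp add: weight_add add.assoc subspace_scale)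
    ultimately have "e x * (e y * e z - scale (\<alpha> y z) (e (y + z))) +
        scale (\<alpha> y z) (e x * e (y + z) - scale (\<alpha> x (y + z)) (e (x + (y + z)))) \<in> below ?N"
      by (rule subspace_add[OF subspace_below])
    then show ?thesis
      by (simp add: right_diff_distrib scale_mult_right scale_right_diff_distrib mult.assoc add.assoc
          mult.commute[of "\<alpha> y z"])
  qed
  have "scale (\<alpha> x y * \<alpha> (x + y) z - \<alpha> x (y + z) * \<alpha> y z) (e (x + y + z)) \<in> below ?N"
    using subspace_diff[OF subspace_below 2 1] by (simp add: scale_left_diff_distrib)
  then have "\<alpha> x y * \<alpha> (x + y) z - \<alpha> x (y + z) * \<alpha> y z = 0" by (rule scale_basis_below)
  then show "\<alpha> x y * \<alpha> (x + y) z = \<alpha> x (y + z) * \<alpha> y z" by simp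
qed

section \<open>The isomorphism from the twisted semigroup algebra to the associated graded
  algebra\<close>

definition iso_gr :: "('s \<Rightarrow>\<^sub>0 'k) \<Rightarrow> nat \<Rightarrow> 'a set" where
  "iso_gr f = gr_filt.graded_class (weight_series \<phi> e f)"

lemma basis_in_filt: "e x \<in> filt (\<phi> x)"
  by (simp add: filt_def basis_in_below)

lemma weight_series_rees: "weight_series \<phi> e f \<in> gr_filt.rees"
  by (rule gr_filt.weight_series_in_rees) (rule basis_in_filt)

lemma iso_gr_carrier: "iso_gr f \<in> carrier gr"
  unfolding gr_filt.carrier_gr iso_gr_def by (rule imageI[OF weight_series_rees])

lemma iso_gr_add: "iso_gr (f + g) = iso_gr f \<oplus>\<^bsub>gr\<^esub> iso_gr g"
  by (simp add: iso_gr_def weight_series_add gr_filt.gr_add)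

lemma iso_gr_zero: "iso_gr 0 = \<zero>\<^bsub>gr\<^esub>"
  by (simp add: iso_gr_def gr_filt.gr_zero)

lemma iso_gr_smult: "iso_gr (Poly_Mapping.map ((*) c) f) = c \<odot>\<^bsub>gr\<^esub> iso_gr f"
proof -
  have "weight_series \<phi> e (Poly_Mapping.map ((*) c) f) = gr_filt.scale_fps c (weight_series \<phi> e f)"
    by (rule fps_ext) (simp add: weight_series_nth lincomb_smult)
  then show ?thesis by (simp add: iso_gr_def gr_filt.gr_smult)
qed

text \<open>In weight 0 there are no lower terms, so \<open>e 0 * e 0\<close> is exactly
  \<open>\<alpha> 0 0\<close> times \<open>e 0\<close>. Comparison with
  \<open>1 = scale c (e 0)\<close> identifies \<open>c\<close> with the inverse of
  \<open>\<alpha> 0 0\<close>.\<close>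

lemma iso_gr_one: "iso_gr (Poly_Mapping.single 0 (inverse (\<alpha> 0 0))) = \<one>\<^bsub>gr\<^esub>"
proof -
  obtain c where c: "1 = scale c (e 0)" using one_eq_basis_zero by blast
  have "e 0 * e 0 - scale (\<alpha> 0 0) (e 0) \<in> below 0"
    using basis_mult_below[of 0 0] weight_zero_iff[of 0] by simp
  then have "e 0 * e 0 = scale (\<alpha> 0 0) (e 0)" by (simp add: below_def)
  then have "scale c (e 0) * e 0 = scale (c * \<alpha> 0 0) (e 0)"
    by (simp add: scale_mult_left)
  then have "e 0 = scale (c * \<alpha> 0 0) (e 0)" by (simp add: c[symmetric])
  then have "scale (1 - c * \<alpha> 0 0) (e 0) \<in> below (\<phi> 0)"
    by (simp add: scale_left_diff_distrib subspace_0)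
  then have "1 - c * \<alpha> 0 0 = 0" by (rule scale_basis_below)
  then have "inverse (\<alpha> 0 0) = c" using structure_nonzero[of 0 0] by (simp add: field_simps)
  then have "weight_series \<phi> e (Poly_Mapping.single 0 (inverse (\<alpha> 0 0))) = mono_fps 0 1"
    using weight_zero_iff[of 0] by (simp add: weight_series_single c[symmetric])
  also have "\<dots> = 1" by (rule fps_ext) (simp add: fps_one_nth)
  finally show ?thesis by (simp add: iso_gr_def gr_filt.gr_one)
qed

lemma weight_series_nth_keys:
  assumes "finite T" "Poly_Mapping.keys f \<subseteq> T"
  shows "fps_nth (weight_series \<phi> e f) d =
    (\<Sum>x\<in>T. if \<phi> x = d then scale (Poly_Mapping.lookup f x) (e x) else 0)"
  unfolding weight_series_nth lincomb_eq_sum[OF assms] by (rule sum.cong) auto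

text \<open>In degree \<open>d\<close> the two series differ by a combination of the errors
  \<open>e x * e y - scale (\<alpha> x y) (e (x + y))\<close> with
  \<open>\<phi> (x + y) = d\<close>, and these vanish in the quotient.\<close>

lemma iso_gr_mult: "iso_gr (f \<otimes>\<^bsub>twisted_algebra \<alpha>\<^esub> g) = iso_gr f \<otimes>\<^bsub>gr\<^esub> iso_gr g"
proof -
  let ?X = "Poly_Mapping.keys f" and ?Y = "Poly_Mapping.keys g"
  let ?c = "\<lambda>x y. Poly_Mapping.lookup f x * Poly_Mapping.lookup g y"
  have "fps_nth (weight_series \<phi> e f * weight_series \<phi> e g) d -
      fps_nth (weight_series \<phi> e (f \<otimes>\<^bsub>twisted_algebra \<alpha>\<^esub> g)) d \<in> below d" for d
  proof -
    have "fps_nth (weight_series \<phi> e f * weight_series \<phi> e g) d =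
        (\<Sum>i=0..d. \<Sum>x\<in>?X. \<Sum>y\<in>?Y. if \<phi> x = i \<and> \<phi> y = d - i then scale (?c x y) (e x * e y) else 0)"
      unfolding fps_mult_nth
    proof (rule sum.cong[OF refl])
      fix i
      show "fps_nth (weight_series \<phi> e f) i * fps_nth (weight_series \<phi> e g) (d - i) =
          (\<Sum>x\<in>?X. \<Sum>y\<in>?Y. if \<phi> x = i \<and> \<phi> y = d - i then scale (?c x y) (e x * e y) else 0)"
        unfolding weight_series_nth_keys[OF finite_keys order_refl] sum_product
        by (intro sum.cong refl) (simp add: scale_mult_left scale_mult_right mult.commute)
    qed
    also have "\<dots> = (\<Sum>x\<in>?X. \<Sum>y\<in>?Y. \<Sum>i=0..d.
        if \<phi> x = i \<and> \<phi> y = d - i then scale (?c x y) (e x * e y) else 0)"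
      by (subst sum.swap, rule sum.cong[OF refl], rule sum.swap)
    also have "\<dots> = (\<Sum>x\<in>?X. \<Sum>y\<in>?Y. if \<phi> (x + y) = d then scale (?c x y) (e x * e y) else 0)"
    proof (intro sum.cong refl)
      fix x y
      \<comment> \<open>Only \<open>i = \<phi> x\<close> can contribute, and it occurs in the range
        only if \<open>\<phi> x \<le> d\<close>, so the truncated subtraction is harmless.\<close>
      have "(\<Sum>i=0..d. if \<phi> x = i \<and> \<phi> y = d - i then scale (?c x y) (e x * e y) else 0) =
          (\<Sum>i=0..d. if i = \<phi> x then (if \<phi> y = d - \<phi> x then scale (?c x y) (e x * e y) else 0) else 0)"
        by (rule sum.cong) auto
      also have "\<dots> = (if \<phi> (x + y) = d then scale (?c x y) (e x * e y) else 0)"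
        by (auto simp: weight_add)
      finally show "(\<Sum>i=0..d. if \<phi> x = i \<and> \<phi> y = d - i then scale (?c x y) (e x * e y) else 0) =
          (if \<phi> (x + y) = d then scale (?c x y) (e x * e y) else 0)" .
    qed
    finally have 1: "fps_nth (weight_series \<phi> e f * weight_series \<phi> e g) d =
        (\<Sum>x\<in>?X. \<Sum>y\<in>?Y. if \<phi> (x + y) = d then scale (?c x y) (e x * e y) else 0)" .
    have "fps_nth (weight_series \<phi> e (f \<otimes>\<^bsub>twisted_algebra \<alpha>\<^esub> g)) d =
        (\<Sum>x\<in>?X. \<Sum>y\<in>?Y. fps_nth (weight_series \<phi> e (Poly_Mapping.single (x + y) (?c x y * \<alpha> x y))) d)"
      by (simp add: twisted_algebra_def weight_series_nth lincomb_sum)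
    also have "\<dots> = (\<Sum>x\<in>?X. \<Sum>y\<in>?Y.
        if \<phi> (x + y) = d then scale (?c x y) (scale (\<alpha> x y) (e (x + y))) else 0)"
      unfolding weight_series_single by (intro sum.cong refl) auto
    finally have 2: "fps_nth (weight_series \<phi> e (f \<otimes>\<^bsub>twisted_algebra \<alpha>\<^esub> g)) d = \<dots>" .
    have "(\<Sum>x\<in>?X. \<Sum>y\<in>?Y. if \<phi> (x + y) = d
        then scale (?c x y) (e x * e y - scale (\<alpha> x y) (e (x + y))) else 0) \<in> below d"
    proof (intro subspace_sum[OF subspace_below])
      fix x y
      show "(if \<phi> (x + y) = d then scale (?c x y) (e x * e y - scale (\<alpha> x y) (e (x + y))) else 0)
          \<in> below d"
        using subspace_scale[OF subspace_below basis_mult_below[of x y]]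
        by (auto simp: weight_add subspace_0)
    qed
    also have "(\<Sum>x\<in>?X. \<Sum>y\<in>?Y. if \<phi> (x + y) = d
        then scale (?c x y) (e x * e y - scale (\<alpha> x y) (e (x + y))) else 0) =
      fps_nth (weight_series \<phi> e f * weight_series \<phi> e g) d -
      fps_nth (weight_series \<phi> e (f \<otimes>\<^bsub>twisted_algebra \<alpha>\<^esub> g)) d"
      unfolding 1 2 sum_subtractf[symmetric]
      by (intro sum.cong refl) (simp add: scale_right_diff_distrib del: scale_scale)
    finally show ?thesis .
  qed
  then have "iso_gr f \<otimes>\<^bsub>gr\<^esub> iso_gr g = iso_gr (f \<otimes>\<^bsub>twisted_algebra \<alpha>\<^esub> g)"
    unfolding iso_gr_def gr_filt.gr_mult[OF weight_series_rees weight_series_rees]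
    by (simp add: gr_filt.graded_class_eq_iff filt_prev_eq_below)
  then show ?thesis by simp
qed

text \<open>If the symbols agree in degree \<open>d\<close>, the difference of the
  weight-\<open>d\<close> parts lies in \<open>below d\<close>; its support has weight exactly
  \<open>d\<close>, so it is empty.\<close>

lemma iso_gr_inj: "inj iso_gr"
proof (rule injI)
  fix f g assume "iso_gr f = iso_gr g"
  then have *: "fps_nth (weight_series \<phi> e f) d - fps_nth (weight_series \<phi> e g) d \<in> below d" for d
    by (simp add: iso_gr_def gr_filt.graded_class_eq_iff filt_prev_eq_below)
  show "f = g"
  proof (rule poly_mapping_eqI)
    fix x
    let ?h = "poly_part f (\<phi> -` {\<phi> x}) - poly_part g (\<phi> -` {\<phi> x})"
    have "lincomb scale e ?h \<in> below (\<phi> x)"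
      using *[of "\<phi> x"] by (simp add: weight_series_def lincomb_diff)
    then have "x \<notin> Poly_Mapping.keys ?h" unfolding lincomb_below_iff by auto
    then show "Poly_Mapping.lookup f x = Poly_Mapping.lookup g x"
      by (simp add: in_keys_iff lookup_minus lookup_poly_part)
  qed
qed

lemma iso_gr_surj: "range iso_gr = carrier gr"
proof
  show "range iso_gr \<subseteq> carrier gr" using iso_gr_carrier by blast
  show "carrier gr \<subseteq> range iso_gr"
  proof
    fix z assume "z \<in> carrier gr"
    then obtain u where u: "z = gr_filt.graded_class u" "u \<in> gr_filt.rees"
      unfolding gr_filt.carrier_gr by blast
    have "\<exists>q. fps_nth u d = lincomb scale e q \<and> Poly_Mapping.keys q \<subseteq> {x. \<phi> x < Suc d}" for d
      using gr_filt.reesD(1)[OF u(2), of d] unfolding filt_def below_def span_image_eq_lincomb by blast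
    then obtain q where q: "\<And>d. fps_nth u d = lincomb scale e (q d)"
      "\<And>d. Poly_Mapping.keys (q d) \<subseteq> {x. \<phi> x < Suc d}"
      by metis
    define D where "D = {d. fps_nth u d \<noteq> 0}"
    have D: "finite D" unfolding D_def by (rule gr_filt.reesD(2)[OF u(2)])
    have q0: "q d = 0" if "d \<notin> D" for d
      using that q(1)[of d] lincomb_inject[of "q d" 0] by (simp add: D_def)
    \<comment> \<open>From the expansion \<open>q d\<close> of the \<open>d\<close>-th coefficient
      only the part of weight exactly \<open>d\<close> is kept, the rest being zero in the quotient.
      Outside the finite set \<open>D\<close> the expansion is zero, so \<open>f\<close> misses
      nothing.\<close>
    define f where "f = (\<Sum>d\<in>D. poly_part (q d) (\<phi> -` {d}))"
    have look: "Poly_Mapping.lookup f x = Poly_Mapping.lookup (q (\<phi> x)) x" for x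
    proof -
      have "Poly_Mapping.lookup f x = (\<Sum>d\<in>D. if d = \<phi> x then Poly_Mapping.lookup (q (\<phi> x)) x else 0)"
        unfolding f_def lookup_sum by (rule sum.cong) (auto simp: lookup_poly_part)
      also have "\<dots> = Poly_Mapping.lookup (q (\<phi> x)) x"
        using D q0[of "\<phi> x"] by (cases "\<phi> x \<in> D") simp_all
      finally show ?thesis .
    qed
    have "z = iso_gr f"
      unfolding u(1) iso_gr_def gr_filt.graded_class_eq_iff filt_prev_eq_below
    proof
      fix d
      have "Poly_Mapping.keys (q d - poly_part f (\<phi> -` {d})) \<subseteq> {x. \<phi> x < d}"
      proof
        fix x assume "x \<in> Poly_Mapping.keys (q d - poly_part f (\<phi> -` {d}))"
        then have *: "Poly_Mapping.lookup (q d) x \<noteq> 0 \<and> \<phi> x \<noteq> d"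
          by (cases "\<phi> x = d") (auto simp: in_keys_iff lookup_minus lookup_poly_part look)
        then have "x \<in> Poly_Mapping.keys (q d)" by (simp add: in_keys_iff)
        then have "\<phi> x < Suc d" using q(2)[of d] by blast
        with * show "x \<in> {x. \<phi> x < d}" by simp
      qed
      then show "fps_nth u d - fps_nth (weight_series \<phi> e f) d \<in> below d"
        by (simp add: q(1) weight_series_def lincomb_diff[symmetric] lincomb_below_iff)
    qed
    then show "z \<in> range iso_gr" by (rule range_eqI)
  qed
qed

lemma iso_gr_ring_iso: "iso_gr \<in> ring_iso (twisted_algebra \<alpha>) gr"
  unfolding ring_iso_def
proof (intro CollectI conjI ring_hom_memI)
  show "iso_gr \<one>\<^bsub>twisted_algebra \<alpha>\<^esub> = \<one>\<^bsub>gr\<^esub>"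
    using iso_gr_one by (simp add: twisted_algebra_def)
  show "bij_betw iso_gr (carrier (twisted_algebra \<alpha>)) (carrier gr)"
    using iso_gr_inj iso_gr_surj by (simp add: twisted_algebra_def bij_betw_def)
  show "iso_gr (f \<otimes>\<^bsub>twisted_algebra \<alpha>\<^esub> g) = iso_gr f \<otimes>\<^bsub>gr\<^esub> iso_gr g" for f g
    by (rule iso_gr_mult)
  show "iso_gr (f \<oplus>\<^bsub>twisted_algebra \<alpha>\<^esub> g) = iso_gr f \<oplus>\<^bsub>gr\<^esub> iso_gr g" for f g
    by (simp add: twisted_algebra_def iso_gr_add)
qed (rule iso_gr_carrier)

lemma iso_gr_sum:
  assumes "finite T"
  shows "iso_gr (\<Sum>t\<in>T. k t) = finsum gr (\<lambda>t. iso_gr (k t)) T"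
proof -
  interpret gr: ring gr by (rule gr_filt.ring_gr)
  from assms show ?thesis
    by (induction T) (simp_all add: iso_gr_zero iso_gr_add iso_gr_carrier Pi_I)
qed

end

section \<open>The \<nat>^(r+1)-grading of the associated graded algebra\<close>

context adapted_basis
begin

abbreviation gr_comp :: "(nat \<Rightarrow> nat) \<Rightarrow> (nat \<Rightarrow> 'a set) set" where
  "gr_comp \<equiv> assoc_graded_component scale r \<A> filt"

definition basis_deg :: "'s \<Rightarrow> nat \<Rightarrow> nat" where
  "basis_deg x = (SOME v. v \<in> Npow r \<and> e x \<in> \<A> v)"

lemma basis_deg: "basis_deg x \<in> Npow r" "e x \<in> \<A> (basis_deg x)"
proof -
  have "\<exists>v. v \<in> Npow r \<and> e x \<in> \<A> v" using basis_homogeneous[of x] by blast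
  then have "basis_deg x \<in> Npow r \<and> e x \<in> \<A> (basis_deg x)"
    unfolding basis_deg_def by (rule someI_ex)
  then show "basis_deg x \<in> Npow r" "e x \<in> \<A> (basis_deg x)" by simp_all
qed

definition total_deg :: "'s \<Rightarrow> nat \<Rightarrow> nat" where
  "total_deg x = (basis_deg x)(r := \<phi> x)"

lemma total_deg: "total_deg x \<in> Npow (Suc r)" "total_deg x r = \<phi> x" "(total_deg x)(r := 0) = basis_deg x"
  using basis_deg(1)[of x] by (auto simp: total_deg_def Npow_def)

lemma Npow_Suc_reset:
  assumes "v \<in> Npow (Suc r)"
  shows "v(r := 0) \<in> Npow r"
  unfolding Npow_def
proof (intro CollectI allI impI)
  fix i assume "r \<le> i"
  then show "(v(r := 0)) i = 0" using assms by (cases "i = r") (simp_all add: Npow_def)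
qed

text \<open>Grouping the basis elements by degree gives a sum of homogeneous pieces; directness
  leaves only the piece of degree \<open>w\<close>, and independence carries this back to the
  coefficients.\<close>

lemma homogeneous_lincomb:
  assumes a: "lincomb scale e q \<in> \<A> w" and w: "w \<in> Npow r"
  shows "Poly_Mapping.keys q \<subseteq> basis_deg -` {w}"
proof -
  define T where "T = basis_deg ` Poly_Mapping.keys q"
  define g where "g t = lincomb scale e (poly_part q (basis_deg -` {t}))" for t
  have T: "finite T" "T \<subseteq> Npow r" using basis_deg(1) by (auto simp: T_def)
  have g: "g t \<in> \<A> t" if "t \<in> T" for t
    unfolding g_def lincomb_def
  proof (rule subspace_sum)
    show "subspace (\<A> t)" using T(2) that by (intro subspace_component) blast
    then show "scale (Poly_Mapping.lookup (poly_part q (basis_deg -` {t})) x) (e x) \<in> \<A> t"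
      if "x \<in> Poly_Mapping.keys (poly_part q (basis_deg -` {t}))" for x
      using that basis_deg(2)[of x] by (intro subspace_scale) (auto simp: keys_poly_part)
  qed
  have "(\<Sum>t\<in>T. poly_part q (basis_deg -` {t})) = q"
    by (rule sum_poly_part_fibres) (simp_all add: T_def)
  then have sum: "(\<Sum>t\<in>T. g t) = lincomb scale e q"
    unfolding g_def lincomb_sum[symmetric] by simp
  have "lincomb scale e q = (if w \<in> T then g w else 0)"
    using component_of_sum[OF T g w] a unfolding sum by simp
  also have "\<dots> = lincomb scale e (poly_part q (basis_deg -` {w}))"
  proof (cases "w \<in> T")
    case False
    then have "Poly_Mapping.keys (poly_part q (basis_deg -` {w})) = {}"
      by (auto simp: keys_poly_part T_def)
    with False show ?thesis by (simp add: keys_eq_empty)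
  qed (simp add: g_def)
  finally have "q = poly_part q (basis_deg -` {w})" by (rule lincomb_inject)
  then show ?thesis using keys_poly_part[of q "basis_deg -` {w}"] by auto
qed

text \<open>Under \<open>iso_gr\<close> the component of degree \<open>v\<close> is spanned by the
  \<open>X^x\<close> of total degree \<open>v\<close>. The decomposition of the associated graded
  algebra thus becomes the partition of \<open>S\<close> into fibres of
  \<open>total_deg\<close>.\<close>

lemma gr_comp_eq:
  assumes v: "v \<in> Npow (Suc r)"
  shows "gr_comp v = iso_gr ` {f. Poly_Mapping.keys f \<subseteq> total_deg -` {v}}"
proof
  show "gr_comp v \<subseteq> iso_gr ` {f. Poly_Mapping.keys f \<subseteq> total_deg -` {v}}"
  proof
    fix x assume "x \<in> gr_comp v"
    then obtain a where a: "a \<in> filt (v r)" "a \<in> \<A> (v(r := 0))"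
      "x = gr_filt.graded_class (mono_fps (v r) a)"
      unfolding gr_filt.mem_assoc_graded_component_iff by blast
    obtain q where q: "a = lincomb scale e q" "Poly_Mapping.keys q \<subseteq> {u. \<phi> u < Suc (v r)}"
      using a(1) unfolding filt_def below_def span_image_eq_lincomb by blast
    have q': "Poly_Mapping.keys q \<subseteq> basis_deg -` {v(r := 0)}"
      using a(2) unfolding q(1) by (rule homogeneous_lincomb[OF _ Npow_Suc_reset[OF v]])
    \<comment> \<open>The expansion of \<open>a\<close> may contain terms of smaller weight; they do
      not affect the class and are discarded so that the support lies in one fibre.\<close>
    define f where "f = poly_part q (\<phi> -` {v r})"
    have "Poly_Mapping.keys f \<subseteq> total_deg -` {v}"
    proof
      fix y assume "y \<in> Poly_Mapping.keys f"
      then have "\<phi> y = v r" "basis_deg y = v(r := 0)"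
        using q' by (auto simp: f_def keys_poly_part)
      then show "y \<in> total_deg -` {v}" by (simp add: total_deg_def)
    qed
    moreover have "x = iso_gr f"
      unfolding a(3) iso_gr_def gr_filt.graded_class_eq_iff filt_prev_eq_below
    proof
      fix d
      show "fps_nth (mono_fps (v r) a) d - fps_nth (weight_series \<phi> e f) d \<in> below d"
      proof (cases "d = v r")
        case True
        have f: "poly_part f (\<phi> -` {v r}) = f"
          by (rule poly_mapping_eqI) (simp add: f_def lookup_poly_part)
        have "Poly_Mapping.keys (q - f) \<subseteq> {u. \<phi> u < v r}"
        proof
          fix y assume "y \<in> Poly_Mapping.keys (q - f)"
          then have "y \<in> Poly_Mapping.keys q" "\<phi> y \<noteq> v r"
            by (auto simp: in_keys_iff lookup_minus f_def lookup_poly_part split: if_splits)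
          then show "y \<in> {u. \<phi> u < v r}" using q(2) by fastforce
        qed
        then show ?thesis
          using True by (simp add: weight_series_def f q(1) lincomb_diff[symmetric] lincomb_below_iff)
      next
        case False
        then have "poly_part f (\<phi> -` {d}) = 0"
          by (intro poly_mapping_eqI) (simp add: f_def lookup_poly_part)
        then show ?thesis using False by (simp add: weight_series_def subspace_0)
      qed
    qed
    ultimately show "x \<in> iso_gr ` {f. Poly_Mapping.keys f \<subseteq> total_deg -` {v}}" by blast
  qed
  show "iso_gr ` {f. Poly_Mapping.keys f \<subseteq> total_deg -` {v}} \<subseteq> gr_comp v"
  proof clarify
    fix f :: "'s \<Rightarrow>\<^sub>0 'k" assume f: "Poly_Mapping.keys f \<subseteq> total_deg -` {v}"
    have deg: "\<phi> y = v r" "basis_deg y = v(r := 0)" if "y \<in> Poly_Mapping.keys f" for y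
      using f that total_deg(2,3)[of y] by auto
    let ?a = "lincomb scale e f"
    have "?a \<in> filt (v r)"
      unfolding filt_def lincomb_below_iff using deg(1) by auto
    moreover have "?a \<in> \<A> (v(r := 0))"
      unfolding lincomb_def
    proof (rule subspace_sum)
      show "subspace (\<A> (v(r := 0)))" by (rule subspace_component[OF Npow_Suc_reset[OF v]])
      then show "scale (Poly_Mapping.lookup f y) (e y) \<in> \<A> (v(r := 0))"
        if "y \<in> Poly_Mapping.keys f" for y
        using basis_deg(2)[of y] deg(2)[OF that] by (intro subspace_scale) simp_all
    qed
    moreover have "weight_series \<phi> e f = mono_fps (v r) ?a"
    proof (rule fps_ext)
      fix d
      have "poly_part f (\<phi> -` {d}) = (if d = v r then f else 0)"
      proof (rule poly_mapping_eqI)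
        fix y
        show "Poly_Mapping.lookup (poly_part f (\<phi> -` {d})) y =
            Poly_Mapping.lookup (if d = v r then f else 0) y"
          using deg(1)[of y] by (cases "y \<in> Poly_Mapping.keys f") (auto simp: lookup_poly_part in_keys_iff)
      qed
      then show "fps_nth (weight_series \<phi> e f) d = fps_nth (mono_fps (v r) ?a) d"
        by (simp add: weight_series_def)
    qed
    ultimately show "iso_gr f \<in> gr_comp v"
      unfolding gr_filt.mem_assoc_graded_component_iff iso_gr_def
      by (intro bexI[of _ ?a]) simp_all
  qed
qed

lemma gr_comp_unique_decomposition:
  assumes x: "x \<in> carrier gr"
  shows "\<exists>!g. (\<forall>v\<in>Npow (Suc r). g v \<in> gr_comp v) \<and>
    (\<forall>v. v \<notin> Npow (Suc r) \<longrightarrow> g v = \<zero>\<^bsub>gr\<^esub>) \<and>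
    finite {v. g v \<noteq> \<zero>\<^bsub>gr\<^esub>} \<and> x = finsum gr g {v. g v \<noteq> \<zero>\<^bsub>gr\<^esub>}"
proof -
  interpret gr: ring gr by (rule gr_filt.ring_gr)
  obtain f where f: "x = iso_gr f" using x unfolding iso_gr_surj[symmetric] by blast
  define k where "k v = poly_part f (total_deg -` {v})" for v
  have keys_k: "Poly_Mapping.keys (k v) \<subseteq> total_deg -` {v}" for v
    by (auto simp: k_def keys_poly_part)
  have zero_iff: "iso_gr g = \<zero>\<^bsub>gr\<^esub> \<longleftrightarrow> g = 0" for g
    using iso_gr_inj unfolding iso_gr_zero[symmetric] by (simp add: inj_eq)
  show ?thesis
  proof (rule ex1I[of _ "\<lambda>v. iso_gr (k v)"], intro conjI ballI allI impI)
    show "iso_gr (k v) \<in> gr_comp v" if "v \<in> Npow (Suc r)" for v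
      unfolding gr_comp_eq[OF that] using keys_k by blast
    show "iso_gr (k v) = \<zero>\<^bsub>gr\<^esub>" if "v \<notin> Npow (Suc r)" for v
    proof -
      have "total_deg y \<noteq> v" for y using total_deg(1)[of y] that by auto
      then have "k v = 0" by (intro poly_mapping_eqI) (simp add: k_def lookup_poly_part)
      then show ?thesis by (simp add: zero_iff)
    qed
    have supp: "{v. iso_gr (k v) \<noteq> \<zero>\<^bsub>gr\<^esub>} = total_deg ` Poly_Mapping.keys f"
    proof -
      have "k v = 0 \<longleftrightarrow> v \<notin> total_deg ` Poly_Mapping.keys f" for v
        unfolding keys_eq_empty[symmetric] k_def keys_poly_part by auto
      then show ?thesis by (simp add: zero_iff)
    qed
    show "finite {v. iso_gr (k v) \<noteq> \<zero>\<^bsub>gr\<^esub>}" unfolding supp by simp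
    have "(\<Sum>v\<in>total_deg ` Poly_Mapping.keys f. k v) = f"
      unfolding k_def by (rule sum_poly_part_fibres) simp_all
    then show "x = finsum gr (\<lambda>v. iso_gr (k v)) {v. iso_gr (k v) \<noteq> \<zero>\<^bsub>gr\<^esub>}"
      unfolding supp f by (simp add: iso_gr_sum[symmetric])
  next
    fix g assume g: "(\<forall>v\<in>Npow (Suc r). g v \<in> gr_comp v) \<and>
      (\<forall>v. v \<notin> Npow (Suc r) \<longrightarrow> g v = \<zero>\<^bsub>gr\<^esub>) \<and>
      finite {v. g v \<noteq> \<zero>\<^bsub>gr\<^esub>} \<and> x = finsum gr g {v. g v \<noteq> \<zero>\<^bsub>gr\<^esub>}"
    have "\<exists>l. Poly_Mapping.keys l \<subseteq> total_deg -` {v} \<and> g v = iso_gr l" for v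
    proof (cases "v \<in> Npow (Suc r)")
      case True
      then show ?thesis using g gr_comp_eq[OF True] by blast
    next
      case False
      then show ?thesis using g by (intro exI[of _ 0]) (simp add: iso_gr_zero)
    qed
    then obtain l where l: "\<And>v. Poly_Mapping.keys (l v) \<subseteq> total_deg -` {v}" "\<And>v. g v = iso_gr (l v)"
      by metis
    have gl: "g = (\<lambda>v. iso_gr (l v))" using l(2) by (simp add: fun_eq_iff)
    define T where "T = {v. g v \<noteq> \<zero>\<^bsub>gr\<^esub>}"
    have T: "finite T" using g by (simp add: T_def)
    have lT: "l v = 0" if "v \<notin> T" for v
      using that unfolding T_def l(2) by (simp add: zero_iff)
    have "iso_gr f = finsum gr (\<lambda>v. iso_gr (l v)) T"
      using g unfolding f T_def gl by (elim conjE)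
    also have "\<dots> = iso_gr (\<Sum>v\<in>T. l v)" by (rule iso_gr_sum[OF T, symmetric])
    finally have fl: "f = (\<Sum>v\<in>T. l v)" by (rule injD[OF iso_gr_inj])
    \<comment> \<open>The index \<open>y\<close> occurs in \<open>l u\<close> only for
      \<open>u = total_deg y\<close>, so the coefficients of \<open>f\<close> determine each
      component.\<close>
    have "l v = k v" for v
    proof (rule poly_mapping_eqI)
      fix y
      have zero: "Poly_Mapping.lookup (l u) y = 0" if "u \<noteq> total_deg y" for u
        using l(1)[of u] that by (auto simp: in_keys_iff)
      have "Poly_Mapping.lookup f y = (\<Sum>u\<in>T. if u = total_deg y then Poly_Mapping.lookup (l u) y else 0)"
        unfolding fl lookup_sum by (rule sum.cong) (auto simp: zero)
      also have "\<dots> = Poly_Mapping.lookup (l (total_deg y)) y"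
        using T lT[of "total_deg y"] by (cases "total_deg y \<in> T") simp_all
      finally have "Poly_Mapping.lookup f y = Poly_Mapping.lookup (l (total_deg y)) y" .
      then show "Poly_Mapping.lookup (l v) y = Poly_Mapping.lookup (k v) y"
        using zero[of v] by (auto simp: k_def lookup_poly_part)
    qed
    then show "g = (\<lambda>v. iso_gr (k v))" by (simp add: fun_eq_iff l(2))
  qed
qed

lemma scale_mono_fps: "gr_filt.scale_fps c (mono_fps d a) = mono_fps d (scale c a)"
  by (rule fps_ext) simp

lemma connected_graded_gr: "connected_graded_algebra (Suc r) gr gr_comp"
  unfolding connected_graded_algebra_def graded_algebra_def
proof (intro conjI ballI allI)
  interpret gr: ring gr by (rule gr_filt.ring_gr)
  show "k_algebra gr" by (rule gr_filt.k_algebra_gr)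
  show "\<exists>!g. (\<forall>v\<in>Npow (Suc r). g v \<in> gr_comp v) \<and>
      (\<forall>v. v \<notin> Npow (Suc r) \<longrightarrow> g v = \<zero>\<^bsub>gr\<^esub>) \<and>
      finite {v. g v \<noteq> \<zero>\<^bsub>gr\<^esub>} \<and> x = finsum gr g {v. g v \<noteq> \<zero>\<^bsub>gr\<^esub>}" if "x \<in> carrier gr" for x
    by (rule gr_comp_unique_decomposition[OF that])
  show "x \<otimes>\<^bsub>gr\<^esub> y \<in> gr_comp (v + w)"
    if vw: "v \<in> Npow (Suc r)" "w \<in> Npow (Suc r)" and xy: "x \<in> gr_comp v" "y \<in> gr_comp w" for v w x y
  proof -
    obtain a b where a: "a \<in> filt (v r)" "a \<in> \<A> (v(r := 0))" "x = gr_filt.graded_class (mono_fps (v r) a)"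
      and b: "b \<in> filt (w r)" "b \<in> \<A> (w(r := 0))" "y = gr_filt.graded_class (mono_fps (w r) b)"
      using xy unfolding gr_filt.mem_assoc_graded_component_iff by blast
    have "a * b \<in> \<A> (v(r := 0) + w(r := 0))"
      by (rule component_mult[OF Npow_Suc_reset[OF vw(1)] Npow_Suc_reset[OF vw(2)] a(2) b(2)])
    also have "v(r := 0) + w(r := 0) = (v + w)(r := 0)" by (simp add: fun_eq_iff)
    finally have "a * b \<in> \<A> ((v + w)(r := 0))" .
    moreover have "a * b \<in> filt ((v + w) r)" using gr_filt.filt_mult[OF a(1) b(1)] by simp
    moreover have "x \<otimes>\<^bsub>gr\<^esub> y = gr_filt.graded_class (mono_fps ((v + w) r) (a * b))"
      unfolding a(3) b(3)
      by (simp add: gr_filt.gr_mult gr_filt.rees_mono a(1) b(1) mono_fps_mult)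
    ultimately show ?thesis unfolding gr_filt.mem_assoc_graded_component_iff by blast
  qed
  fix v assume v: "v \<in> Npow (Suc r)"
  show "c \<odot>\<^bsub>gr\<^esub> x \<in> gr_comp v" if "x \<in> gr_comp v" for c x
  proof -
    obtain f where f: "Poly_Mapping.keys f \<subseteq> total_deg -` {v}" "x = iso_gr f"
      using \<open>x \<in> gr_comp v\<close> unfolding gr_comp_eq[OF v] by blast
    then have "Poly_Mapping.keys (Poly_Mapping.map ((*) c) f) \<subseteq> total_deg -` {v}"
      by (auto simp: in_keys_iff)
    then show ?thesis
      unfolding gr_comp_eq[OF v] f(2) iso_gr_smult[symmetric] by blast
  qed
  show "additive_subgroup (gr_comp v) gr"
    unfolding additive_subgroup_def
  proof (rule group.subgroupI)
    show "group (add_monoid gr)" by (rule gr.add.is_group)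
    show "gr_comp v \<subseteq> carrier (add_monoid gr)"
      by (auto simp: gr_comp_eq[OF v] iso_gr_carrier)
    have "iso_gr 0 \<in> gr_comp v" unfolding gr_comp_eq[OF v] by (intro imageI) simp
    then show "gr_comp v \<noteq> {}" by blast
    fix x assume "x \<in> gr_comp v"
    then obtain f where f: "Poly_Mapping.keys f \<subseteq> total_deg -` {v}" "x = iso_gr f"
      unfolding gr_comp_eq[OF v] by blast
    have "iso_gr (- f) \<oplus>\<^bsub>gr\<^esub> x = \<zero>\<^bsub>gr\<^esub>"
      by (simp add: f(2) iso_gr_add[symmetric] iso_gr_zero)
    then have "\<ominus>\<^bsub>gr\<^esub> x = iso_gr (- f)"
      by (intro gr.minus_equality) (simp_all add: f(2) iso_gr_carrier)
    moreover have "iso_gr (- f) \<in> gr_comp v"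
      unfolding gr_comp_eq[OF v] using f(1) by (intro imageI) (simp add: keys_minus)
    ultimately show "inv\<^bsub>add_monoid gr\<^esub> x \<in> gr_comp v"
      unfolding a_inv_def by simp
    fix y assume "y \<in> gr_comp v"
    then obtain g where g: "Poly_Mapping.keys g \<subseteq> total_deg -` {v}" "y = iso_gr g"
      unfolding gr_comp_eq[OF v] by blast
    have "Poly_Mapping.keys (f + g) \<subseteq> total_deg -` {v}"
      using Poly_Mapping.keys_add[of f g] f(1) g(1) by blast
    then have "iso_gr (f + g) \<in> gr_comp v" unfolding gr_comp_eq[OF v] by blast
    then show "x \<otimes>\<^bsub>add_monoid gr\<^esub> y \<in> gr_comp v"
      by (simp add: f(2) g(2) iso_gr_add)
  qed
next
  show "\<one>\<^bsub>gr\<^esub> \<noteq> \<zero>\<^bsub>gr\<^esub>"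
  proof
    assume "\<one>\<^bsub>gr\<^esub> = \<zero>\<^bsub>gr\<^esub>"
    then have "fps_nth (1 :: 'a fps) 0 - fps_nth 0 0 \<in> below 0"
      unfolding gr_filt.gr_one gr_filt.gr_zero gr_filt.graded_class_eq_iff filt_prev_eq_below
      by (rule spec)
    then show False by (simp add: below_def)
  qed
next
  have mono0: "c \<odot>\<^bsub>gr\<^esub> \<one>\<^bsub>gr\<^esub> = gr_filt.graded_class (mono_fps 0 (scale c 1))" for c
  proof -
    have one: "(1 :: 'a fps) = mono_fps 0 1" by (rule fps_ext) (simp add: fps_one_nth)
    show ?thesis unfolding gr_filt.gr_one gr_filt.gr_smult one scale_mono_fps ..
  qed
  have "(0 :: nat \<Rightarrow> nat)(r := 0) = 0" by (simp add: fun_eq_iff)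
  then have "x \<in> gr_comp 0 \<longleftrightarrow> x \<in> range (\<lambda>c. c \<odot>\<^bsub>gr\<^esub> \<one>\<^bsub>gr\<^esub>)" for x
    unfolding gr_filt.mem_assoc_graded_component_iff mono0
    by (auto simp: filt_zero_eq component_zero)
  then show "gr_comp 0 = range (\<lambda>c. c \<odot>\<^bsub>gr\<^esub> \<one>\<^bsub>gr\<^esub>)" by blast
qed

theorem imp_quantum_toric_degeneration:
  assumes "\<And>d. finite {u. \<phi> u \<le> d}"
  shows "quantum_toric_degeneration scale r \<A> TYPE('s)"
proof -
  have "\<exists>v\<in>Npow (Suc r). v \<noteq> 0 \<and> iso_gr (Poly_Mapping.single x 1) \<in> gr_comp v" if "x \<noteq> 0" for x
  proof (intro bexI[of _ "total_deg x"] conjI)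
    have "total_deg x r \<noteq> 0" using that weight_zero_iff by (simp add: total_deg(2))
    then show "total_deg x \<noteq> 0" by auto
    show "iso_gr (Poly_Mapping.single x 1) \<in> gr_comp (total_deg x)"
      unfolding gr_comp_eq[OF total_deg(1)] by (intro imageI) simp
  qed (rule total_deg(1))
  moreover have "iso_gr (c \<odot>\<^bsub>twisted_algebra \<alpha>\<^esub> f) = c \<odot>\<^bsub>gr\<^esub> iso_gr f" for c f
    using iso_gr_smult by (simp add: twisted_algebra_def)
  ultimately have "quantum_positive_affine_toric (Suc r) gr gr_comp TYPE('s)"
    unfolding quantum_positive_affine_toric_def
    using connected_graded_gr two_cocycle_structure iso_gr_ring_iso by blast
  then show ?thesis
    unfolding quantum_toric_degeneration_def using connected_filtration_filt[OF assms] by blast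
qed

end

theorem mainTheorem3:
  fixes scale :: "'k::field \<Rightarrow> 'a::ring_1 \<Rightarrow> 'a"
    and r n :: nat
    and \<A> :: "(nat \<Rightarrow> nat) \<Rightarrow> 'a set"
    and s :: "nat \<Rightarrow> 's::comm_monoid_add"
  assumes "positive_affine_semigroup TYPE('s)"
    and "bij_betw s {..<n} hilbert_basis"
    and "connected_graded_algebra r (algebra_of_type scale) \<A>"
    and "noetherian_type TYPE('a)"
  shows
    "(quantum_toric_degeneration scale r \<A> TYPE('s) \<longleftrightarrow>
        (\<forall>P. presentation n s P \<longrightarrow>
           (\<exists>\<phi> b. S_phi_type scale r \<A> n s P \<phi> b \<and>
              (\<forall>\<tau>. pres_section n s \<tau> \<longrightarrow>
                 independent_family scale (\<lambda>x. monomial_at n b (\<tau> x))))))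
     \<and> (quantum_toric_degeneration scale r \<A> TYPE('s) \<longleftrightarrow>
        (\<exists>P \<phi> \<tau> b. presentation n s P \<and> pres_section n s \<tau> \<and>
           S_phi_type scale r \<A> n s P \<phi> b \<and>
           independent_family scale (\<lambda>x. monomial_at n b (\<tau> x))))"
    (is "(?D \<longleftrightarrow> ?Q) \<and> (?D \<longleftrightarrow> ?R)")
proof -
  interpret graded_unital_algebra scale r \<A>
    by (rule connected_graded_algebra_imp_graded_unital_algebra[OF assms(3)])
  have 1: ?Q if D: ?D
  proof (intro allI impI)
    fix P assume P: "presentation n s P"
    obtain \<phi> :: "'s \<Rightarrow> nat" and e \<alpha> where "adapted_basis scale r \<A> \<phi> e \<alpha>"
      using quantum_toric_degeneration_imp_adapted_basis[OF D] by blast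
    then interpret adapted_basis scale r \<A> \<phi> e \<alpha> .
    show "\<exists>\<phi> b. S_phi_type scale r \<A> n s P \<phi> b \<and>
        (\<forall>\<tau>. pres_section n s \<tau> \<longrightarrow> independent_family scale (\<lambda>x. monomial_at n b (\<tau> x)))"
      by (rule exI[of _ \<phi>]) (rule imp_S_phi_type[OF assms(1,2) P])
  qed
  have 2: ?R if ?Q
  proof -
    \<comment> \<open>Statement (2) quantifies universally over presentations and sections; (3)
      follows because both exist.\<close>
    obtain P where P: "presentation n s P" using presentation_exists[OF assms(1)] by blast
    obtain \<tau> where \<tau>: "pres_section n s \<tau>" using pres_section_exists[OF assms(1,2)] by blast
    show ?thesis using that P \<tau> by blast
  qed
  have 3: ?D if R: ?R
  proof -
    obtain P \<phi> \<tau> b where P: "presentation n s P" and \<tau>: "pres_section n s \<tau>"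
      and type: "S_phi_type scale r \<A> n s P \<phi> b"
      and ind: "independent_family scale (\<lambda>x. monomial_at n b (\<tau> x))"
      using R by blast
    interpret S_phi_algebra scale r \<A> n s P \<phi> b by unfold_locales (rule type, rule P)
    obtain \<alpha> where "adapted_basis scale r \<A> \<phi> (\<lambda>x. monomial_at n b (\<tau> x)) \<alpha>"
      using imp_adapted_basis[OF \<tau> ind] by blast
    then show ?thesis
    proof (rule adapted_basis.imp_quantum_toric_degeneration)
      show "finite {u. \<phi> u \<le> d}" for d
        using type by (intro finite_weight_le[OF assms(1,2)]) (simp_all add: S_phi_type_def)
    qed
  qed
  from 1 2 3 show ?thesis by blast
qed

end
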